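(* The pair $(\le^{=_2}_{dop},\cong_{dop})$ on ${}^{\mathbb Q}2$ is invariantly universal. Consequently, if $R$ is a quasi-order on $\omega$ with at least two $R$-incomparable elements, then the pair $(\le^R_{dop},\cong_{dop})$ on ${}^{\mathbb Q}\omega$ is invariantly universal.
   Context: A function $g\colon\mathbb Q\to\mathbb Q$ is dense order preserving if it is strictly increasing and for all $q_0,q_1,r_0,r_1\in\mathbb Q$ with $g(q_0)<r_0<r_1<g(q_1)$ there is $q\in\mathbb Q$ with $r_0<g(q)<r_1$. For a quasi-order $R$ on a countable set $C$, $\le^R_{dop}$ is the quasi-order on ${}^{\mathbb Q}C$ with $c\le^R_{dop}c'$ iff there is a dense order preserving $g$ with $c(q)\,R\,c'(g(q))$ for all $q$; $\le^{=_2}_{dop}$ is the case $C=2=\{0,1\}$ with $R$ equality. $c\cong_{dop}c'$ iff there is an order automorphism $h$ of $\mathbb Q$ with $c(q)=c'(h(q))$ for all $q$. Borel reducibility: for binary relations $R,R'$ on standard Borel spaces $X,X'$, a Borel $h\colon X\to X'$ with $x\,R\,y \iff h(x)\,R'\,h(y)$ is a Borel reduction, written $R\le_B R'$; $R\sim_B R'$ means $R\le_B R'\le_B R$. For an analytic quasi-order $S$ on a standard Borel space $X$ and an analytic equivalence relation $E\subseteq S\cap S^{-1}$ on $X$, the pair $(S,E)$ is invariantly universal if for every analytic quasi-order $R$ on a standard Borel space there is a Borel $E$-invariant $B\subseteq X$ with $R\sim_B S\restriction B$. *)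

theory Defs
  imports "HOL-Analysis.Analysis"
begin

text \<open>
  Borel structures are carried by the type \<^typ>\<open>'a measure\<close>; only the carrier
  \<^const>\<open>space\<close> and the sigma-algebra \<^const>\<open>sets\<close> are ever used, the measure itself is ignored.
  Binary relations are sets of pairs.
\<close>

definition Polish_space :: "'a topology \<Rightarrow> bool" where
  "Polish_space T \<longleftrightarrow> separable_space T \<and> completely_metrizable_space T"

definition standard_Borel :: "'a measure \<Rightarrow> bool" where
  "standard_Borel X \<longleftrightarrow>
    (\<exists>T. topspace T = space X \<and> Polish_space T \<and>
         sets X = sigma_sets (space X) {U. openin T U})"

text \<open>Analytic sets are the projections of Borel subsets of the product with the Baire space
  \<^typ>\<open>nat \<Rightarrow> nat\<close>, whose \<^const>\<open>borel\<close> structure is that of the product of discrete topologies.\<close>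

definition analytic_in :: "'a measure \<Rightarrow> 'a set \<Rightarrow> bool" where
  "analytic_in X A \<longleftrightarrow>
    (\<exists>W \<in> sets (X \<Otimes>\<^sub>M (borel :: (nat \<Rightarrow> nat) measure)). A = fst ` W)"

definition analytic_quasi_order :: "'a measure \<Rightarrow> 'a rel \<Rightarrow> bool" where
  "analytic_quasi_order X S \<longleftrightarrow> preorder_on (space X) S \<and> analytic_in (X \<Otimes>\<^sub>M X) S"

definition analytic_equivalence :: "'a measure \<Rightarrow> 'a rel \<Rightarrow> bool" where
  "analytic_equivalence X E \<longleftrightarrow> equiv (space X) E \<and> analytic_in (X \<Otimes>\<^sub>M X) E"

definition Borel_reducible :: "'a measure \<Rightarrow> 'a rel \<Rightarrow> 'b measure \<Rightarrow> 'b rel \<Rightarrow> bool" where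
  "Borel_reducible X R Y R' \<longleftrightarrow>
    (\<exists>h \<in> X \<rightarrow>\<^sub>M Y. \<forall>x \<in> space X. \<forall>y \<in> space X. (x, y) \<in> R \<longleftrightarrow> (h x, h y) \<in> R')"

definition Borel_bireducible :: "'a measure \<Rightarrow> 'a rel \<Rightarrow> 'b measure \<Rightarrow> 'b rel \<Rightarrow> bool" where
  "Borel_bireducible X R Y R' \<longleftrightarrow> Borel_reducible X R Y R' \<and> Borel_reducible Y R' X R"

text \<open>HOL cannot quantify over types inside a formula. The type \<^typ>\<open>'b\<close> containing the carriers
  of the standard Borel spaces \<open>Y\<close> is therefore a parameter; a theorem in which it is a type
  variable covers all standard Borel spaces. The standing requirements on the pair
  \<open>(S, E)\<close> are part of the definition.\<close>

definition invariantly_universal ::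
    "'b itself \<Rightarrow> 'a measure \<Rightarrow> 'a rel \<Rightarrow> 'a rel \<Rightarrow> bool" where
  "invariantly_universal (_ :: 'b itself) X S E \<longleftrightarrow>
    standard_Borel X \<and> analytic_quasi_order X S \<and> analytic_equivalence X E \<and>
    E \<subseteq> S \<inter> S\<inverse> \<and>
    (\<forall>(Y :: 'b measure) R. standard_Borel Y \<and> analytic_quasi_order Y R \<longrightarrow>
      (\<exists>B \<in> sets X. E `` B \<subseteq> B \<and>
         Borel_bireducible Y R (restrict_space X B) (S \<inter> B \<times> B)))"

definition dense_order_preserving :: "(rat \<Rightarrow> rat) \<Rightarrow> bool" where
  "dense_order_preserving g \<longleftrightarrow> strict_mono g \<and>
    (\<forall>q0 q1 r0 r1. g q0 < r0 \<and> r0 < r1 \<and> r1 < g q1 \<longrightarrow> (\<exists>q. r0 < g q \<and> g q < r1))"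

text \<open>For countable \<open>C\<close> this sigma-algebra is the Borel one of the product of
  discrete topologies.\<close>

definition rat_colourings :: "'c set \<Rightarrow> (rat \<Rightarrow> 'c) measure" where
  "rat_colourings C = (\<Pi>\<^sub>M q \<in> (UNIV :: rat set). count_space C)"

definition dop_le :: "'c set \<Rightarrow> 'c rel \<Rightarrow> (rat \<Rightarrow> 'c) rel" where
  "dop_le C R = {(c, c'). c \<in> UNIV \<rightarrow> C \<and> c' \<in> UNIV \<rightarrow> C \<and>
    (\<exists>g. dense_order_preserving g \<and> (\<forall>q. (c q, c' (g q)) \<in> R))}"

definition dop_iso :: "'c set \<Rightarrow> (rat \<Rightarrow> 'c) rel" where
  "dop_iso C = {(c, c'). c \<in> UNIV \<rightarrow> C \<and> c' \<in> UNIV \<rightarrow> C \<and>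
    (\<exists>h :: rat \<Rightarrow> rat. bij h \<and> strict_mono h \<and> (\<forall>q. c q = c' (h q)))}"

end

theory Submission
  imports Defs "HOL-Library.Diagonal_Subsequence" "HOL-Library.List_Lexorder"
begin

text \<open>
  After a Borel coding, an analytic quasi-order \<open>R\<close> lives on a Borel set \<open>D\<close> of binary sequences.
  Closing a closed representation of \<open>R\<close> under finite chains, and adding up the witnesses along a
  chain, gives relations \<open>S\<^sub>n\<close> on sequences of length \<open>n\<close> such that \<open>y R y'\<close> iff some \<open>x\<close> satisfies
  \<open>S\<^sub>n(y, y', x)\<close> for all \<open>n\<close>, and such that \<open>S\<^sub>n(u, v, s)\<close> and \<open>S\<^sub>n(v, w, t)\<close> imply
  \<open>S\<^sub>n(u, w, s + t)\<close>. Hence adding a witness \<open>t\<close> of \<open>y R y'\<close> maps \<open>{(u, s). S\<^sub>n(u, y, s)}\<close> into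
  \<open>{(u, s). S\<^sub>n(u, y', s)}\<close>.

  The colouring attached to \<open>y\<close> is built on the tree of finite integer sequences in its
  lexicographic order. A node \<open>a\<close>, with \<open>a\<^sub>i = 3 s\<^sub>i + u\<^sub>i\<close>, becomes a finite alternating sequence
  of monochromatic open intervals whose number determines the length of \<open>a\<close> and its last residue
  modulo \<open>3\<close>; for binary \<open>u\<close> the first interval has a maximum iff \<open>0 \<le> s\<close> and \<open>S\<^sub>n(u, y, s)\<close>.
  A dense order preserving map skips no interval, so it induces a tree embedding that acts on the
  children of each node as a translation of \<open>\<int>\<close> and sends intervals with a maximum to
  intervals with a maximum. Thus the image of the branch
  \<open>a = y\<close> is a witness for \<open>y R y'\<close>, and conversely a witness defines a translation.

  Nodes with last residue \<open>2\<close> mark the origin of each copy of \<open>\<int>\<close>. They make the labelling of a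
  colouring by tree nodes unique, so by the Lusin-Souslin theorem the saturation of the set of these
  colourings is Borel and \<open>y\<close> is a Borel function of the colouring.
\<close>

section \<open>Borel sets of sequences\<close>

text \<open>An embedding witnessing \<open>y R y'\<close> has to move the whole tree, not only the
  branch \<open>y\<close>. One translation serves all nodes at once because the finite
  approximations compose with additive witnesses; this is the reason for closing under chains. The
  danger is that approximating chains grow without bound. So the witness of every link starts with
  1: then \<open>s 0\<close> bounds the number of links, and compactness together with transitivity
  leads back to a single pair of \<open>R\<close>. Having a maximum is a good mark because an
  embedding cannot destroy it but may create it, so that marks give a quasi-order rather than an
  equivalence. Integer entries make the nodes dense in the lexicographic order: no two blocks are
  adjacent, hence adjacency of intervals detects the blocks. The price is that a copy of the
  integers has no visible origin. Residues 0 and 1 carry the bits of \<open>u\<close>, and residue 2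
  is free for markers that are the same for every \<open>y\<close>. They also exclude translations
  by negative amounts.\<close>

instantiation nat :: metric_space
begin

text \<open>The discrete metric turns products such as \<open>nat => nat\<close> into metric spaces,
  as \<open>open_eq_UN_closed\<close> and \<open>borel_imp_closed_projection\<close> require of the
  spaces of sequences.\<close>

definition dist_nat :: "nat \<Rightarrow> nat \<Rightarrow> real" where "dist_nat m n = (if m = n then 0 else 1)"

definition uniformity_nat :: "(nat \<times> nat) filter" where
  "uniformity_nat = (INF e\<in>{0 <..}. principal {(x, y). dist x y < e})"

instance
proof
  show "uniformity = (INF e\<in>{0 <..}. principal {(x :: nat, y). dist x y < e})"
    by (rule uniformity_nat_def)
  show "open U \<longleftrightarrow> (\<forall>x\<in>U. \<forall>\<^sub>F (x', y) in uniformity. x' = x \<longrightarrow> y \<in> U)" for U :: "nat set"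
  proof -
    have "\<forall>\<^sub>F (x', y) in uniformity. x' = x \<longrightarrow> y \<in> U" if "x \<in> U" for x
      unfolding uniformity_nat_def
      by (rule eventually_INF1[of "1/2"]) (use that in \<open>auto simp: eventually_principal dist_nat_def split: if_splits\<close>)
    then show ?thesis by (auto simp: open_discrete)
  qed
  show "dist x y = 0 \<longleftrightarrow> x = y" "dist x y \<le> dist x z + dist y z" for x y z :: nat
    by (auto simp: dist_nat_def)
qed

end

lemma tendsto_funI:
  fixes f :: "'b \<Rightarrow> 'i::countable \<Rightarrow> 'a::topological_space"
  assumes "\<And>i. ((\<lambda>x. f x i) \<longlongrightarrow> l i) G"
  shows "(f \<longlongrightarrow> l) G"
  using assms limitin_componentwise[of "\<lambda>_. euclidean :: 'a topology" "UNIV :: 'i set" f l G]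
  by (simp add: euclidean_product_topology limitin_canonical_iff)

lemma tendsto_agree:
  fixes z :: "nat \<Rightarrow> nat"
  assumes "\<And>n i. i < n \<Longrightarrow> x n i = z i"
  shows "x \<longlonglongrightarrow> z"
proof (rule tendsto_funI)
  fix i
  have "\<forall>\<^sub>F n in sequentially. x n i = z i"
    using assms eventually_gt_at_top[of i] by (metis (mono_tags, lifting) eventually_mono)
  then show "(\<lambda>n. x n i) \<longlonglongrightarrow> z i"
    by (rule tendsto_eventually)
qed

lemma continuous_coordinate: "continuous_on S (\<lambda>x :: nat \<Rightarrow> 'a::topological_space. x i)"
  by (rule continuous_on_product_then_coordinatewise[OF continuous_on_id])

lemma continuous_snd_coordinate:
  "continuous_on S (\<lambda>p :: 'b::topological_space \<times> ('i \<Rightarrow> 'a::topological_space). snd p i)"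
  by (rule continuous_on_product_then_coordinatewise[OF continuous_on_snd[OF continuous_on_id]])

section \<open>Borel sets as projections of closed sets\<close>

lemma closed_projection_UN:
  fixes A :: "nat \<Rightarrow> 'a::metric_space set"
  assumes "\<And>n. \<exists>F :: ('a \<times> (nat \<Rightarrow> nat)) set. closed F \<and> A n = fst ` F"
  shows "\<exists>F :: ('a \<times> (nat \<Rightarrow> nat)) set. closed F \<and> (\<Union>n. A n) = fst ` F"
proof -
  obtain F :: "nat \<Rightarrow> ('a \<times> (nat \<Rightarrow> nat)) set" where F: "\<And>n. closed (F n)" "\<And>n. A n = fst ` F n"
    using assms by metis
  \<comment> \<open>Entry 0 of a witness names the index of a set; the tail is a witness for that
    set.\<close>
  define T where "T = (\<lambda>p :: 'a \<times> (nat \<Rightarrow> nat). (fst p, \<lambda>n. snd p (Suc n)))"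
  define G where "G = (\<Inter>k. {p. snd p 0 \<noteq> k} \<union> T -` F k)"
  have T: "continuous_on UNIV T"
    unfolding T_def
    by (intro continuous_on_Pair continuous_on_fst continuous_on_id
            continuous_on_coordinatewise_then_product continuous_snd_coordinate)
  have "continuous_on UNIV (\<lambda>p :: 'a \<times> (nat \<Rightarrow> nat). snd p 0)"
    by (rule continuous_snd_coordinate)
  then have "closed ((\<lambda>p :: 'a \<times> (nat \<Rightarrow> nat). snd p 0) -` (- {k}))" for k
    by (rule closed_vimage[rotated]) (simp add: closed_def open_discrete)
  then have "closed {p :: 'a \<times> (nat \<Rightarrow> nat). snd p 0 \<noteq> k}" for k
    by (simp add: vimage_def)
  then have "closed G"
    unfolding G_def by (intro closed_INT closed_Un ballI closed_vimage F T)
  moreover have "(\<Union>n. A n) = fst ` G"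
  proof (intro equalityI subsetI)
    fix a assume "a \<in> (\<Union>n. A n)"
    then obtain n x where "(a, x) \<in> F n" using F(2) by fastforce
    then have "(a, \<lambda>i. case i of 0 \<Rightarrow> n | Suc j \<Rightarrow> x j) \<in> G" by (auto simp: G_def T_def)
    then show "a \<in> fst ` G" by force
  next
    fix a assume "a \<in> fst ` G"
    then obtain x where "(a, x) \<in> G" by auto
    then have "(a, \<lambda>n. x (Suc n)) \<in> F (x 0)" by (auto simp: G_def T_def)
    then show "a \<in> (\<Union>n. A n)" using F(2) by force
  qed
  ultimately show ?thesis by blast
qed

lemma closed_projection_INT:
  fixes A :: "nat \<Rightarrow> 'a::metric_space set"
  assumes "\<And>n. \<exists>F :: ('a \<times> (nat \<Rightarrow> nat)) set. closed F \<and> A n = fst ` F"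
  shows "\<exists>F :: ('a \<times> (nat \<Rightarrow> nat)) set. closed F \<and> (\<Inter>n. A n) = fst ` F"
proof -
  obtain F :: "nat \<Rightarrow> ('a \<times> (nat \<Rightarrow> nat)) set" where F: "\<And>n. closed (F n)" "\<And>n. A n = fst ` F n"
    using assms by metis
  \<comment> \<open>One witness interleaves witnesses for all the sets: the entries
    \<open>prod_encode (n, m)\<close> belong to \<open>F n\<close>.\<close>
  define T where "T = (\<lambda>n (p :: 'a \<times> (nat \<Rightarrow> nat)). (fst p, \<lambda>m. snd p (prod_encode (n, m))))"
  define G where "G = (\<Inter>k. T k -` F k)"
  have T: "continuous_on UNIV (T n)" for n
    unfolding T_def
    by (intro continuous_on_Pair continuous_on_fst continuous_on_id
            continuous_on_coordinatewise_then_product continuous_snd_coordinate)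
  have "closed G"
    unfolding G_def by (intro closed_INT ballI closed_vimage F T)
  moreover have "(\<Inter>n. A n) = fst ` G"
  proof (intro equalityI subsetI)
    fix a assume a: "a \<in> (\<Inter>n. A n)"
    have "\<exists>x. (a, x) \<in> F n" for n
    proof -
      have "a \<in> fst ` F n" using a F(2) by auto
      then show ?thesis by force
    qed
    then obtain x where "\<And>n. (a, x n) \<in> F n" by metis
    then have "(a, \<lambda>i. case prod_decode i of (n, m) \<Rightarrow> x n m) \<in> G" by (auto simp: G_def T_def)
    then show "a \<in> fst ` G" by force
  next
    fix a assume "a \<in> fst ` G"
    then obtain x where "(a, x) \<in> G" by auto
    then have "(a, \<lambda>m. x (prod_encode (n, m))) \<in> F n" for n by (auto simp: G_def T_def)
    then show "a \<in> (\<Inter>n. A n)" using F(2) by force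
  qed
  ultimately show ?thesis by blast
qed

lemma open_eq_UN_closed:
  fixes S :: "'a::metric_space set"
  assumes "open S"
  obtains C :: "nat \<Rightarrow> 'a set" where "\<And>n. closed (C n)" "S = (\<Union>n. C n)"
proof (cases "S = UNIV")
  \<comment> \<open>\<open>infdist\<close> to the empty set is 0, so the sets \<open>C n\<close> of
    the other case would be empty here.\<close>
  case True then show ?thesis using that[of "\<lambda>_. UNIV"] by auto
next
  case False
  define C where "C = (\<lambda>n. {x. inverse (real (Suc n)) \<le> infdist x (- S)})"
  have "closed (C n)" for n
    unfolding C_def by (intro closed_Collect_le continuous_intros)
  moreover have "S = (\<Union>n. C n)"
  proof (intro equalityI subsetI)
    fix x assume "x \<in> S"
    then have "infdist x (- S) \<noteq> 0"
      using False in_closed_iff_infdist_zero[of "- S" x] assms by (auto simp: closed_Compl)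
    then have "infdist x (- S) > 0" using infdist_nonneg[of x "- S"] by linarith
    then show "x \<in> (\<Union>n. C n)"
      using reals_Archimedean by (fastforce simp: C_def intro: less_imp_le)
  next
    fix x assume "x \<in> (\<Union>n. C n)"
    then obtain n where n: "inverse (real (Suc n)) \<le> infdist x (- S)" by (auto simp: C_def)
    have "0 < inverse (real (Suc n))" by simp
    then have "infdist x (- S) > 0" using n by linarith
    then show "x \<in> S" by (metis ComplI infdist_zero less_irrefl)
  qed
  ultimately show ?thesis using that by blast
qed

text \<open>Projections do not commute with complements, so the induction over the sigma-algebra
  carries each set together with its complement. Only countable unions and intersections of
  projections then occur.\<close>

lemma borel_imp_closed_projection:
  fixes A :: "'a::metric_space set"
  assumes "A \<in> sets borel"
  shows "\<exists>F :: ('a \<times> (nat \<Rightarrow> nat)) set. closed F \<and> A = fst ` F"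
proof -
  define P where "P = (\<lambda>A :: 'a set. \<exists>F :: ('a \<times> (nat \<Rightarrow> nat)) set. closed F \<and> A = fst ` F)"
  have closed: "P C" if "closed C" for C
    unfolding P_def using that by (intro exI[of _ "C \<times> UNIV"]) (auto intro: closed_Times)
  have "A \<in> sigma_sets UNIV {S. open S}" using assms by (simp add: borel_def)
  then have "P A \<and> P (- A)"
  proof induction
    case (Basic S)
    then obtain C :: "nat \<Rightarrow> _" where C: "\<And>n. closed (C n)" "S = (\<Union>n. C n)"
      using open_eq_UN_closed by blast
    have "P S" unfolding C(2) P_def
      by (rule closed_projection_UN) (use closed[unfolded P_def] C(1) in blast)
    moreover have "P (- S)" using Basic by (intro closed) (simp add: closed_Compl)
    ultimately show ?case by blast
  next
    case Empty then show ?case using closed by auto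
  next
    case (Compl B) then show ?case by (simp add: Compl_eq_Diff_UNIV[symmetric])
  next
    case (Union B)
    have "P (\<Union>n. B n)" unfolding P_def
      by (rule closed_projection_UN) (use Union.IH[unfolded P_def] in blast)
    moreover have "P (\<Inter>n. - B n)" unfolding P_def
      by (rule closed_projection_INT) (use Union.IH[unfolded P_def] in blast)
    ultimately show ?case by (simp add: Compl_UN)
  qed
  then show ?thesis by (simp add: P_def)
qed

section \<open>Separation of analytic sets and uniformization\<close>

definition Borel_separable :: "'a::topological_space set \<Rightarrow> 'a set \<Rightarrow> bool" where
  "Borel_separable A B \<longleftrightarrow> (\<exists>C \<in> sets borel. A \<subseteq> C \<and> B \<inter> C = {})"

lemma Borel_separable_UN:
  fixes A B :: "'i::countable \<Rightarrow> 'a::topological_space set"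
  assumes "\<And>i j. Borel_separable (A i) (B j)"
  shows "Borel_separable (\<Union>i. A i) (\<Union>j. B j)"
proof -
  obtain C where C: "\<And>i j. C i j \<in> sets borel" "\<And>i j. A i \<subseteq> C i j" "\<And>i j. B j \<inter> C i j = {}"
    using assms unfolding Borel_separable_def by metis
  show ?thesis
    unfolding Borel_separable_def
    using C by (intro bexI[of _ "\<Union>i. \<Inter>j. C i j"]) (fastforce intro!: sets.countable_UN'' sets.countable_INT'')+
qed

text \<open>If the projections are inseparable, then by \<open>Borel_separable_UN\<close> some pair
  of pieces stays inseparable however finely both sets are split. The pieces shrink to one point of
  \<open>F\<close> and one of \<open>G\<close>. Disjointness makes these differ in some entry of the
  first component, and fixing that entry separates the pieces after all.\<close>

lemma Lusin_separation:
  fixes F G :: "((nat \<Rightarrow> nat) \<times> (nat \<Rightarrow> nat)) set"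
  assumes "closed F" "closed G" and disj: "fst ` F \<inter> fst ` G = {}"
  shows "Borel_separable (fst ` F) (fst ` G)"
proof (rule ccontr)
  assume nsep: "\<not> Borel_separable (fst ` F) (fst ` G)"
  \<comment> \<open>Both the point and its witness are fixed below \<open>n\<close>, so that a
    branch of pieces converges to an element of the closed set \<open>H\<close>.\<close>
  define part where "part = (\<lambda>(H :: ((nat \<Rightarrow> nat) \<times> (nat \<Rightarrow> nat)) set) n z.
    {c. \<exists>x. (c, x) \<in> H \<and> (\<forall>i<n. (c i, x i) = z i)})"
  have split: "part H n z = (\<Union>k. part H (Suc n) (z(n := k)))" for H n z
    by (fastforce simp: part_def less_Suc_eq)
  define Q where "Q = (\<lambda>n zw. \<not> Borel_separable (part F n (fst zw)) (part G n (snd zw)))"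
  have "part H 0 z = fst ` H" for H z by (force simp: part_def)
  then have ex0: "\<exists>zw. Q 0 zw" using nsep by (auto simp: Q_def)
  have step: "\<exists>zw'. Q (Suc n) zw' \<and> (\<exists>k l. zw' = ((fst zw)(n := k), (snd zw)(n := l)))"
    if "Q n zw" for n zw
  proof (rule ccontr)
    assume "\<not> ?thesis"
    then have "Borel_separable (part F (Suc n) ((fst zw)(n := k))) (part G (Suc n) ((snd zw)(n := l)))"
      for k l unfolding Q_def by (metis fst_conv snd_conv)
    then have "Borel_separable (part F n (fst zw)) (part G n (snd zw))"
      unfolding split[of _ n] by (rule Borel_separable_UN)
    with that show False by (simp add: Q_def)
  qed
  obtain zw where zw: "\<And>n. Q n (zw n)"
    "\<And>n. \<exists>k l. zw (Suc n) = ((fst (zw n))(n := k), (snd (zw n))(n := l))"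
    using dependent_nat_choice[of Q "\<lambda>n zw zw'. \<exists>k l. zw' = ((fst zw)(n := k), (snd zw)(n := l))",
        OF ex0 step] by blast
  define z where "z = (\<lambda>i. fst (zw (Suc i)) i)"
  define w where "w = (\<lambda>i. snd (zw (Suc i)) i)"
  have agree: "fst (zw n) i = z i \<and> snd (zw n) i = w i" if "i < n" for n i
    using that
  proof (induction n)
    case (Suc n)
    obtain k l where "zw (Suc n) = ((fst (zw n))(n := k), (snd (zw n))(n := l))"
      using zw(2) by blast
    then show ?case using Suc by (cases "i = n") (auto simp: z_def w_def)
  qed simp
  have part_cong: "part H n v = part H n v'" if "\<And>i. i < n \<Longrightarrow> v i = v' i" for H n v v'
    using that by (auto simp: part_def)
  have nsep': "\<not> Borel_separable (part F n z) (part G n w)" for n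
    using zw(1)[of n] part_cong[of n "fst (zw n)" z F] part_cong[of n "snd (zw n)" w G] agree[of _ n]
    by (simp add: Q_def)
  have limit: "(fst \<circ> v, snd \<circ> v) \<in> H"
    if "closed H" and ne: "\<And>n. part H n v \<noteq> {}" for H v
  proof -
    have "\<exists>c x. (c, x) \<in> H \<and> (\<forall>i<n. c i = fst (v i) \<and> x i = snd (v i))" for n
    proof -
      obtain c x where "(c, x) \<in> H" "\<forall>i<n. (c i, x i) = v i"
        using ne[of n] unfolding part_def by blast
      then show ?thesis by (metis fst_conv snd_conv)
    qed
    then obtain c x where cx: "\<And>n. (c n, x n) \<in> H"
      "\<And>n i. i < n \<Longrightarrow> c n i = fst (v i) \<and> x n i = snd (v i)" by metis
    have "c \<longlonglongrightarrow> (fst \<circ> v)" "x \<longlonglongrightarrow> (snd \<circ> v)"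
      using cx(2) by (auto intro!: tendsto_agree)
    then have "(\<lambda>n. (c n, x n)) \<longlonglongrightarrow> (fst \<circ> v, snd \<circ> v)" by (rule tendsto_Pair)
    then show ?thesis using closed_sequentially[OF \<open>closed H\<close>, of "\<lambda>n. (c n, x n)"] cx(1) by blast
  qed
  have "Borel_separable {} B" "Borel_separable A {}" for A B :: "(nat \<Rightarrow> nat) set"
    unfolding Borel_separable_def by (auto intro: bexI[of _ "{}"] bexI[of _ UNIV])
  then have "part F n z \<noteq> {}" "part G n w \<noteq> {}" for n using nsep'[of n] by metis+
  then have "(fst \<circ> z, snd \<circ> z) \<in> F" "(fst \<circ> w, snd \<circ> w) \<in> G"
    using limit assms(1,2) by blast+
  then have "fst \<circ> z \<noteq> fst \<circ> w" using disj by force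
  then obtain i where i: "fst (z i) \<noteq> fst (w i)" by (auto simp: fun_eq_iff)
  have "open {fst (z i)}" by (rule open_discrete)
  then have "open ((\<lambda>c :: nat \<Rightarrow> nat. c i) -` {fst (z i)})"
    by (intro open_vimage continuous_coordinate)
  then have "Borel_separable (part F (Suc i) z) (part G (Suc i) w)"
    unfolding Borel_separable_def using i
    by (intro bexI[of _ "(\<lambda>c :: nat \<Rightarrow> nat. c i) -` {fst (z i)}"])
      (auto simp: part_def prod_eq_iff dest: spec[of _ i])
  with nsep' show False by blast
qed

lemma measurable_fun_borel:
  fixes f :: "'a \<Rightarrow> 'i::countable \<Rightarrow> 'b::second_countable_topology"
  shows "(\<And>i. (\<lambda>x. f x i) \<in> borel_measurable M) \<Longrightarrow> f \<in> borel_measurable M"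
  by (rule measurable_coordinatewise_then_product)

lemma measurable_coordinate [measurable]:
  "(\<lambda>x :: nat \<Rightarrow> nat. x i) \<in> borel \<rightarrow>\<^sub>M count_space UNIV"
proof -
  have "(\<lambda>x :: nat \<Rightarrow> nat. x i) \<in> borel_measurable borel"
    by (intro borel_measurable_continuous_onI continuous_coordinate)
  then show ?thesis by (simp add: measurable_cong_sets[OF refl sets_borel_eq_count_space])
qed

text \<open>For each coordinate \<open>n\<close> the analytic sets \<open>{c. \<exists>z. (c, z) \<in> P \<and> z n = m}\<close> are disjoint, so
  they can be separated simultaneously by Borel sets.\<close>

lemma Borel_unique_uniformization:
  fixes P :: "((nat \<Rightarrow> nat) \<times> (nat \<Rightarrow> nat)) set"
  assumes P: "P \<in> sets borel" and uniq: "\<And>c z z'. (c, z) \<in> P \<Longrightarrow> (c, z') \<in> P \<Longrightarrow> z = z'"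
  obtains \<psi> where "\<psi> \<in> borel \<rightarrow>\<^sub>M borel" "\<And>c z. (c, z) \<in> P \<Longrightarrow> \<psi> c = z" "fst ` P \<in> sets borel"
proof -
  define A where "A = (\<lambda>n m. {c. \<exists>z. (c, z) \<in> P \<and> z n = m})"
  have sep: "Borel_separable (A n m) (A n m')" if "m \<noteq> m'" for n m m'
  proof -
    have proj: "\<exists>F :: ((nat \<Rightarrow> nat) \<times> (nat \<Rightarrow> nat)) set. closed F \<and> A n m = fst ` F" for n m
    proof -
      have "continuous_on UNIV (\<lambda>p :: (nat \<Rightarrow> nat) \<times> (nat \<Rightarrow> nat). snd p n)"
        by (rule continuous_snd_coordinate)
      then have "open ((\<lambda>p :: (nat \<Rightarrow> nat) \<times> (nat \<Rightarrow> nat). snd p n) -` {m})"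
        by (intro open_vimage open_discrete)
      then have "P \<inter> (\<lambda>p. snd p n) -` {m} \<in> sets borel"
        using P by auto
      from borel_imp_closed_projection[OF this]
      obtain F :: "(((nat \<Rightarrow> nat) \<times> (nat \<Rightarrow> nat)) \<times> (nat \<Rightarrow> nat)) set"
        where F: "closed F" "P \<inter> (\<lambda>p. snd p n) -` {m} = fst ` F"
        by (elim exE conjE)
      define T where "T = (\<lambda>p :: (nat \<Rightarrow> nat) \<times> (nat \<Rightarrow> nat).
        ((fst p, \<lambda>i. snd p (2 * i)), \<lambda>i. snd p (Suc (2 * i))))"
      have "continuous_on UNIV T"
        unfolding T_def
        by (intro continuous_on_Pair continuous_on_fst continuous_on_id
            continuous_on_coordinatewise_then_product continuous_snd_coordinate)
      then have "closed (T -` F)" using F(1) by (intro closed_vimage)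
      moreover have "A n m = fst ` (T -` F)"
      proof (intro equalityI subsetI)
        fix c assume "c \<in> A n m"
        then obtain z where "(c, z) \<in> fst ` F" unfolding F(2)[symmetric] by (auto simp: A_def)
        then obtain x where "((c, z), x) \<in> F" by force
        then have "(c, \<lambda>i. if even i then z (i div 2) else x (i div 2)) \<in> T -` F"
          by (simp add: T_def)
        then show "c \<in> fst ` (T -` F)" by force
      next
        fix c assume "c \<in> fst ` (T -` F)"
        then obtain x where "T (c, x) \<in> F" by (metis image_iff prod.collapse vimageE)
        then have "(c, \<lambda>i. x (2 * i)) \<in> fst ` F" by (force simp: T_def)
        then show "c \<in> A n m" unfolding F(2)[symmetric] by (auto simp: A_def)
      qed
      ultimately show ?thesis by blast
    qed
    obtain F G :: "((nat \<Rightarrow> nat) \<times> (nat \<Rightarrow> nat)) set"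
      where "closed F" "A n m = fst ` F" "closed G" "A n m' = fst ` G"
      using proj by metis
    moreover have "A n m \<inter> A n m' = {}" using uniq that by (force simp: A_def)
    ultimately show ?thesis using Lusin_separation by metis
  qed
  then have "\<forall>n m m'. \<exists>C. m \<noteq> m' \<longrightarrow> C \<in> sets borel \<and> A n m \<subseteq> C \<and> A n m' \<inter> C = {}"
    unfolding Borel_separable_def by metis
  then obtain C where C: "\<And>n m m'. m \<noteq> m' \<Longrightarrow> C n m m' \<in> sets borel"
    "\<And>n m m'. m \<noteq> m' \<Longrightarrow> A n m \<subseteq> C n m m'" "\<And>n m m'. m \<noteq> m' \<Longrightarrow> A n m' \<inter> C n m m' = {}"
    by metis
  \<comment> \<open>\<open>A n m\<close> lies in \<open>C n m m'\<close> and misses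
    \<open>C n m' m\<close>, so it survives the subtraction; the subtraction makes the sets
    \<open>H n m\<close> disjoint for different \<open>m\<close>.\<close>
  define H where "H = (\<lambda>n m. (\<Inter>m' \<in> - {m}. C n m m' - C n m' m))"
  have H: "H n m \<in> sets borel" for n m
  proof -
    have "- {m} \<noteq> {}" by (metis Compl_iff empty_iff n_not_Suc_n singletonD)
    then show ?thesis
      unfolding H_def using C(1) by (intro sets.countable_INT') auto
  qed
  define \<psi> where "\<psi> = (\<lambda>c n. if \<exists>m. c \<in> H n m then LEAST m. c \<in> H n m else 0)"
  have \<psi>: "\<psi> c = z" if "(c, z) \<in> P" for c z
  proof
    fix n
    have "c \<in> A n (z n)" using that by (auto simp: A_def)
    then have "c \<in> C n (z n) m' - C n m' (z n)" if "m' \<noteq> z n" for m'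
      using C(2)[of "z n" m' n] C(3)[of m' "z n" n] that by auto
    then have 1: "c \<in> H n (z n)" by (simp add: H_def)
    have "m = z n" if "c \<in> H n m" for m
      using 1 that by (auto simp: H_def)
    with 1 have "(LEAST m. c \<in> H n m) = z n" by (intro Least_equality) blast+
    with 1 show "\<psi> c n = z n" unfolding \<psi>_def by metis
  qed
  have H' [measurable]: "Measurable.pred borel (\<lambda>c. c \<in> H n m)" for n m
    using H by (simp add: pred_sets2)
  have "(\<lambda>c. \<psi> c n) \<in> borel \<rightarrow>\<^sub>M count_space UNIV" for n
    unfolding \<psi>_def by measurable
  then have \<psi>m [measurable]: "\<psi> \<in> borel \<rightarrow>\<^sub>M borel"
    by (intro measurable_fun_borel) (simp add: measurable_cong_sets[OF refl sets_borel_eq_count_space])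
  \<comment> \<open>A projection with unique witnesses is the preimage of the set under its own
    Borel section.\<close>
  have "fst ` P = {c. (c, \<psi> c) \<in> P}" using \<psi> by force
  also have "\<dots> = (\<lambda>c. (c, \<psi> c)) -` P \<inter> space borel" by auto
  also have "\<dots> \<in> sets borel"
  proof (rule measurable_sets)
    show "(\<lambda>c. (c, \<psi> c)) \<in> borel \<rightarrow>\<^sub>M borel \<Otimes>\<^sub>M borel" by measurable
    show "P \<in> sets (borel \<Otimes>\<^sub>M borel)" using P by (simp only: borel_prod)
  qed
  finally have "fst ` P \<in> sets borel" .
  with \<psi>m \<psi> show ?thesis by (rule that)
qed

section \<open>Binary codes for standard Borel spaces\<close>

lemma standard_Borel_code:
  fixes Y :: "'b measure"
  assumes "standard_Borel Y"
  obtains e :: "'b \<Rightarrow> nat \<Rightarrow> nat" and D d where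
    "e \<in> Y \<rightarrow>\<^sub>M borel" "D \<in> sets borel" "d \<in> restrict_space borel D \<rightarrow>\<^sub>M Y"
    "e ` space Y = D" "\<And>y. y \<in> space Y \<Longrightarrow> d (e y) = y" "\<And>y i. e y i \<le> 1"
proof -
  obtain T where T: "topspace T = space Y" "separable_space T" "completely_metrizable_space T"
    "sets Y = sigma_sets (space Y) {U. openin T U}"
    using assms unfolding standard_Borel_def Polish_space_def by blast
  then obtain M dm where "Metric_space M dm" and complete: "Metric_space.mcomplete M dm"
    and Teq: "T = Metric_space.mtopology M dm"
    unfolding completely_metrizable_space_def by blast
  interpret Metric_space M dm by fact
  have M: "M = space Y" using T(1) Teq by simp
  obtain C where C: "countable C" "C \<subseteq> M" "mtopology closure_of C = M"
    using T(2) Teq unfolding separable_space_def by auto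
  define cen where "cen = (\<lambda>i. from_nat_into C (fst (prod_decode i)))"
  define rad where "rad = (\<lambda>i. inverse (real (Suc (snd (prod_decode i)))))"
  define U where "U = (\<lambda>i. mball (cen i) (rad i))"
  define K where "K = (\<lambda>i. mcball (cen i) (rad i))"
  have rad_pos: "rad i > 0" for i by (simp add: rad_def)
  have U_open: "openin mtopology (U i)" for i by (simp add: U_def)
  have UK: "U i \<subseteq> K i" for i by (auto simp: U_def K_def)
  have open_ball: "y \<in> M \<and> (\<exists>\<epsilon>>0. mball y \<epsilon> \<subseteq> V)" if "openin mtopology V" "y \<in> V" for V y
    using that unfolding openin_mtopology by (metis subsetD)
  have basis: "\<exists>i. y \<in> U i \<and> K i \<subseteq> V \<and> rad i \<le> inverse (real (Suc k))"
    if "openin mtopology V" "y \<in> V" for V y k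
  proof -
    obtain \<epsilon> where \<epsilon>: "\<epsilon> > 0" "mball y \<epsilon> \<subseteq> V" and "y \<in> M"
      using open_ball[of V y] \<open>openin mtopology V\<close> \<open>y \<in> V\<close> by metis
    have "0 < min (\<epsilon> / 2) (inverse (real (Suc k)))" using \<epsilon> by simp
    then obtain n where n: "inverse (real (Suc n)) < min (\<epsilon> / 2) (inverse (real (Suc k)))"
      using reals_Archimedean by blast
    have "y \<in> mtopology closure_of C" using C(3) \<open>y \<in> M\<close> by simp
    then obtain c where c: "c \<in> C" "c \<in> mball y (inverse (real (Suc n)))"
      unfolding metric_closure_of by (auto dest: spec[of _ "inverse (real (Suc n))"])
    then obtain m where "from_nat_into C m = c" using from_nat_into_surj[OF C(1)] by blast
    then have i: "cen (prod_encode (m, n)) = c" "rad (prod_encode (m, n)) = inverse (real (Suc n))"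
      by (auto simp: cen_def rad_def)
    have "y \<in> U (prod_encode (m, n))" using c by (auto simp: U_def i commute)
    moreover have "K (prod_encode (m, n)) \<subseteq> V"
    proof
      fix x assume "x \<in> K (prod_encode (m, n))"
      then have "x \<in> M" "dm c x \<le> inverse (real (Suc n))" by (auto simp: K_def i)
      moreover have "dm y c < inverse (real (Suc n))" "c \<in> M" using c by auto
      ultimately have "dm y x < \<epsilon>" using triangle[of y c x] n \<open>y \<in> M\<close> by auto
      then show "x \<in> V" using \<epsilon> \<open>y \<in> M\<close> \<open>x \<in> M\<close> by auto
    qed
    ultimately show ?thesis using n i(2) by (intro exI[of _ "prod_encode (m, n)"]) auto
  qed
  \<comment> \<open>A point is coded by the set of basic open balls that contain it.\<close>
  define e where "e = (\<lambda>y i. of_bool (y \<in> U i) :: nat)"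
  \<comment> \<open>Countably many conditions, hence a Borel set, that characterise the codes. The
    third yields nested closed balls with radii tending to 0, whose common point exists by
    completeness; upward closure, the last one, then makes \<open>z\<close> contain every ball
    around that point.\<close>
  define \<Phi> where "\<Phi> = (\<lambda>z :: nat \<Rightarrow> nat. (\<forall>i. z i \<le> 1) \<and> (\<exists>i. z i = 1) \<and>
    (\<forall>i j k. z i = 1 \<and> z j = 1 \<longrightarrow>
      (\<exists>l. z l = 1 \<and> U l \<noteq> {} \<and> K l \<subseteq> U i \<inter> U j \<and> rad l \<le> inverse (real (Suc k)))) \<and>
    (\<forall>i j. z i = 1 \<and> U i \<subseteq> U j \<longrightarrow> z j = 1))"
  have e_\<Phi>: "\<Phi> (e y)" if "y \<in> M" for y
  proof -
    have "\<exists>i. y \<in> U i" using basis[of M y 0] that by auto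
    moreover have "\<exists>l. y \<in> U l \<and> U l \<noteq> {} \<and> K l \<subseteq> U i \<inter> U j \<and> rad l \<le> inverse (real (Suc k))"
      if "y \<in> U i" "y \<in> U j" for i j k
      using basis[of "U i \<inter> U j" y k] U_open that by blast
    moreover have "e y i = 1 \<longleftrightarrow> y \<in> U i" "e y i \<le> 1" for i by (auto simp: e_def)
    ultimately show ?thesis unfolding \<Phi>_def by simp blast
  qed
  have \<Phi>_e: "\<exists>y \<in> M. e y = z" if z: "\<Phi> z" for z
  proof -
    have z1: "\<exists>i. z i = 1" and z2: "\<And>i j k. z i = 1 \<Longrightarrow> z j = 1 \<Longrightarrow>
      \<exists>l. z l = 1 \<and> U l \<noteq> {} \<and> K l \<subseteq> U i \<inter> U j \<and> rad l \<le> inverse (real (Suc k))"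
      and z3: "\<And>i j. z i = 1 \<Longrightarrow> U i \<subseteq> U j \<Longrightarrow> z j = 1" and z4: "\<And>i. z i \<le> 1"
      using z unfolding \<Phi>_def by blast+
    have "\<exists>l. (\<forall>n. z (l n) = 1) \<and> (\<forall>n. K (l (Suc n)) \<subseteq> U (l n) \<and>
      rad (l (Suc n)) \<le> inverse (real (Suc n)) \<and> U (l (Suc n)) \<noteq> {})"
      using dependent_nat_choice[of "\<lambda>_ i. z i = 1"
          "\<lambda>n i l. K l \<subseteq> U i \<and> rad l \<le> inverse (real (Suc n)) \<and> U l \<noteq> {}"] z1 z2 by (metis inf.idem)
    then obtain l where l: "\<And>n. z (l n) = 1" "\<And>n. K (l (Suc n)) \<subseteq> U (l n)"
      "\<And>n. rad (l (Suc n)) \<le> inverse (real (Suc n))" "\<And>n. U (l (Suc n)) \<noteq> {}" by blast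
    have "\<Inter> (range (\<lambda>n. K (l (Suc n)))) \<noteq> {}"
    proof (rule complete[unfolded mcomplete_nest, rule_format], intro conjI allI impI)
      show "closedin mtopology (K (l (Suc n)))" for n by (simp add: K_def)
      show "K (l (Suc n)) \<noteq> {}" for n using l(4) UK by blast
      show "decseq (\<lambda>n. K (l (Suc n)))" unfolding decseq_Suc_iff using l(2) UK by blast
      fix \<epsilon> :: real assume "\<epsilon> > 0"
      then obtain n where "inverse (real (Suc n)) < \<epsilon>" using reals_Archimedean by blast
      then have "K (l (Suc n)) \<subseteq> mcball (cen (l (Suc n))) \<epsilon>"
        unfolding K_def using l(3)[of n] by (intro mcball_subset_concentric) linarith
      then show "\<exists>n a. K (l (Suc n)) \<subseteq> mcball a \<epsilon>" by blast
    qed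
    then obtain y where yK: "\<And>n. y \<in> K (l (Suc n))" by blast
    have yU: "y \<in> U (l n)" for n using yK[of n] l(2)[of n] by blast
    then have "y \<in> M" by (auto simp: U_def)
    have small: "dm y x \<le> 2 * inverse (real (Suc n))" if "x \<in> K (l (Suc n))" for x n
      using yK[of n] that l(3)[of n] triangle[of y "cen (l (Suc n))" x] by (auto simp: K_def commute)
    have close: "x \<in> mball y \<epsilon>" if "x \<in> K (l (Suc n))" "2 * inverse (real (Suc n)) < \<epsilon>" for x n \<epsilon>
      using small[OF that(1)] that \<open>y \<in> M\<close> by (auto simp: K_def)
    have arch: "\<exists>n. 2 * inverse (real (Suc n)) < \<epsilon>" if "\<epsilon> > 0" for \<epsilon>
      using reals_Archimedean[of "\<epsilon> / 2"] that by (simp add: mult.commute)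
    have "y \<in> U i \<longleftrightarrow> z i = 1" for i
    proof
      assume "y \<in> U i"
      then obtain \<epsilon> where \<epsilon>: "\<epsilon> > 0" "mball y \<epsilon> \<subseteq> U i"
        using open_ball[OF U_open] by metis
      obtain n where "2 * inverse (real (Suc n)) < \<epsilon>" using arch \<epsilon> by blast
      then have "U (l (Suc n)) \<subseteq> U i" using close UK \<epsilon>(2) by blast
      then show "z i = 1" using l(1) z3 by blast
    next
      assume "z i = 1"
      then obtain m where m: "z m = 1" "K m \<subseteq> U i" using z2[of i i 0] by auto
      \<comment> \<open>By the third condition \<open>U m\<close> meets each of the balls that
        shrink to \<open>y\<close>; since \<open>K m\<close> is closed, it contains
        \<open>y\<close>.\<close>
      have "y \<in> mtopology closure_of K m"
        unfolding metric_closure_of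
      proof (intro CollectI conjI allI impI \<open>y \<in> M\<close>)
        fix \<epsilon> :: real assume "\<epsilon> > 0"
        then obtain n where n: "2 * inverse (real (Suc n)) < \<epsilon>" using arch by blast
        obtain p where "U p \<noteq> {}" "K p \<subseteq> U m \<inter> U (l (Suc n))" using z2[OF m(1) l(1)] by metis
        then obtain x where "x \<in> U m" "x \<in> U (l (Suc n))" using UK by blast
        then show "\<exists>x\<in>K m. x \<in> mball y \<epsilon>" using close[OF _ n] UK by blast
      qed
      then have "y \<in> K m" by (simp add: K_def closure_of_closedin)
      then show "y \<in> U i" using m by blast
    qed
    then have "e y = z" unfolding e_def fun_eq_iff using z4 by (metis One_nat_def le_Suc_eq le_zero_eq of_bool_def)
    then show ?thesis using \<open>y \<in> M\<close> by blast
  qed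
  define D where "D = {z. \<Phi> z}"
  have D: "e ` M = D" using e_\<Phi> \<Phi>_e by (auto simp: D_def)
  have "Measurable.pred borel \<Phi>" unfolding \<Phi>_def by measurable
  then have D_sets: "D \<in> sets borel" unfolding D_def pred_def by simp
  have inj: "inj_on e M"
  proof
    fix x y assume xy: "x \<in> M" "y \<in> M" "e x = e y"
    then have U: "x \<in> U i \<longleftrightarrow> y \<in> U i" for i unfolding e_def fun_eq_iff by (metis of_bool_eq_iff)
    show "x = y"
    proof (rule ccontr)
      assume "x \<noteq> y"
      then have "dm x y > 0" using xy by simp
      then obtain i where "x \<in> U i" "K i \<subseteq> mball x (dm x y)"
        using basis[of "mball x (dm x y)" x 0] xy by auto
      then have "y \<in> mball x (dm x y)" using U UK by blast
      then show False by simp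
    qed
  qed
  define d where "d = inv_into M e"
  have de: "d (e y) = y" if "y \<in> M" for y using inj that by (simp add: d_def)
  have U_sets [measurable]: "U i \<in> sets Y" for i using U_open Teq T(4) by auto
  have "(\<lambda>y. e y i) \<in> borel_measurable Y" for i unfolding e_def by measurable
  then have "e \<in> Y \<rightarrow>\<^sub>M borel" by (rule measurable_fun_borel)
  moreover have "d \<in> restrict_space borel D \<rightarrow>\<^sub>M Y"
  proof (rule measurable_sigma_sets[OF T(4)])
    show "{U. openin T U} \<subseteq> Pow (space Y)" using T(1) openin_subset by blast
    show "d \<in> space (restrict_space borel D) \<rightarrow> space Y"
      using D de M by (auto simp: space_restrict_space)
    fix V assume "V \<in> {U. openin T U}"
    then have V: "openin mtopology V" using Teq by simp
    have "d -` V \<inter> D = (\<Union>i \<in> {i. U i \<subseteq> V}. {z. z i = 1}) \<inter> D"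
    proof (intro equalityI subsetI; elim IntE; intro IntI)
      fix z assume z: "z \<in> d -` V" "z \<in> D"
      then obtain y where y: "y \<in> M" "z = e y" using D by blast
      then have "y \<in> V" using z de by auto
      then obtain i where "y \<in> U i" "U i \<subseteq> V" using basis[OF V, of y 0] UK by blast
      then show "z \<in> (\<Union>i \<in> {i. U i \<subseteq> V}. {z. z i = 1})" using y by (auto simp: e_def)
    next
      fix z assume z: "z \<in> (\<Union>i \<in> {i. U i \<subseteq> V}. {z. z i = 1})" "z \<in> D"
      then obtain y where y: "y \<in> M" "z = e y" using D by blast
      with z have "y \<in> V" by (auto simp: e_def of_bool_def split: if_splits)
      then show "z \<in> d -` V" using y de by auto
    qed auto
    moreover have "(\<Union>i \<in> {i. U i \<subseteq> V}. {z :: nat \<Rightarrow> nat. z i = 1}) \<in> sets borel"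
    proof -
      have "{z \<in> space borel. (z :: nat \<Rightarrow> nat) i = 1} \<in> sets borel" for i by measurable
      then have "{z :: nat \<Rightarrow> nat. z i = 1} \<in> sets borel" for i by simp
      then show ?thesis by (intro sets.countable_UN') auto
    qed
    moreover have "space (restrict_space borel D) = D" by (simp add: space_restrict_space)
    ultimately show "d -` V \<inter> space (restrict_space borel D) \<in> sets (restrict_space borel D)"
      unfolding sets_restrict_space
      by (intro image_eqI[where x = "\<Union>i \<in> {i. U i \<subseteq> V}. {z. z i = 1}"]) auto
  qed
  ultimately show ?thesis
    using that[of e D d] D_sets D de M by (auto simp: e_def)
qed

section \<open>Chains\<close>

definition agree :: "nat \<Rightarrow> (nat \<Rightarrow> nat) \<Rightarrow> (nat \<Rightarrow> nat) \<Rightarrow> bool" where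
  "agree n u v \<longleftrightarrow> (\<forall>i<n. u i = v i)"

text \<open>The relation \<open>S\<^sub>n\<close> of the overview, with full sequences standing for
  their prefixes of length \<open>n\<close>. The witnesses of the links sum to at most
  \<open>s\<close>; this slack makes the relation upward closed in \<open>s\<close>, see
  \<open>chain_cong\<close>.\<close>

inductive chain ::
    "(((nat \<Rightarrow> nat) \<times> (nat \<Rightarrow> nat)) \<times> (nat \<Rightarrow> nat)) set \<Rightarrow> nat \<Rightarrow> (nat \<Rightarrow> nat) \<Rightarrow> (nat \<Rightarrow> nat) \<Rightarrow> (nat \<Rightarrow> nat) \<Rightarrow> bool"
  for F n where
  chain_refl: "agree n u v \<Longrightarrow> chain F n u v s"
| chain_step: "((p, r), t) \<in> F \<Longrightarrow> agree n u p \<Longrightarrow> chain F n r v s' \<Longrightarrow> \<forall>i<n. t i + s' i \<le> s i \<Longrightarrow>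
    chain F n u v s"

lemma chain_cong:
  assumes "chain F n u v s" "agree n u u'" "agree n v v'" "\<And>i. i < n \<Longrightarrow> s i \<le> s' i"
  shows "chain F n u' v' s'"
  using assms
proof (induction arbitrary: u' s')
  case (chain_refl u v s)
  then show ?case by (auto simp: agree_def intro!: chain.chain_refl)
next
  case (chain_step p r t u v s1 s)
  have "chain F n r v' s1" using chain_step.IH[of r s1] chain_step.prems by (auto simp: agree_def)
  moreover have "agree n u' p" using chain_step by (auto simp: agree_def)
  moreover have "\<forall>i<n. t i + s1 i \<le> s' i" using chain_step by (meson order_trans)
  ultimately show ?case using chain_step.hyps(1) chain.chain_step by blast
qed

lemma chain_trans:
  assumes "chain F n u v s" "chain F n v w s'"
  shows "chain F n u w (\<lambda>i. s i + s' i)"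
  using assms
proof (induction)
  case (chain_refl u v s)
  show ?case by (rule chain_cong[OF chain_refl.prems]) (use chain_refl.hyps in \<open>auto simp: agree_def\<close>)
next
  case (chain_step p r t u v s1 s)
  have "\<forall>i<n. t i + (s1 i + s' i) \<le> s i + s' i" using chain_step.hyps by auto
  then show ?case by (rule chain.chain_step[OF chain_step.hyps(1,2) chain_step.IH[OF chain_step.prems]])
qed

lemma chain_mono:
  assumes "chain F n u v s" "m \<le> n"
  shows "chain F m u v s"
  using assms
proof (induction)
  case (chain_refl u v s)
  then show ?case by (auto simp: agree_def intro!: chain.chain_refl)
next
  case (chain_step p r t u v s1 s)
  then have "agree m u p" "\<forall>i<m. t i + s1 i \<le> s i" by (auto simp: agree_def)
  then show ?case using chain_step chain.chain_step by blast
qed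

text \<open>Every link costs 1 in entry 0, so with \<open>s 0 = 0\<close> there is no link. This
  later recovers \<open>y\<close> from its marks.\<close>

lemma chain_zero:
  assumes "chain F n u v s" "\<And>x. x \<in> F \<Longrightarrow> snd x 0 = 1" "s 0 = 0" "n > 0"
  shows "agree n u v"
  using assms by (cases rule: chain.cases) fastforce+

text \<open>Compactness for approximations. Finiteness at entry \<open>i\<close> is asked only for
  \<open>n > i\<close>, because stage \<open>n\<close> controls just the entries below
  \<open>n\<close>.\<close>

lemma diagonal_subsequence:
  fixes Z :: "nat \<Rightarrow> nat \<Rightarrow> 'a"
  assumes fin: "\<And>i. finite {Z n i | n. i < n}"
  obtains \<phi> z where "strict_mono \<phi>" "\<And>i. \<forall>\<^sub>F k in sequentially. Z (\<phi> k) i = z i"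
proof -
  interpret subseqs "\<lambda>i s. \<exists>x. \<forall>\<^sub>F k in sequentially. Z (s k) i = x"
  proof
    fix i and s :: "nat \<Rightarrow> nat" assume s: "strict_mono s"
    have "(\<lambda>k. Z (s k) i) ` {i<..} \<subseteq> {Z n i | n. i < n}"
    proof
      fix x assume "x \<in> (\<lambda>k. Z (s k) i) ` {i<..}"
      then obtain k where k: "i < k" "x = Z (s k) i" by auto
      have "i < s k" using seq_suble[OF s, of k] k(1) by linarith
      with k(2) show "x \<in> {Z n i | n. i < n}" by blast
    qed
    then have "finite ((\<lambda>k. Z (s k) i) ` {i<..})" using fin finite_subset by blast
    moreover have "infinite {i<..}" by (simp add: infinite_Ioi)
    ultimately obtain k0 where inf: "infinite {k \<in> {i<..}. Z (s k) i = Z (s k0) i}"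
      using pigeonhole_infinite[of "{i<..}" "\<lambda>k. Z (s k) i"] by blast
    define r where "r = enumerate {k \<in> {i<..}. Z (s k) i = Z (s k0) i}"
    have "strict_mono r" unfolding r_def using inf by (rule strict_mono_enumerate)
    moreover have "Z ((s \<circ> r) k) i = Z (s k0) i" for k
      using enumerate_in_set[OF inf, of k] by (simp add: r_def)
    ultimately show "\<exists>r'. strict_mono r' \<and> (\<exists>x. \<forall>\<^sub>F k in sequentially. Z ((s \<circ> r') k) i = x)"
      by (meson always_eventually)
  qed
  \<comment> \<open>\<open>diagseq_holds\<close> speaks of the diagonal from index
    \<open>Suc i\<close> on; the offset is removed afterwards.\<close>
  have "\<exists>x. \<forall>\<^sub>F k in sequentially. Z ((diagseq \<circ> (+) (Suc i)) k) i = x" for i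
  proof (rule diagseq_holds)
    fix r s :: "nat \<Rightarrow> nat" and n
    assume "strict_mono r" "\<exists>x. \<forall>\<^sub>F k in sequentially. Z (s k) n = x"
    then show "\<exists>x. \<forall>\<^sub>F k in sequentially. Z ((s \<circ> r) k) n = x"
      using eventually_subseq by fastforce
  qed
  then have "\<exists>x. \<forall>\<^sub>F k in sequentially. Z (diagseq (k + Suc i)) i = x" for i
    unfolding o_def add.commute[of "Suc _"] .
  then have "\<exists>x. \<forall>\<^sub>F k in sequentially. Z (diagseq k) i = x" for i
  proof -
    obtain x where "\<forall>\<^sub>F k in sequentially. Z (diagseq (k + Suc i)) i = x"
      using \<open>\<And>i. \<exists>x. \<forall>\<^sub>F k in sequentially. Z (diagseq (k + Suc i)) i = x\<close> by blast
    then show ?thesis using eventually_sequentially_seg[of "\<lambda>k. Z (diagseq k) i = x" "Suc i"] by blast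
  qed
  then obtain z where "\<And>i. \<forall>\<^sub>F k in sequentially. Z (diagseq k) i = z i"
    using choice[of "\<lambda>i x. \<forall>\<^sub>F k in sequentially. Z (diagseq k) i = x"] by blast
  then show ?thesis using that subseq_diagseq by blast
qed

text \<open>Every link of a chain uses one unit of \<open>s 0\<close>, so the induction on \<open>s 0\<close> peels off a first link,
  obtained as a limit of the first links of the finite approximations.\<close>

lemma chain_limit:
  assumes "closed F" "trans (fst ` F)" and one: "\<And>p r t. ((p, r), t) \<in> F \<Longrightarrow> t 0 = 1"
    and bounded: "\<And>p r t i. ((p, r), t) \<in> F \<Longrightarrow> r i \<le> 1"
    and "\<And>n. chain F n u v s"
  shows "u = v \<or> (u, v) \<in> fst ` F"
  using assms(5)
proof (induction "s 0" arbitrary: u s rule: less_induct)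
  case less
  show ?case
  proof (cases "\<forall>n. agree n u v")
    case True
    then show ?thesis by (auto simp: agree_def fun_eq_iff)
  next
    case False
    then obtain N where N: "\<not> agree N u v" by blast
    have "\<exists>p r t s'. ((p, r), t) \<in> F \<and> agree n u p \<and> chain F n r v s' \<and> (\<forall>i<n. t i + s' i \<le> s i)" for n
    proof -
      \<comment> \<open>\<open>u\<close> and \<open>v\<close> differ below \<open>N\<close>, so at
        level \<open>n + N\<close> the chain has a first link; it is then cut back to level
        \<open>n\<close>.\<close>
      have "chain F (n + N) u v s" by (rule less.prems)
      then show ?thesis
      proof (cases rule: chain.cases)
        case chain_refl
        then show ?thesis using N by (auto simp: agree_def)
      next
        case (chain_step p r t s')
        then show ?thesis
          by (intro exI[of _ p] exI[of _ r] exI[of _ t] exI[of _ s'])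
            (auto simp: agree_def intro: chain_mono)
      qed
    qed
    then obtain p r t s' where *: "\<And>n. ((p n, r n), t n) \<in> F" "\<And>n. agree n u (p n)"
      "\<And>n. chain F n (r n) v (s' n)" "\<And>n i. i < n \<Longrightarrow> t n i + s' n i \<le> s i"
      by metis
    \<comment> \<open>Below \<open>n\<close> the entries of \<open>t n\<close> and
      \<open>s' n\<close> are bounded by \<open>s\<close>, and those of \<open>r n\<close> by 1. The
      sequences \<open>p n\<close> agree with \<open>u\<close> below \<open>n\<close> and converge
      on their own.\<close>
    define Z where "Z = (\<lambda>n i. (r n i, t n i, s' n i))"
    have "finite {Z n i | n. i < n}" for i
    proof (rule finite_subset)
      show "{Z n i | n. i < n} \<subseteq> {..1} \<times> {..s i} \<times> {..s i}"
        using *(4) bounded[OF *(1)] by (fastforce simp: Z_def)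
    qed auto
    then obtain \<phi> z where \<phi>: "strict_mono \<phi>" and z: "\<And>i. \<forall>\<^sub>F k in sequentially. Z (\<phi> k) i = z i"
      using diagonal_subsequence[of Z] by blast
    define r' t' s'' where "r' = (\<lambda>i. fst (z i))" and "t' = (\<lambda>i. fst (snd (z i)))"
      and "s'' = (\<lambda>i. snd (snd (z i)))"
    have ev: "\<forall>\<^sub>F k in sequentially. r (\<phi> k) i = r' i \<and> t (\<phi> k) i = t' i \<and> s' (\<phi> k) i = s'' i" for i
      using z[of i] by eventually_elim (auto simp: Z_def r'_def t'_def s''_def dest: sym)
    have large: "\<forall>\<^sub>F k in sequentially. n < \<phi> k" for n
      using seq_suble[OF \<phi>] by (intro eventually_sequentiallyI[of "Suc n"]) (meson Suc_le_lessD order_trans)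
    have "(\<lambda>k. r (\<phi> k)) \<longlonglongrightarrow> r'"
    proof (intro tendsto_funI tendsto_eventually)
      fix i
      from ev[of i] show "\<forall>\<^sub>F k in sequentially. r (\<phi> k) i = r' i" by eventually_elim simp
    qed
    moreover have "(\<lambda>k. t (\<phi> k)) \<longlonglongrightarrow> t'"
    proof (intro tendsto_funI tendsto_eventually)
      fix i
      from ev[of i] show "\<forall>\<^sub>F k in sequentially. t (\<phi> k) i = t' i" by eventually_elim simp
    qed
    moreover have "(\<lambda>k. p (\<phi> k)) \<longlonglongrightarrow> u"
    proof (intro tendsto_funI tendsto_eventually)
      show "\<forall>\<^sub>F k in sequentially. p (\<phi> k) i = u i" for i
        using large[of i] by eventually_elim (use *(2) in \<open>auto simp: agree_def\<close>)
    qed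
    ultimately have "(\<lambda>k. ((p (\<phi> k), r (\<phi> k)), t (\<phi> k))) \<longlonglongrightarrow> ((u, r'), t')"
      by (intro tendsto_Pair)
    then have F: "((u, r'), t') \<in> F"
      using closed_sequentially[OF \<open>closed F\<close>, of "\<lambda>k. ((p (\<phi> k), r (\<phi> k)), t (\<phi> k))"] *(1) by blast
    have chain: "chain F n r' v s''" for n
    proof -
      have "\<forall>\<^sub>F k in sequentially. n < \<phi> k \<and>
          (\<forall>i\<in>{..<n}. r (\<phi> k) i = r' i \<and> t (\<phi> k) i = t' i \<and> s' (\<phi> k) i = s'' i)"
        using ev large by (simp add: eventually_conj eventually_ball_finite)
      then obtain k where k: "n < \<phi> k"
        "\<forall>i\<in>{..<n}. r (\<phi> k) i = r' i \<and> t (\<phi> k) i = t' i \<and> s' (\<phi> k) i = s'' i"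
        using eventually_happens'[OF sequentially_bot] by blast
      have "chain F n (r (\<phi> k)) v (s' (\<phi> k))" using *(3) k chain_mono less_imp_le by blast
      then show ?thesis by (rule chain_cong) (use k in \<open>auto simp: agree_def\<close>)
    qed
    have "s'' 0 < s 0"
    proof -
      have "\<forall>\<^sub>F k in sequentially. 0 < \<phi> k \<and> r (\<phi> k) 0 = r' 0 \<and> t (\<phi> k) 0 = t' 0 \<and> s' (\<phi> k) 0 = s'' 0"
        using ev[of 0] large[of 0] by (simp add: eventually_conj)
      then obtain k where "0 < \<phi> k" "t (\<phi> k) 0 = t' 0" "s' (\<phi> k) 0 = s'' 0"
        using eventually_happens'[OF sequentially_bot] by blast
      then show ?thesis using *(4)[of 0 "\<phi> k"] one[OF *(1), of "\<phi> k"] by linarith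
    qed
    from less.hyps[OF this chain] have "r' = v \<or> (r', v) \<in> fst ` F" .
    moreover have "(u, r') \<in> fst ` F" using F by force
    ultimately show ?thesis using \<open>trans (fst ` F)\<close> by (auto dest: transD)
  qed
qed

text \<open>Entry 0 of a witness is reserved for the constant 1, the price of a link in a chain. The
  odd entries carry the witness of analyticity, the positive even entries the witness that turns the
  Borel set \<open>W0\<close> into a closed one.\<close>

lemma analytic_imp_closed_code:
  fixes Y :: "'b measure"
  assumes R: "analytic_in (Y \<Otimes>\<^sub>M Y) R" "R \<subseteq> space Y \<times> space Y"
    and e: "D \<in> sets borel" "d \<in> restrict_space borel D \<rightarrow>\<^sub>M Y"
      "e ` space Y = D" "\<And>y. y \<in> space Y \<Longrightarrow> d (e y) = y"
  shows "\<exists>F :: (((nat \<Rightarrow> nat) \<times> (nat \<Rightarrow> nat)) \<times> (nat \<Rightarrow> nat)) set.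
    closed F \<and> fst ` F = map_prod e e ` R \<and> (\<forall>p t. (p, t) \<in> F \<longrightarrow> t 0 = 1)"
proof (cases "space Y = {}")
  case True
  then have "R = {}" using R by auto
  then show ?thesis by (intro exI[of _ "{}"]) auto
next
  case False
  then obtain y0 where y0: "y0 \<in> space Y" by blast
  \<comment> \<open>\<open>d\<close> is measurable on \<open>D\<close> only, and the constant
    \<open>y0\<close> extends it; \<open>W0\<close> asks for membership in \<open>D\<close>
    again.\<close>
  define d' where "d' = (\<lambda>z. if z \<in> D then d z else y0)"
  have d'[measurable]: "d' \<in> borel \<rightarrow>\<^sub>M Y"
    using e(2) measurable_restrict_space_iff[of D borel y0 Y d] e(1) y0 unfolding d'_def by auto
  obtain W where W[measurable]: "W \<in> sets ((Y \<Otimes>\<^sub>M Y) \<Otimes>\<^sub>M (borel :: (nat \<Rightarrow> nat) measure))" and RW: "R = fst ` W"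
    using R(1) unfolding analytic_in_def by blast
  define W0 where "W0 = {w \<in> space ((borel \<Otimes>\<^sub>M borel) \<Otimes>\<^sub>M borel). fst (fst w) \<in> D \<and> snd (fst w) \<in> D \<and>
    ((d' (fst (fst w)), d' (snd (fst w))), snd w) \<in> W}"
  have [measurable]: "D \<in> sets borel" by fact
  have "W0 \<in> sets ((borel \<Otimes>\<^sub>M borel) \<Otimes>\<^sub>M borel)" unfolding W0_def by measurable
  then have "W0 \<in> sets borel" by (simp only: borel_prod)
  from borel_imp_closed_projection[OF this]
  obtain F1 :: "((((nat \<Rightarrow> nat) \<times> (nat \<Rightarrow> nat)) \<times> (nat \<Rightarrow> nat)) \<times> (nat \<Rightarrow> nat)) set"
    where F1: "closed F1" "W0 = fst ` F1"
    by (elim exE conjE)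
  have W0: "((u, v), x) \<in> W0 \<longleftrightarrow> u \<in> D \<and> v \<in> D \<and> ((d u, d v), x) \<in> W" for u v x
    by (auto simp: W0_def d'_def space_pair_measure)
  define T where "T = (\<lambda>p :: ((nat \<Rightarrow> nat) \<times> (nat \<Rightarrow> nat)) \<times> (nat \<Rightarrow> nat).
    ((fst p, \<lambda>i. snd p (Suc (2 * i))), \<lambda>i. snd p (Suc (Suc (2 * i)))))"
  define F where "F = (T -` F1) \<inter> ((\<lambda>p. snd p 0) -` {1})"
  have "continuous_on UNIV T"
    unfolding T_def
    by (intro continuous_on_Pair continuous_on_fst continuous_on_id
        continuous_on_coordinatewise_then_product continuous_snd_coordinate)
  then have "closed F"
    unfolding F_def using F1(1) by (intro closed_Int closed_vimage continuous_snd_coordinate) auto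
  moreover have "fst ` F = map_prod e e ` R"
  proof (intro equalityI subsetI)
    fix p assume "p \<in> fst ` F"
    then obtain t where "T (p, t) \<in> F1" by (force simp: F_def)
    moreover obtain u v where p: "p = (u, v)" by (cases p)
    ultimately have "((u, v), \<lambda>i. t (Suc (2 * i))) \<in> W0" unfolding F1(2) by (force simp: T_def)
    then have uv: "u \<in> D" "v \<in> D" "(d u, d v) \<in> R" unfolding W0 RW by force+
    then have "e (d u) = u" "e (d v) = v" using e(3,4) by (metis imageE)+
    then show "p \<in> map_prod e e ` R" using uv p by force
  next
    fix p assume "p \<in> map_prod e e ` R"
    then obtain x y where xy: "(x, y) \<in> R" "p = (e x, e y)" by auto
    then have "x \<in> space Y" "y \<in> space Y" using R(2) by auto
    moreover obtain z where "((x, y), z) \<in> W" using xy RW by force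
    ultimately have "((e x, e y), z) \<in> W0" unfolding W0 using e(3,4) by auto
    then obtain w where w: "(((e x, e y), z), w) \<in> F1" unfolding F1(2) by force
    define t where "t = (\<lambda>i. if i = 0 then 1 else if odd i then z (i div 2) else w ((i - 2) div 2))"
    have "(p, t) \<in> F" using w by (simp add: F_def T_def t_def xy(2))
    then show "p \<in> fst ` F" by force
  qed
  moreover have "\<forall>p t. (p, t) \<in> F \<longrightarrow> t 0 = 1" by (auto simp: F_def)
  ultimately show ?thesis by blast
qed

section \<open>Countable dense orders\<close>

text \<open>Formulated for a carrier and a relation because it is applied both to sets of rationals
  and to \<open>point_less\<close> on pairs of a class and a rational.\<close>

definition dense_unbounded :: "'a set \<Rightarrow> ('a \<Rightarrow> 'a \<Rightarrow> bool) \<Rightarrow> bool" where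
  "dense_unbounded S r \<longleftrightarrow> countable S \<and> S \<noteq> {} \<and>
    (\<forall>x\<in>S. \<not> r x x) \<and> (\<forall>x\<in>S. \<forall>y\<in>S. \<forall>z\<in>S. r x y \<longrightarrow> r y z \<longrightarrow> r x z) \<and>
    (\<forall>x\<in>S. \<forall>y\<in>S. x = y \<or> r x y \<or> r y x) \<and>
    (\<forall>x\<in>S. \<forall>y\<in>S. r x y \<longrightarrow> (\<exists>z\<in>S. r x z \<and> r z y)) \<and>
    (\<forall>x\<in>S. (\<exists>y\<in>S. r x y) \<and> (\<exists>y\<in>S. r y x))"

lemma dense_unbounded_conversep: "dense_unbounded S r \<Longrightarrow> dense_unbounded S r\<inverse>\<inverse>"
  unfolding dense_unbounded_def conversep_iff by (elim conjE, intro conjI) (assumption | meson)+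

lemma dense_unboundedD:
  assumes "dense_unbounded S r"
  shows "countable S" "S \<noteq> {}" "x \<in> S \<Longrightarrow> \<not> r x x"
    "x \<in> S \<Longrightarrow> y \<in> S \<Longrightarrow> z \<in> S \<Longrightarrow> r x y \<Longrightarrow> r y z \<Longrightarrow> r x z"
    "x \<in> S \<Longrightarrow> y \<in> S \<Longrightarrow> x = y \<or> r x y \<or> r y x"
    "x \<in> S \<Longrightarrow> y \<in> S \<Longrightarrow> r x y \<Longrightarrow> \<exists>z\<in>S. r x z \<and> r z y"
    "x \<in> S \<Longrightarrow> \<exists>y\<in>S. r x y" "x \<in> S \<Longrightarrow> \<exists>y\<in>S. r y x"
  using assms unfolding dense_unbounded_def by meson+

lemma dense_unbounded_max:
  assumes "dense_unbounded S r" "finite A" "A \<noteq> {}" "A \<subseteq> S"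
  shows "\<exists>m\<in>A. \<forall>a\<in>A. a = m \<or> r a m"
  using assms(2-)
proof (induction rule: finite_ne_induct)
  case (insert x A)
  then obtain m where m: "m \<in> A" "\<forall>a\<in>A. a = m \<or> r a m" by auto
  have tr: "\<And>x y z. x \<in> S \<Longrightarrow> y \<in> S \<Longrightarrow> z \<in> S \<Longrightarrow> r x y \<Longrightarrow> r y z \<Longrightarrow> r x z"
    and tot: "\<And>x y. x \<in> S \<Longrightarrow> y \<in> S \<Longrightarrow> x = y \<or> r x y \<or> r y x"
    by (fact dense_unboundedD[OF assms(1)])+
  show ?case
  proof (cases "r m x")
    case True
    then have "\<forall>a\<in>insert x A. a = x \<or> r a x"
      using m tr[of _ m x] insert.prems by (metis insert_iff subsetD)
    then show ?thesis by blast
  next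
    case False
    then have "x = m \<or> r x m" using tot m insert.prems by blast
    then show ?thesis using m by blast
  qed
qed auto

lemma dense_unbounded_between:
  assumes S: "dense_unbounded S r" and fin: "finite L" "finite U" "L \<subseteq> S" "U \<subseteq> S"
    and LU: "\<And>l u. l \<in> L \<Longrightarrow> u \<in> U \<Longrightarrow> r l u"
  shows "\<exists>y\<in>S. (\<forall>l\<in>L. r l y) \<and> (\<forall>u\<in>U. r y u)"
proof -
  have tr: "\<And>x y z. x \<in> S \<Longrightarrow> y \<in> S \<Longrightarrow> z \<in> S \<Longrightarrow> r x y \<Longrightarrow> r y z \<Longrightarrow> r x z"
    and dense: "\<And>x y. x \<in> S \<Longrightarrow> y \<in> S \<Longrightarrow> r x y \<Longrightarrow> \<exists>z\<in>S. r x z \<and> r z y"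
    and unb: "\<And>x. x \<in> S \<Longrightarrow> \<exists>y\<in>S. r x y" "\<And>x. x \<in> S \<Longrightarrow> \<exists>y\<in>S. r y x"
    and ne: "S \<noteq> {}"
    by (fact dense_unboundedD[OF S])+
  have max: "\<exists>m\<in>L. \<forall>a\<in>L. a = m \<or> r a m" if "L \<noteq> {}"
    using dense_unbounded_max[OF S fin(1) that fin(3)] .
  have min: "\<exists>m\<in>U. \<forall>a\<in>U. a = m \<or> r m a" if "U \<noteq> {}"
    using dense_unbounded_max[OF dense_unbounded_conversep[OF S] fin(2) that fin(4)] by simp
  consider "L = {}" "U = {}" | "L \<noteq> {}" "U = {}" | "L = {}" "U \<noteq> {}" | "L \<noteq> {}" "U \<noteq> {}" by blast
  then show ?thesis
  proof cases
    case 1 then show ?thesis using ne by auto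
  next
    case 2
    then obtain m where m: "m \<in> L" "\<forall>a\<in>L. a = m \<or> r a m" using max by blast
    then obtain y where "y \<in> S" "r m y" using unb(1) fin by blast
    then have "\<forall>l\<in>L. r l y" using m tr[of _ m y] fin(3) by (metis subsetD)
    then show ?thesis using \<open>y \<in> S\<close> 2 by blast
  next
    case 3
    then obtain m where m: "m \<in> U" "\<forall>a\<in>U. a = m \<or> r m a" using min by blast
    then obtain y where "y \<in> S" "r y m" using unb(2) fin by blast
    then have "\<forall>u\<in>U. r y u" using m tr[of y m] fin(4) by (metis subsetD)
    then show ?thesis using \<open>y \<in> S\<close> 3 by blast
  next
    case 4
    then obtain m m' where m: "m \<in> L" "\<forall>a\<in>L. a = m \<or> r a m" "m' \<in> U" "\<forall>a\<in>U. a = m' \<or> r m' a"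
      using max min by metis
    then obtain y where y: "y \<in> S" "r m y" "r y m'" using dense LU fin by (metis subsetD)
    then have "\<forall>l\<in>L. r l y" "\<forall>u\<in>U. r y u"
      using m tr[of _ m y] tr[of y m'] fin(3,4) by (metis subsetD)+
    then show ?thesis using \<open>y \<in> S\<close> by blast
  qed
qed

definition finite_iso :: "'a set \<Rightarrow> ('a \<Rightarrow> 'a \<Rightarrow> bool) \<Rightarrow> 'b set \<Rightarrow> ('b \<Rightarrow> 'b \<Rightarrow> bool) \<Rightarrow> ('a \<times> 'b) set \<Rightarrow> bool" where
  "finite_iso S r T s P \<longleftrightarrow> finite P \<and> P \<subseteq> S \<times> T \<and>
    (\<forall>(x, y)\<in>P. \<forall>(x', y')\<in>P. (x = x' \<longleftrightarrow> y = y') \<and> (r x x' \<longleftrightarrow> s y y'))"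

lemma finite_iso_converse: "finite_iso S r T s P \<Longrightarrow> finite_iso T s S r (P\<inverse>)"
  unfolding finite_iso_def by fast

lemma finite_iso_forth:
  assumes S: "dense_unbounded S r" and T: "dense_unbounded T s"
    and P: "finite_iso S r T s P" and x: "x \<in> S"
  shows "\<exists>P'. finite_iso S r T s P' \<and> P \<subseteq> P' \<and> x \<in> fst ` P'"
proof (cases "x \<in> fst ` P")
  case True then show ?thesis using P by blast
next
  case False
  have fin: "finite P" and sub: "P \<subseteq> S \<times> T"
    using P unfolding finite_iso_def by blast+
  have iso: "(a = a' \<longleftrightarrow> b = b') \<and> (r a a' \<longleftrightarrow> s b b')" if "(a, b) \<in> P" "(a', b') \<in> P" for a b a' b'
    using P that unfolding finite_iso_def by fast
  have tr: "\<And>x y z. x \<in> S \<Longrightarrow> y \<in> S \<Longrightarrow> z \<in> S \<Longrightarrow> r x y \<Longrightarrow> r y z \<Longrightarrow> r x z"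
    and tot: "\<And>x y. x \<in> S \<Longrightarrow> y \<in> S \<Longrightarrow> x = y \<or> r x y \<or> r y x"
    and irr: "\<And>x. x \<in> S \<Longrightarrow> \<not> r x x"
    by (fact dense_unboundedD[OF S])+
  have tr': "\<And>x y z. x \<in> T \<Longrightarrow> y \<in> T \<Longrightarrow> z \<in> T \<Longrightarrow> s x y \<Longrightarrow> s y z \<Longrightarrow> s x z"
    and irr': "\<And>x. x \<in> T \<Longrightarrow> \<not> s x x"
    by (fact dense_unboundedD[OF T])+
  define L where "L = snd ` {p \<in> P. r (fst p) x}"
  define U where "U = snd ` {p \<in> P. r x (fst p)}"
  have "\<exists>y\<in>T. (\<forall>l\<in>L. s l y) \<and> (\<forall>u\<in>U. s y u)"
  proof (rule dense_unbounded_between[OF T])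
    show "finite L" "finite U" using fin by (auto simp: L_def U_def)
    show "L \<subseteq> T" "U \<subseteq> T" using sub by (auto simp: L_def U_def)
    fix l u assume "l \<in> L" "u \<in> U"
    then obtain a b where ab: "(a, l) \<in> P" "r a x" "(b, u) \<in> P" "r x b" by (auto simp: L_def U_def)
    moreover have "a \<in> S" "b \<in> S" using ab sub by blast+
    ultimately show "s l u" using tr[of a x b] x iso by blast
  qed
  then obtain y where y: "y \<in> T" "\<And>a b. (a, b) \<in> P \<Longrightarrow> r a x \<Longrightarrow> s b y" "\<And>a b. (a, b) \<in> P \<Longrightarrow> r x a \<Longrightarrow> s y b"
    unfolding L_def U_def by force
  have new: "a \<noteq> x \<and> b \<noteq> y \<and> (r a x \<longleftrightarrow> s b y) \<and> (r x a \<longleftrightarrow> s y b)" if ab: "(a, b) \<in> P" for a b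
  proof -
    have abST: "a \<in> S" "b \<in> T" using ab sub by blast+
    have "a \<noteq> x" using False ab by force
    then consider "r a x" "s b y" | "r x a" "s y b" using tot[OF abST(1) x] y(2,3)[OF ab] by blast
    then show ?thesis
      by cases (metis abST irr irr' tr tr' x y(1) \<open>a \<noteq> x\<close>)+
  qed
  have "(u = u' \<longleftrightarrow> v = v') \<and> (r u u' \<longleftrightarrow> s v v')"
    if "(u, v) \<in> insert (x, y) P" "(u', v') \<in> insert (x, y) P" for u v u' v'
    using that
  proof (elim insertE)
    assume "(u, v) = (x, y)" "(u', v') = (x, y)"
    then show ?thesis using irr[OF x] irr'[OF y(1)] by simp
  next
    assume "(u, v) = (x, y)" "(u', v') \<in> P"
    then show ?thesis using new[of u' v'] by auto
  next
    assume "(u, v) \<in> P" "(u', v') = (x, y)"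
    then show ?thesis using new[of u v] by auto
  next
    assume "(u, v) \<in> P" "(u', v') \<in> P"
    then show ?thesis by (rule iso)
  qed
  then have "finite_iso S r T s (insert (x, y) P)"
    unfolding finite_iso_def using fin sub x y(1) by blast
  then show ?thesis by (metis fst_conv image_insert insertI1 subset_insertI)
qed

text \<open>Back and forth. It serves twice: to match the intervals of two labelled colourings, and
  to arrange all classes along the rationals.\<close>

theorem Cantor_isomorphism:
  assumes S: "dense_unbounded S r" and T: "dense_unbounded T s"
  shows "\<exists>f. bij_betw f S T \<and> (\<forall>x\<in>S. \<forall>y\<in>S. r x y \<longleftrightarrow> s (f x) (f y))"
proof -
  have ne: "countable S" "S \<noteq> {}" "countable T" "T \<noteq> {}"
    by (fact dense_unboundedD[OF S] dense_unboundedD[OF T])+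
  have step: "\<exists>P'. finite_iso S r T s P' \<and>
      (P \<subseteq> P' \<and> from_nat_into S n \<in> fst ` P' \<and> from_nat_into T n \<in> snd ` P')"
    if Pn: "finite_iso S r T s P" for P n
  proof -
    obtain P1 where P1: "finite_iso S r T s P1" "P \<subseteq> P1" "from_nat_into S n \<in> fst ` P1"
      using finite_iso_forth[OF S T Pn from_nat_into[OF ne(2)]] by blast
    obtain P2 where P2: "finite_iso T s S r P2" "P1\<inverse> \<subseteq> P2" "from_nat_into T n \<in> fst ` P2"
      using finite_iso_forth[OF T S finite_iso_converse[OF P1(1)] from_nat_into[OF ne(4)]] by blast
    have "finite_iso S r T s (P2\<inverse>)"
      using finite_iso_converse[OF P2(1)] .
    moreover have "P1 \<subseteq> P2\<inverse>" using P2(2) by fastforce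
    moreover have "from_nat_into T n \<in> snd ` (P2\<inverse>)" using P2(3) by force
    ultimately show ?thesis using P1 by blast
  qed
  have "finite_iso S r T s {}" by (simp add: finite_iso_def)
  then obtain P where P: "\<And>n. finite_iso S r T s (P n)"
    "\<And>n. P n \<subseteq> P (Suc n) \<and> from_nat_into S n \<in> fst ` P (Suc n) \<and> from_nat_into T n \<in> snd ` P (Suc n)"
    using dependent_nat_choice[of "\<lambda>_. finite_iso S r T s"
        "\<lambda>n P P'. P \<subseteq> P' \<and> from_nat_into S n \<in> fst ` P' \<and> from_nat_into T n \<in> snd ` P'"] step
    by (metis (no_types, lifting))
  have mono: "P i \<subseteq> P j" if "i \<le> j" for i j
    using lift_Suc_mono_le[of P] P(2) that by blast
  define G where "G = (\<Union>n. P n)"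
  have iso: "(x = x' \<longleftrightarrow> y = y') \<and> (r x x' \<longleftrightarrow> s y y')" if xy: "(x, y) \<in> G" "(x', y') \<in> G" for x y x' y'
  proof -
    obtain i j where "(x, y) \<in> P i" "(x', y') \<in> P j" using xy by (auto simp: G_def)
    then have "(x, y) \<in> P (max i j)" "(x', y') \<in> P (max i j)" using mono by (meson max.cobounded1 max.cobounded2 subsetD)+
    then show ?thesis using P(1)[of "max i j"] unfolding finite_iso_def by fast
  qed
  have sub: "G \<subseteq> S \<times> T" using P(1) unfolding G_def finite_iso_def by blast
  have "\<exists>y. (x, y) \<in> G" if x: "x \<in> S" for x
  proof -
    obtain n where "from_nat_into S n = x" using from_nat_into_surj[OF ne(1) x] by blast
    then have "x \<in> fst ` P (Suc n)" using P(2) by blast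
    then show ?thesis by (force simp: G_def)
  qed
  then obtain f where f: "\<And>x. x \<in> S \<Longrightarrow> (x, f x) \<in> G" by metis
  have "\<exists>x\<in>S. f x = y" if y: "y \<in> T" for y
  proof -
    obtain n where "from_nat_into T n = y" using from_nat_into_surj[OF ne(3) y] by blast
    then have "y \<in> snd ` P (Suc n)" using P(2) by blast
    then obtain x where "(x, y) \<in> G" by (force simp: G_def)
    moreover have "x \<in> S" using calculation sub by blast
    ultimately show ?thesis using f iso by blast
  qed
  moreover have "f x \<in> T" if "x \<in> S" for x using f[OF that] sub by blast
  moreover have "inj_on f S" using f iso by (meson inj_onI)
  ultimately have "bij_betw f S T" unfolding bij_betw_def by blast
  then show ?thesis using f iso by blast
qed

section \<open>Labelled colourings\<close>

text \<open>The residue is below 3, so the number determines both summands. It is at least 3 for a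
  nonempty list, hence the positions 0 and 1 occur in every block.\<close>

definition top_class :: "int list \<Rightarrow> nat" where
  "top_class a = 3 * length a + nat (last a mod 3)"

text \<open>Without the root there is no first block, see \<open>exists_below\<close>.\<close>

definition classes :: "(int list \<times> nat) set" where
  "classes = {(a, j). a \<noteq> [] \<and> j \<le> top_class a}"

definition class_less :: "int list \<times> nat \<Rightarrow> int list \<times> nat \<Rightarrow> bool" where
  "class_less \<kappa> \<mu> \<longleftrightarrow> fst \<kappa> < fst \<mu> \<or> fst \<kappa> = fst \<mu> \<and> snd \<kappa> < snd \<mu>"

text \<open>The pairs \<open>(a, j)\<close> index the monochromatic intervals: \<open>j\<close> is the position of the interval in
  the block of the node \<open>a\<close>, and \<open>m\<close> is the set of nodes whose first interval has a maximum.\<close>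

definition labelled :: "(int list \<Rightarrow> bool) \<Rightarrow> (rat \<Rightarrow> nat) \<Rightarrow> (rat \<Rightarrow> int list \<times> nat) \<Rightarrow> bool" where
  "labelled m c \<alpha> \<longleftrightarrow> range \<alpha> = classes \<and>
    (\<forall>p q. p < q \<longrightarrow> \<alpha> p = \<alpha> q \<or> class_less (\<alpha> p) (\<alpha> q)) \<and>
    (\<forall>p. c p = snd (\<alpha> p) mod 2) \<and>
    (\<forall>p. \<exists>q<p. \<alpha> q = \<alpha> p) \<and>
    (\<forall>p. \<not> (snd (\<alpha> p) = 0 \<and> m (fst (\<alpha> p))) \<longrightarrow> (\<exists>q>p. \<alpha> q = \<alpha> p)) \<and>
    (\<forall>a. a \<noteq> [] \<and> m a \<longrightarrow> (\<exists>p. \<alpha> p = (a, 0) \<and> (\<forall>q>p. \<alpha> q \<noteq> (a, 0))))"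

lemma top_class_ge: "a \<noteq> [] \<Longrightarrow> 3 \<le> top_class a"
  by (cases a) (auto simp: top_class_def)

lemma top_class_eq:
  assumes "top_class a = top_class b" "a \<noteq> []" "b \<noteq> []"
  shows "length a = length b" "last a mod 3 = last b mod 3"
proof -
  have "nat (last a mod 3) < 3" "nat (last b mod 3) < 3" by auto
  moreover have "3 * length a + nat (last a mod 3) = 3 * length b + nat (last b mod 3)"
    using assms(1) by (simp add: top_class_def)
  moreover have "x = y \<and> u = v" if "u < 3" "v < 3" "3 * x + u = 3 * y + v" for x y u v :: nat
    using that by presburger
  ultimately have "length a = length b \<and> nat (last a mod 3) = nat (last b mod 3)" by metis
  then show "length a = length b" "last a mod 3 = last b mod 3"
    by (auto simp: eq_nat_nat_iff)
qed

lemma class_less_irrefl [simp]: "\<not> class_less \<kappa> \<kappa>"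
  by (auto simp: class_less_def)

lemma class_less_trans: "class_less \<kappa> \<mu> \<Longrightarrow> class_less \<mu> \<nu> \<Longrightarrow> class_less \<kappa> \<nu>"
  by (auto simp: class_less_def)

lemma class_less_total: "\<kappa> = \<mu> \<or> class_less \<kappa> \<mu> \<or> class_less \<mu> \<kappa>"
  by (auto simp: class_less_def prod_eq_iff)

lemma class_less_asym: "class_less \<kappa> \<mu> \<Longrightarrow> \<not> class_less \<mu> \<kappa>"
  by (auto simp: class_less_def)

text \<open>Density of the nodes, due to integer entries: below every child there is a smaller one.
  Hence no two blocks are adjacent.\<close>

lemma lex_between:
  fixes a b :: "int list"
  assumes "a < b"
  shows "\<exists>d. d \<noteq> [] \<and> a < d \<and> d < b"
  using assms
proof (induction a arbitrary: b)
  case Nil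
  then obtain k r where "b = k # r" by (cases b) auto
  then show ?case by (intro exI[of _ "[k - 1]"]) simp
next
  case (Cons x xs)
  then obtain y ys where b: "b = y # ys" by (cases b) auto
  show ?case
  proof (cases "x < y")
    case True
    have "xs < xs @ [0]" by (induction xs) auto
    then show ?thesis using True b by (intro exI[of _ "x # xs @ [0]"]) simp
  next
    case False
    then have "x = y" "xs < ys" using Cons.prems b by auto
    then obtain d where "xs < d" "d < ys" using Cons.IH by blast
    then show ?thesis using b \<open>x = y\<close> by (intro exI[of _ "x # d"]) simp
  qed
qed

text \<open>Here and in \<open>lex_between_siblings\<close> the tree structure is read off from
  order and length, the two things that \<open>block_map\<close> will be seen to preserve.\<close>

lemma lex_between_child:
  fixes b e :: "int list"
  assumes "b < e" "e < b @ [k]"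
  shows "length b < length e"
  using assms
proof (induction b arbitrary: e)
  case Nil
  then show ?case by (cases e) auto
next
  case (Cons x xs)
  then show ?case by (cases e) auto
qed

lemma lex_between_siblings:
  fixes b e :: "int list"
  assumes "b @ [k] < e" "e < b @ [k + 1]"
  shows "Suc (length b) < length e"
  using assms
proof (induction b arbitrary: e)
  case Nil
  then show ?case by (cases e) (auto simp: list_less_def)
next
  case (Cons x xs)
  then show ?case by (cases e) auto
qed

lemma lex_append_less: "xs < xs @ [k :: int]"
  by (induction xs) auto

lemma lex_siblings: "b @ [k] < b @ [l] \<longleftrightarrow> k < (l :: int)"
  by (induction b) auto

section \<open>The intervals of a labelled colouring\<close>

context
  fixes m c \<alpha>
  assumes lab: "labelled m c \<alpha>"
begin

lemma labelled_range: "\<alpha> p \<in> classes"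
  using lab by (auto simp: labelled_def)

lemma labelled_surj: "\<kappa> \<in> classes \<Longrightarrow> \<exists>p. \<alpha> p = \<kappa>"
  using lab unfolding labelled_def by (metis imageE)

lemma labelled_mono: "p < q \<Longrightarrow> \<alpha> p = \<alpha> q \<or> class_less (\<alpha> p) (\<alpha> q)"
  using lab unfolding labelled_def by blast

lemma labelled_colour: "c p = snd (\<alpha> p) mod 2"
  using lab unfolding labelled_def by blast

lemma labelled_no_min: "\<exists>q<p. \<alpha> q = \<alpha> p"
  using lab unfolding labelled_def by blast

lemma labelled_no_max: "\<not> (snd (\<alpha> p) = 0 \<and> m (fst (\<alpha> p))) \<Longrightarrow> \<exists>q>p. \<alpha> q = \<alpha> p"
  using lab unfolding labelled_def by blast

lemma labelled_max: "a \<noteq> [] \<Longrightarrow> m a \<Longrightarrow> \<exists>p. \<alpha> p = (a, 0) \<and> (\<forall>q>p. \<alpha> q \<noteq> (a, 0))"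
  using lab unfolding labelled_def by blast

lemma labelled_less: "class_less (\<alpha> p) (\<alpha> q) \<Longrightarrow> p < q"
  using labelled_mono[of q p] class_less_asym class_less_irrefl by (metis linorder_neqE)

lemma labelled_convex: "\<alpha> p = \<alpha> q \<Longrightarrow> p < x \<Longrightarrow> x < q \<Longrightarrow> \<alpha> x = \<alpha> q"
  using labelled_mono[of p x] labelled_mono[of x q] class_less_asym by metis

lemma labelled_two: "\<kappa> \<in> classes \<Longrightarrow> \<exists>p q. p < q \<and> \<alpha> p = \<kappa> \<and> \<alpha> q = \<kappa>"
  using labelled_surj labelled_no_min by metis

text \<open>With its maximum removed, if there is one, every interval is a copy of the
  rationals.\<close>

lemma labelled_fibre:
  assumes "\<kappa> \<in> classes"
  shows "dense_unbounded {p. \<alpha> p = \<kappa> \<and> (\<exists>q>p. \<alpha> q = \<kappa>)} (<)"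
proof -
  have "{p. \<alpha> p = \<kappa> \<and> (\<exists>q>p. \<alpha> q = \<kappa>)} \<noteq> {}" using labelled_two[OF assms] by blast
  moreover have "\<exists>z. (\<alpha> z = \<kappa> \<and> (\<exists>q>z. \<alpha> q = \<kappa>)) \<and> x < z \<and> z < y"
    if xy: "\<alpha> x = \<kappa>" "\<alpha> y = \<kappa>" "x < y" for x y
  proof -
    obtain z where z: "x < z" "z < y" using dense[OF xy(3)] by blast
    then have "\<alpha> z = \<kappa>" using labelled_convex[of x y z] xy by auto
    then show ?thesis using z xy by blast
  qed
  moreover have "\<exists>y. (\<alpha> y = \<kappa> \<and> (\<exists>q>y. \<alpha> q = \<kappa>)) \<and> y < x" if "\<alpha> x = \<kappa>" for x
    using labelled_no_min[of x] that by blast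
  moreover have "\<exists>y. (\<alpha> y = \<kappa> \<and> (\<exists>q>y. \<alpha> q = \<kappa>)) \<and> x < y" if x: "\<alpha> x = \<kappa>" "\<exists>q>x. \<alpha> q = \<kappa>" for x
    using \<open>\<And>y x. \<alpha> x = \<kappa> \<Longrightarrow> \<alpha> y = \<kappa> \<Longrightarrow> x < y \<Longrightarrow>
      \<exists>z. (\<alpha> z = \<kappa> \<and> (\<exists>q>z. \<alpha> q = \<kappa>)) \<and> x < z \<and> z < y\<close> x by metis
  ultimately show ?thesis unfolding dense_unbounded_def by (auto 0 3)
qed

end

text \<open>Cantor isomorphisms between intervals with the same label are glued along the order of
  the labels. Maxima are matched separately: since \<open>m\<close> is common to both sides, the
  same labels have one.\<close>

lemma labelled_isomorphic:
  assumes lab: "labelled m c \<alpha>" "labelled m c' \<alpha>'"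
  shows "\<exists>h. bij h \<and> strict_mono h \<and> (\<forall>q. c q = c' (h q))"
proof -
  define S where "S = (\<lambda>\<alpha> :: rat \<Rightarrow> int list \<times> nat. \<lambda>\<kappa>. {p. \<alpha> p = \<kappa> \<and> (\<exists>q>p. \<alpha> q = \<kappa>)})"
  have "\<exists>f. bij_betw f (S \<alpha> \<kappa>) (S \<alpha>' \<kappa>) \<and> (\<forall>x\<in>S \<alpha> \<kappa>. \<forall>y\<in>S \<alpha> \<kappa>. x < y \<longleftrightarrow> f x < f y)"
    if "\<kappa> \<in> classes" for \<kappa>
    unfolding S_def by (rule Cantor_isomorphism[OF labelled_fibre[OF lab(1) that] labelled_fibre[OF lab(2) that]])
  then obtain f where f: "\<And>\<kappa>. \<kappa> \<in> classes \<Longrightarrow> bij_betw (f \<kappa>) (S \<alpha> \<kappa>) (S \<alpha>' \<kappa>)"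
    "\<And>\<kappa> x y. \<kappa> \<in> classes \<Longrightarrow> x \<in> S \<alpha> \<kappa> \<Longrightarrow> y \<in> S \<alpha> \<kappa> \<Longrightarrow> x < y \<longleftrightarrow> f \<kappa> x < f \<kappa> y"
    by metis
  define is_top where "is_top = (\<lambda>\<alpha> :: rat \<Rightarrow> int list \<times> nat. \<lambda>p. \<forall>q>p. \<alpha> q \<noteq> \<alpha> p)"
  have top_iff: "(\<exists>p. \<beta> p = \<kappa> \<and> is_top \<beta> p) \<longleftrightarrow> (\<exists>a. \<kappa> = (a, 0) \<and> a \<noteq> [] \<and> m a)"
    if "labelled m d \<beta>" for d \<beta> \<kappa>
  proof
    assume "\<exists>p. \<beta> p = \<kappa> \<and> is_top \<beta> p"
    then obtain p where p: "\<beta> p = \<kappa>" "is_top \<beta> p" by blast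
    then have "snd \<kappa> = 0 \<and> m (fst \<kappa>)" using labelled_no_max[OF that, of p] unfolding is_top_def by metis
    moreover have "fst \<kappa> \<noteq> []" using labelled_range[OF that, of p] p(1) by (auto simp: classes_def)
    ultimately show "\<exists>a. \<kappa> = (a, 0) \<and> a \<noteq> [] \<and> m a" by (metis prod.collapse)
  next
    assume "\<exists>a. \<kappa> = (a, 0) \<and> a \<noteq> [] \<and> m a"
    then show "\<exists>p. \<beta> p = \<kappa> \<and> is_top \<beta> p" using labelled_max[OF that] unfolding is_top_def by metis
  qed
  have top_unique: "p = q" if "is_top \<beta> p" "is_top \<beta> q" "\<beta> p = \<beta> q" for \<beta> p q
    using that unfolding is_top_def by (metis linorder_neqE)
  have S_iff: "p \<in> S \<beta> (\<beta> p) \<longleftrightarrow> \<not> is_top \<beta> p" for \<beta> p by (auto simp: S_def is_top_def)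
  define h where "h = (\<lambda>p. if is_top \<alpha> p then SOME q. \<alpha>' q = \<alpha> p \<and> is_top \<alpha>' q else f (\<alpha> p) p)"
  have h_top: "\<alpha>' (h p) = \<alpha> p \<and> is_top \<alpha>' (h p)" if "is_top \<alpha> p" for p
  proof -
    have "\<exists>q. \<alpha>' q = \<alpha> p \<and> is_top \<alpha>' q"
      using that top_iff[OF lab(1), of "\<alpha> p"] top_iff[OF lab(2), of "\<alpha> p"] by blast
    from someI_ex[OF this] show ?thesis unfolding h_def using that by simp
  qed
  have h_S: "h p \<in> S \<alpha>' (\<alpha> p)" if "\<not> is_top \<alpha> p" for p
    using f(1)[OF labelled_range[OF lab(1), of p]] that S_iff[of p \<alpha>]
    by (auto simp: h_def dest: bij_betwE)
  have h_class: "\<alpha>' (h p) = \<alpha> p" for p using h_top[of p] h_S[of p] by (auto simp: S_def)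
  have h_mono: "h p < h q" if "p < q" for p q
  proof (cases "\<alpha> p = \<alpha> q")
    case True
    then have p: "\<not> is_top \<alpha> p" using that by (auto simp: is_top_def)
    show ?thesis
    proof (cases "is_top \<alpha> q")
      case False
      then show ?thesis
        using p S_iff[of p \<alpha>] S_iff[of q \<alpha>] that True f(2)[OF labelled_range[OF lab(1), of q], of p q]
        by (simp add: h_def)
    next
      case top: True
      have "\<exists>r>h p. \<alpha>' r = \<alpha> p" using h_S[OF p] by (auto simp: S_def)
      then obtain r where "h p < r" "\<alpha>' r = \<alpha> q" using True by auto
      moreover have "\<not> h q < r" using h_top[OF top] \<open>\<alpha>' r = \<alpha> q\<close> by (auto simp: is_top_def)
      ultimately show ?thesis by simp
    qed
  next
    case False
    then have "class_less (\<alpha>' (h p)) (\<alpha>' (h q))" using labelled_mono[OF lab(1) that] h_class by simp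
    then show ?thesis by (rule labelled_less[OF lab(2)])
  qed
  have "\<exists>p. h p = q" for q
  proof (cases "is_top \<alpha>' q")
    case True
    then obtain p where p: "\<alpha> p = \<alpha>' q" "is_top \<alpha> p"
      using top_iff[OF lab(1), of "\<alpha>' q"] top_iff[OF lab(2), of "\<alpha>' q"] by blast
    then have "h p = q" using h_top[OF p(2)] True by (intro top_unique[of \<alpha>']) auto
    then show ?thesis by blast
  next
    case False
    have \<kappa>: "\<alpha>' q \<in> classes" by (rule labelled_range[OF lab(2)])
    have "q \<in> S \<alpha>' (\<alpha>' q)" using False S_iff by blast
    then obtain p where p: "p \<in> S \<alpha> (\<alpha>' q)" "f (\<alpha>' q) p = q"
      using f(1)[OF \<kappa>] unfolding bij_betw_def by (metis imageE)
    then have "\<alpha> p = \<alpha>' q" "\<not> is_top \<alpha> p" by (auto simp: S_def is_top_def)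
    then show ?thesis using p(2) by (intro exI[of _ p]) (simp add: h_def)
  qed
  then have "surj h" by (metis surjI)
  moreover have "strict_mono h" using h_mono by (simp add: strict_mono_def)
  moreover have "inj h" using calculation(2) by (rule strict_mono_imp_inj_on)
  moreover have "c q = c' (h q)" for q
    using labelled_colour[OF lab(1)] labelled_colour[OF lab(2)] h_class by simp
  ultimately show ?thesis unfolding bij_def by blast
qed

section \<open>Rigidity of embeddings between labelled colourings\<close>

locale labelled_embedding =
  fixes m c \<alpha> m' c' \<alpha>' g
  assumes lab: "labelled m c \<alpha>" and lab': "labelled m' c' \<alpha>'"
    and dop: "dense_order_preserving g" and col: "\<And>q. c q = c' (g q)"
begin

lemma g_mono: "p < q \<Longrightarrow> g p < g q"
  using dop by (auto simp: dense_order_preserving_def strict_mono_def)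

text \<open>Colours alternate inside a block, and between two blocks lies a third one with both
  colours. So different intervals of one colour are always kept apart, and a map that respects order
  and colour can see them.\<close>

lemma opposite_between:
  assumes "class_less \<kappa> \<mu>" "\<kappa> \<in> classes" "\<mu> \<in> classes" "snd \<kappa> mod 2 = snd \<mu> mod 2"
  shows "\<exists>\<nu>\<in>classes. class_less \<kappa> \<nu> \<and> class_less \<nu> \<mu> \<and> snd \<nu> mod 2 \<noteq> snd \<kappa> mod 2"
proof (cases "fst \<kappa> = fst \<mu>")
  case True
  then have "snd \<kappa> < snd \<mu>" using assms(1) by (auto simp: class_less_def)
  moreover have "Suc (snd \<kappa>) \<noteq> snd \<mu>" using assms(4) by presburger
  ultimately show ?thesis using True assms(2,3)
    by (intro bexI[of _ "(fst \<kappa>, Suc (snd \<kappa>))"]) (auto simp: class_less_def classes_def mod_Suc)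
next
  case False
  then have "fst \<kappa> < fst \<mu>" using assms(1) by (auto simp: class_less_def)
  then obtain d where d: "d \<noteq> []" "fst \<kappa> < d" "d < fst \<mu>" using lex_between by blast
  define j where "j = (if snd \<kappa> mod 2 = 0 then 1 else 0 :: nat)"
  have "(d, j) \<in> classes" using d(1) top_class_ge[OF d(1)] by (auto simp: classes_def j_def)
  then show ?thesis using d by (intro bexI[of _ "(d, j)"]) (auto simp: class_less_def j_def)
qed

text \<open>An interval has two points, so the density condition applied between them forces
  \<open>g\<close> to enter it.\<close>

lemma dense_hit:
  assumes "\<kappa> \<in> classes" "class_less (\<alpha>' (g p)) \<kappa>" "class_less \<kappa> (\<alpha>' (g q))"
  shows "\<exists>x. p < x \<and> x < q \<and> \<alpha>' (g x) = \<kappa>"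
proof -
  obtain r0 r1 where r: "r0 < r1" "\<alpha>' r0 = \<kappa>" "\<alpha>' r1 = \<kappa>" using labelled_two[OF lab' assms(1)] by blast
  then have "g p < r0" "r1 < g q" using labelled_less[OF lab'] assms by auto
  then obtain x where x: "r0 < g x" "g x < r1"
    using dop r(1) unfolding dense_order_preserving_def by blast
  then have "\<alpha>' (g x) = \<kappa>" using labelled_convex[OF lab', of r0 r1 "g x"] r by simp
  moreover have "p < x" "x < q"
    using x \<open>g p < r0\<close> \<open>r1 < g q\<close> g_mono by (metis less_trans linorder_less_linear order_less_irrefl)+
  ultimately show ?thesis by blast
qed

text \<open>Otherwise \<open>g\<close> would enter an interval of the opposite colour from a point
  between \<open>p\<close> and \<open>q\<close>, but those points all have the same colour.\<close>

lemma same_class: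
  assumes "p < q" "\<alpha> p = \<alpha> q"
  shows "\<alpha>' (g p) = \<alpha>' (g q)"
proof (rule ccontr)
  assume "\<alpha>' (g p) \<noteq> \<alpha>' (g q)"
  then have less: "class_less (\<alpha>' (g p)) (\<alpha>' (g q))" using labelled_mono[OF lab' g_mono[OF assms(1)]] by blast
  have colour: "snd (\<alpha> x) mod 2 = snd (\<alpha>' (g x)) mod 2" for x
    using labelled_colour[OF lab] labelled_colour[OF lab'] col by metis
  then obtain \<nu> where \<nu>: "\<nu> \<in> classes" "class_less (\<alpha>' (g p)) \<nu>" "class_less \<nu> (\<alpha>' (g q))"
    "snd \<nu> mod 2 \<noteq> snd (\<alpha>' (g p)) mod 2"
    using opposite_between[OF less labelled_range[OF lab'] labelled_range[OF lab']] assms(2) by metis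
  then obtain x where "p < x" "x < q" "\<alpha>' (g x) = \<nu>" using dense_hit by blast
  then show False using \<nu>(4) colour labelled_convex[OF lab assms(2)] assms(2) by metis
qed

text \<open>Dual to \<open>same_class\<close>: the opposite colour is now found between
  \<open>p\<close> and \<open>q\<close>, so their images cannot share an interval.\<close>

lemma diff_class:
  assumes "class_less (\<alpha> p) (\<alpha> q)"
  shows "class_less (\<alpha>' (g p)) (\<alpha>' (g q))"
proof -
  have colour: "snd (\<alpha> x) mod 2 = snd (\<alpha>' (g x)) mod 2" for x
    using labelled_colour[OF lab] labelled_colour[OF lab'] col by metis
  have le: "\<alpha>' (g x) = \<alpha>' (g y) \<or> class_less (\<alpha>' (g x)) (\<alpha>' (g y))" if "x < y" for x y
    using labelled_mono[OF lab' g_mono[OF that]] .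
  have pq: "p < q" using labelled_less[OF lab assms] .
  show ?thesis
  proof (cases "snd (\<alpha> p) mod 2 = snd (\<alpha> q) mod 2")
    case False
    then show ?thesis using colour le[OF pq] by metis
  next
    case True
    then obtain \<nu> where \<nu>: "\<nu> \<in> classes" "class_less (\<alpha> p) \<nu>" "class_less \<nu> (\<alpha> q)"
      "snd \<nu> mod 2 \<noteq> snd (\<alpha> p) mod 2"
      using opposite_between[OF assms labelled_range[OF lab] labelled_range[OF lab]] by metis
    then obtain x where x: "\<alpha> x = \<nu>" using labelled_surj[OF lab] by blast
    then have "p < x" "x < q" using \<nu> labelled_less[OF lab] by auto
    then show ?thesis using le[of p x] le[of x q] colour \<nu>(4) x by (metis class_less_trans)
  qed
qed

definition class_map :: "int list \<times> nat \<Rightarrow> int list \<times> nat" where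
  "class_map \<kappa> = \<alpha>' (g (SOME p. \<alpha> p = \<kappa>))"

lemma class_map [simp]: "class_map (\<alpha> p) = \<alpha>' (g p)"
proof -
  have "\<alpha> (SOME q. \<alpha> q = \<alpha> p) = \<alpha> p" by (rule someI[of _ p]) simp
  then show ?thesis unfolding class_map_def by (metis linorder_neqE same_class)
qed

lemma class_map_range: "\<kappa> \<in> classes \<Longrightarrow> class_map \<kappa> \<in> classes"
  using labelled_surj[OF lab, of \<kappa>] labelled_range[OF lab'] by auto

lemma class_map_mono:
  "\<kappa> \<in> classes \<Longrightarrow> \<mu> \<in> classes \<Longrightarrow> class_less \<kappa> \<mu> \<Longrightarrow> class_less (class_map \<kappa>) (class_map \<mu>)"
  using labelled_surj[OF lab] diff_class class_map by metis

lemma class_map_inj: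
  "\<kappa> \<in> classes \<Longrightarrow> \<mu> \<in> classes \<Longrightarrow> class_map \<kappa> = class_map \<mu> \<Longrightarrow> \<kappa> = \<mu>"
  using class_map_mono class_less_total class_less_irrefl by metis

lemma class_map_less_iff:
  "\<kappa> \<in> classes \<Longrightarrow> \<mu> \<in> classes \<Longrightarrow> class_less (class_map \<kappa>) (class_map \<mu>) \<longleftrightarrow> class_less \<kappa> \<mu>"
  using class_map_mono class_less_total class_less_irrefl class_less_asym by metis

lemma class_map_convex:
  assumes "\<kappa> \<in> classes" "\<mu> \<in> classes" "\<nu> \<in> classes"
    "class_less (class_map \<kappa>) \<nu>" "class_less \<nu> (class_map \<mu>)"
  shows "\<exists>\<xi>\<in>classes. class_map \<xi> = \<nu> \<and> class_less \<kappa> \<xi> \<and> class_less \<xi> \<mu>"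
proof -
  obtain p q where pq: "\<alpha> p = \<kappa>" "\<alpha> q = \<mu>" using labelled_surj[OF lab] assms by blast
  then have "class_less (\<alpha>' (g p)) \<nu>" "class_less \<nu> (\<alpha>' (g q))" using assms by auto
  then obtain x where x: "\<alpha>' (g x) = \<nu>" using dense_hit assms(3) by blast
  then have "class_map (\<alpha> x) = \<nu>" by simp
  moreover have "\<alpha> x \<in> classes" by (rule labelled_range[OF lab])
  ultimately show ?thesis using assms class_map_less_iff by metis
qed

text \<open>Neighbours have neighbouring images by convexity, and by \<open>lex_between\<close>
  classes can be neighbours only inside one block.\<close>

lemma class_map_Suc:
  assumes "(a, Suc j) \<in> classes"
  shows "class_map (a, Suc j) = (fst (class_map (a, j)), Suc (snd (class_map (a, j))))"
proof -
  have j: "(a, j) \<in> classes" using assms by (auto simp: classes_def)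
  have less: "class_less (class_map (a, j)) (class_map (a, Suc j))"
    by (rule class_map_mono[OF j assms]) (simp add: class_less_def)
  have none: False if "\<nu> \<in> classes" "class_less (class_map (a, j)) \<nu>" "class_less \<nu> (class_map (a, Suc j))" for \<nu>
    using class_map_convex[OF j assms that] by (auto simp: class_less_def)
  obtain a1 j1 a2 j2 where eq: "class_map (a, j) = (a1, j1)" "class_map (a, Suc j) = (a2, j2)"
    by (metis prod.collapse)
  have cl: "(a1, j1) \<in> classes" "(a2, j2) \<in> classes" using class_map_range j assms eq by metis+
  have "a1 = a2"
  proof (rule ccontr)
    assume "a1 \<noteq> a2"
    then have "a1 < a2" using less eq by (auto simp: class_less_def)
    then obtain d where "d \<noteq> []" "a1 < d" "d < a2" using lex_between by blast
    then show False using none[of "(d, 0)"] eq by (auto simp: class_less_def classes_def)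
  qed
  moreover have "j2 = Suc j1"
  proof (rule ccontr)
    assume "j2 \<noteq> Suc j1"
    then have "Suc j1 < j2" using less eq \<open>a1 = a2\<close> by (auto simp: class_less_def)
    then show False using none[of "(a1, Suc j1)"] eq cl \<open>a1 = a2\<close> by (auto simp: class_less_def classes_def)
  qed
  ultimately show ?thesis using eq by simp
qed

text \<open>Position 0 stands for the whole block, as \<open>class_map_eq\<close> justifies.\<close>

definition block_map :: "int list \<Rightarrow> int list" where
  "block_map a = fst (class_map (a, 0))"

lemma block_map_nonempty: "a \<noteq> [] \<Longrightarrow> block_map a \<noteq> []"
  using class_map_range[of "(a, 0)"] by (auto simp: block_map_def classes_def)

lemma exists_below:
  assumes "a \<noteq> []"
  shows "\<exists>b. b \<noteq> [] \<and> b < (a :: int list)"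
proof -
  have "butlast a @ [last a - 1] < butlast a @ [last a]" by (simp add: lex_siblings)
  then show ?thesis using assms by (intro exI[of _ "butlast a @ [last a - 1]"]) simp
qed

text \<open>Density leaves \<open>(a, 0)\<close> without an immediate predecessor. If its image had
  a positive position, the class just below the image would be hit by convexity, say from
  \<open>\<xi>\<close>, and a node between \<open>\<xi>\<close> and \<open>a\<close> would have no
  place to go.\<close>

lemma class_map_zero:
  assumes "a \<noteq> []"
  shows "class_map (a, 0) = (block_map a, 0)"
proof (rule ccontr)
  assume "class_map (a, 0) \<noteq> (block_map a, 0)"
  then obtain j where j: "class_map (a, 0) = (block_map a, Suc j)"
    by (metis block_map_def not0_implies_Suc prod.collapse)
  have a0: "(a, 0) \<in> classes" using assms by (auto simp: classes_def)
  then have "(block_map a, Suc j) \<in> classes" using class_map_range j by metis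
  then have fj: "(block_map a, j) \<in> classes" by (auto simp: classes_def)
  obtain b where b: "b \<noteq> []" "b < a" using exists_below[OF assms] by blast
  then have b0: "(b, 0) \<in> classes" "class_less (b, 0) (a, 0)" by (auto simp: classes_def class_less_def)
  have pred: "\<exists>\<xi>\<in>classes. class_map \<xi> = (block_map a, j)"
  proof (cases "class_map (b, 0) = (block_map a, j)")
    case False
    have "class_less (class_map (b, 0)) (block_map a, Suc j)" using class_map_mono[OF b0(1) a0 b0(2)] j by simp
    then have "class_less (class_map (b, 0)) (block_map a, j)"
      using False by (auto simp: class_less_def prod_eq_iff less_Suc_eq)
    then show ?thesis using class_map_convex[OF b0(1) a0 fj] j by (auto simp: class_less_def)
  qed (use b0 in blast)
  then obtain \<xi> where \<xi>: "\<xi> \<in> classes" "class_map \<xi> = (block_map a, j)" by blast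
  have "class_less \<xi> (a, 0)"
    using class_map_less_iff[OF \<xi>(1) a0] \<xi>(2) j by (simp add: class_less_def)
  then have "fst \<xi> < a" by (auto simp: class_less_def)
  then obtain d where d: "d \<noteq> []" "fst \<xi> < d" "d < a" using lex_between by blast
  then have d0: "(d, 0) \<in> classes" by (auto simp: classes_def)
  have "class_less (class_map \<xi>) (class_map (d, 0))" "class_less (class_map (d, 0)) (class_map (a, 0))"
    using d class_map_mono \<xi>(1) d0 a0 by (auto simp: class_less_def)
  then show False unfolding \<xi>(2) j by (auto simp: class_less_def)
qed

lemma class_map_eq:
  "(a, j) \<in> classes \<Longrightarrow> class_map (a, j) = (block_map a, j)"
proof (induction j)
  case 0
  then show ?case using class_map_zero by (auto simp: classes_def)
next
  case (Suc j)
  then have "class_map (a, j) = (block_map a, j)" by (auto simp: classes_def)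
  then show ?case using class_map_Suc[OF Suc.prems] by simp
qed

lemma block_map_mono:
  assumes "a \<noteq> []" "b \<noteq> []" "a < b"
  shows "block_map a < block_map b"
  using class_map_mono[of "(a, 0)" "(b, 0)"] assms class_map_zero
  by (auto simp: classes_def class_less_def)

lemma block_map_less_iff:
  "a \<noteq> [] \<Longrightarrow> b \<noteq> [] \<Longrightarrow> block_map a < block_map b \<longleftrightarrow> a < b"
  using block_map_mono by (metis linorder_neqE not_less_iff_gr_or_eq)

lemma block_map_convex:
  assumes "a \<noteq> []" "b \<noteq> []" "block_map a < d" "d < block_map b"
  shows "\<exists>e. e \<noteq> [] \<and> block_map e = d \<and> a < e \<and> e < b"
proof -
  have "d \<noteq> []" using assms(3) by auto
  then obtain \<xi> where \<xi>: "\<xi> \<in> classes" "class_map \<xi> = (d, 0)"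
    using class_map_convex[of "(a, 0)" "(b, 0)" "(d, 0)"] assms class_map_zero
    by (auto simp: classes_def class_less_def)
  have e: "fst \<xi> \<noteq> []" using \<xi>(1) by (auto simp: classes_def)
  have "block_map (fst \<xi>) = d" using class_map_eq[of "fst \<xi>" "snd \<xi>"] \<xi> by simp
  then show ?thesis using e assms block_map_less_iff by metis
qed

text \<open>Positions are preserved, so the image block is at least as long. If it were longer, the
  class after the image of the top would be hit by convexity, necessarily from a position of
  \<open>a\<close> beyond its top.\<close>

lemma top_class_block_map:
  assumes "a \<noteq> []"
  shows "top_class (block_map a) = top_class a"
proof (rule antisym)
  have top: "(a, top_class a) \<in> classes" using assms by (auto simp: classes_def)
  then show "top_class a \<le> top_class (block_map a)"
    using class_map_range[OF top] class_map_eq[OF top] by (simp add: classes_def)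
  show "top_class (block_map a) \<le> top_class a"
  proof (rule ccontr)
    assume "\<not> ?thesis"
    then have s: "(block_map a, Suc (top_class a)) \<in> classes"
      using block_map_nonempty[OF assms] by (auto simp: classes_def)
    define b where "b = a @ [0]"
    have b: "b \<noteq> []" "a < b" by (simp_all add: b_def lex_append_less)
    then have b0: "(b, 0) \<in> classes" by (auto simp: classes_def)
    obtain \<xi> where \<xi>: "\<xi> \<in> classes" "class_map \<xi> = (block_map a, Suc (top_class a))"
      using class_map_convex[OF top b0 s] class_map_eq[OF top] class_map_zero[OF b(1)]
        block_map_mono[OF assms b] by (auto simp: class_less_def)
    then have "class_map \<xi> = (block_map (fst \<xi>), snd \<xi>)" using class_map_eq[of "fst \<xi>" "snd \<xi>"] by simp
    then have "block_map (fst \<xi>) = block_map a" "snd \<xi> = Suc (top_class a)" using \<xi>(2) by auto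
    moreover have "fst \<xi> \<noteq> []" using \<xi>(1) by (auto simp: classes_def)
    ultimately have "fst \<xi> = a" using block_map_less_iff assms by (metis linorder_neqE less_irrefl)
    then show False using \<xi>(1) \<open>snd \<xi> = Suc (top_class a)\<close> by (auto simp: classes_def)
  qed
qed

lemma block_map_length: "a \<noteq> [] \<Longrightarrow> length (block_map a) = length a"
  and block_map_last: "a \<noteq> [] \<Longrightarrow> last (block_map a) mod 3 = last a mod 3"
  using top_class_eq[OF top_class_block_map] block_map_nonempty by blast+

text \<open>Suppose the maximum \<open>p\<close> of \<open>(a, 0)\<close> had an image that is not a
  maximum. A point of \<open>(a, 1)\<close> supplies a value of \<open>g\<close> further up, so by
  the density condition \<open>g\<close> takes a value above \<open>g p\<close> in the same
  interval. By injectivity on classes this value comes from \<open>(a, 0)\<close> above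
  \<open>p\<close>.\<close>

lemma block_map_mark:
  assumes "a \<noteq> []" "m a"
  shows "m' (block_map a)"
proof (rule ccontr)
  assume unmarked: "\<not> m' (block_map a)"
  obtain p where p: "\<alpha> p = (a, 0)" "\<And>q. p < q \<Longrightarrow> \<alpha> q \<noteq> (a, 0)"
    using labelled_max[OF lab assms] by blast
  have gp: "\<alpha>' (g p) = (block_map a, 0)" using class_map[of p] p(1) class_map_zero[OF assms(1)] by simp
  then obtain r where r: "g p < r" "\<alpha>' r = (block_map a, 0)"
    using labelled_no_max[OF lab', of "g p"] unmarked by auto
  have a1: "(a, 1) \<in> classes" using assms(1) top_class_ge[OF assms(1)] by (auto simp: classes_def)
  obtain q where q: "\<alpha> q = (a, 1)" using labelled_surj[OF lab a1] by blast
  have "\<alpha>' (g q) = (block_map a, 1)" using class_map[of q] q class_map_eq[OF a1] by simp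
  then have "r < g q" using labelled_less[OF lab', of r "g q"] r(2) by (simp add: class_less_def)
  obtain r0 where r0: "g p < r0" "r0 < r" using dense r(1) by blast
  then obtain x where x: "r0 < g x" "g x < r"
    using dop \<open>r < g q\<close> unfolding dense_order_preserving_def by blast
  have "\<alpha>' (g x) = (block_map a, 0)"
    using labelled_convex[OF lab', of "g p" r "g x"] gp r(2) x r0 by auto
  then have "class_map (\<alpha> x) = class_map (a, 0)" using class_map_zero[OF assms(1)] by simp
  then have "\<alpha> x = (a, 0)"
    using class_map_inj[OF labelled_range[OF lab, of x], of "(a, 0)"] assms(1) by (simp add: classes_def)
  moreover have "p < x" using x r0 g_mono by (metis less_trans linorder_neqE not_less_iff_gr_or_eq)
  ultimately show False using p(2) by blast
qed

text \<open>The parent \<open>d\<close> of the image and \<open>block_map b\<close> have the same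
  length. If \<open>d\<close> were smaller, \<open>block_map b\<close> would lie between
  \<open>d\<close> and a child of \<open>d\<close>; if it were larger, convexity would give a node
  between \<open>b\<close> and its child. Either is too short by
  \<open>lex_between_child\<close>.\<close>

lemma block_map_butlast:
  assumes "b \<noteq> []"
  shows "butlast (block_map (b @ [k])) = block_map b"
proof -
  let ?a = "b @ [k]"
  have len: "length (block_map ?a) = Suc (length b)" "length (block_map b) = length b"
    using block_map_length[of ?a] block_map_length[OF assms] by simp_all
  have less: "block_map b < block_map ?a" using block_map_mono[OF assms] lex_append_less by blast
  define d where "d = butlast (block_map ?a)"
  have d: "block_map ?a = d @ [last (block_map ?a)]" unfolding d_def using len(1)
    by (metis append_butlast_last_id length_0_conv nat.distinct(1))
  have dlen: "length d = length b" using len(1) by (simp add: d_def)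
  have "\<not> d < block_map b"
    using lex_between_child[of d "block_map b" "last (block_map ?a)"] less d dlen len by auto
  moreover have "\<not> block_map b < d"
  proof
    assume "block_map b < d"
    moreover have "d < block_map ?a" using d lex_append_less by metis
    ultimately obtain e where e: "e \<noteq> []" "block_map e = d" "b < e" "e < ?a"
      using block_map_convex[OF assms, of ?a d] by blast
    then have "length b < length e" using lex_between_child by blast
    then show False using block_map_length[OF e(1)] e(2) dlen by simp
  qed
  ultimately show ?thesis unfolding d_def by (metis linorder_neqE)
qed

text \<open>The root has no block and is sent to itself, so that its children are treated like all
  others.\<close>

definition block_map' :: "int list \<Rightarrow> int list" where
  "block_map' a = (if a = [] then [] else block_map a)"

lemma block_map_child: "\<exists>l. block_map (b @ [k]) = block_map' b @ [l]"
proof (cases "b = []")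
  case True
  then have "length (block_map [k]) = 1" using block_map_length[of "[k]"] by simp
  then show ?thesis using True by (auto simp: block_map'_def length_Suc_conv)
next
  case False
  then have "block_map (b @ [k]) = block_map b @ [last (block_map (b @ [k]))]"
    using block_map_butlast block_map_nonempty by (metis append_butlast_last_id append_is_Nil_conv list.distinct(1))
  then show ?thesis using False by (auto simp: block_map'_def)
qed

text \<open>A child skipped between the images of neighbouring siblings would, by convexity, come
  from a node of the same length strictly between these siblings. So children are
  translated.\<close>

lemma block_map_shift:
  assumes U: "\<And>a. a \<noteq> [] \<Longrightarrow> last a mod 3 = 2 \<Longrightarrow> m a \<longleftrightarrow> 0 \<le> last a"
    "\<And>a. a \<noteq> [] \<Longrightarrow> last a mod 3 = 2 \<Longrightarrow> m' a \<longleftrightarrow> 0 \<le> last a"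
  shows "\<exists>s\<ge>0. \<forall>k. block_map (b @ [k]) = block_map' b @ [k + s]"
proof -
  obtain \<sigma> where \<sigma>: "\<And>k. block_map (b @ [k]) = block_map' b @ [\<sigma> k]" using block_map_child by metis
  have "\<sigma> (k + 1) = \<sigma> k + 1" for k
  proof (rule ccontr)
    assume neq: "\<sigma> (k + 1) \<noteq> \<sigma> k + 1"
    have "block_map (b @ [k]) < block_map (b @ [k + 1])"
      by (rule block_map_mono) (auto simp: lex_siblings)
    then have "\<sigma> k < \<sigma> (k + 1)" by (simp add: \<sigma> lex_siblings)
    then have "block_map (b @ [k]) < block_map' b @ [\<sigma> k + 1]" "block_map' b @ [\<sigma> k + 1] < block_map (b @ [k + 1])"
      using neq by (auto simp: \<sigma> lex_siblings)
    then obtain e where e: "e \<noteq> []" "block_map e = block_map' b @ [\<sigma> k + 1]" "b @ [k] < e" "e < b @ [k + 1]"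
      using block_map_convex[of "b @ [k]" "b @ [k + 1]"] by blast
    have "length (block_map' b) = length b" by (simp add: block_map'_def block_map_length)
    then have "length e = Suc (length b)" using block_map_length[OF e(1)] e(2) by simp
    then show False using lex_between_siblings[OF e(3,4)] by simp
  qed
  then have up: "\<sigma> (k + 1) - (k + 1) = \<sigma> k - k" for k by simp
  have lin: "\<sigma> k = k + \<sigma> 0" for k
  proof (induction k rule: int_induct[of _ 0])
    case (step2 i)
    then show ?case using up[of "i - 1"] by simp
  next
    case (step1 i)
    then show ?case using up[of i] by simp
  qed simp
  \<comment> \<open>2 is the least nonnegative integer with residue 2. Its image is nonnegative with
    residue 2, so the translation is a multiple of 3 and at least -2, hence nonnegative.\<close>
  have "m (b @ [2])" using U(1)[of "b @ [2]"] by simp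
  then have "m' (block_map' b @ [\<sigma> 2])" using block_map_mark[of "b @ [2]"] \<sigma> by simp
  moreover have mod: "\<sigma> 2 mod 3 = 2" using block_map_last[of "b @ [2]"] \<sigma> by simp
  ultimately have "0 \<le> \<sigma> 2" using U(2)[of "block_map' b @ [\<sigma> 2]"] by simp
  then have "0 \<le> \<sigma> 0" using lin[of 2] mod by presburger
  then show ?thesis using \<sigma> lin by metis
qed

end

text \<open>The identity is an embedding in both directions. At each node the two translations are
  nonnegative and compose to the identity, so both vanish; this propagates from the root along the
  tree.\<close>

lemma labelled_unique:
  assumes lab: "labelled m c \<alpha>" "labelled m' c \<alpha>'"
    and U: "\<And>a. a \<noteq> [] \<Longrightarrow> last a mod 3 = 2 \<Longrightarrow> m a \<longleftrightarrow> 0 \<le> last a"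
    "\<And>a. a \<noteq> [] \<Longrightarrow> last a mod 3 = 2 \<Longrightarrow> m' a \<longleftrightarrow> 0 \<le> last a"
  shows "\<alpha> = \<alpha>'" "\<And>a. a \<noteq> [] \<Longrightarrow> m a \<longleftrightarrow> m' a"
proof -
  have id: "dense_order_preserving (\<lambda>x. x)"
    unfolding dense_order_preserving_def strict_mono_def using dense by blast
  interpret A: labelled_embedding m c \<alpha> m' c \<alpha>' "\<lambda>x. x"
    using lab id by unfold_locales auto
  interpret B: labelled_embedding m' c \<alpha>' m c \<alpha> "\<lambda>x. x"
    using lab id by unfold_locales auto
  have BA: "B.block_map (A.block_map a) = a" if a: "a \<noteq> []" for a
  proof -
    obtain p where p: "\<alpha> p = (a, 0)" using labelled_surj[OF lab(1), of "(a, 0)"] a by (auto simp: classes_def)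
    then have "\<alpha>' p = (A.block_map a, 0)" using A.class_map[of p] A.class_map_zero[OF that] by simp
    then show ?thesis
      using B.class_map[of p] B.class_map_zero[OF A.block_map_nonempty[OF that]] p by simp
  qed
  have A_id: "A.block_map' a = a" for a
  proof (induction a rule: rev_induct)
    case Nil
    then show ?case by (simp add: A.block_map'_def)
  next
    case (snoc k b)
    have B_id: "B.block_map' b = b"
      using BA[of b] snoc by (auto simp: A.block_map'_def B.block_map'_def split: if_splits)
    obtain s where s: "s \<ge> 0" "\<And>k. A.block_map (b @ [k]) = b @ [k + s]"
      using A.block_map_shift[OF U, of b] unfolding snoc by blast
    obtain t where t: "t \<ge> 0" "\<And>k. B.block_map (b @ [k]) = b @ [k + t]"
      using B.block_map_shift[OF U(2,1), of b] unfolding B_id by blast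
    have "b @ [k + s + t] = b @ [k]" using BA[of "b @ [k]"] s(2) t(2) by simp
    then have "s = 0" using s(1) t(1) by simp
    then show ?case using s(2) by (simp add: A.block_map'_def)
  qed
  then have A_id': "A.block_map a = a" if "a \<noteq> []" for a
    using that by (metis A.block_map'_def)
  show "\<alpha> = \<alpha>'"
  proof
    fix p
    have "\<alpha> p \<in> classes" by (rule labelled_range[OF lab(1)])
    then have "A.class_map (\<alpha> p) = \<alpha> p"
      using A.class_map_eq[of "fst (\<alpha> p)" "snd (\<alpha> p)"] A_id'[of "fst (\<alpha> p)"] by (auto simp: classes_def)
    then show "\<alpha> p = \<alpha>' p" by simp
  qed
  show "m a \<longleftrightarrow> m' a" if "a \<noteq> []" for a
    using A.block_map_mark[OF that] B.block_map_mark[OF that] A_id'[OF that] BA[OF that] by auto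
qed

section \<open>Cubes of rationals\<close>

lemma cube_less:
  fixes x y :: "'a::linordered_field"
  assumes "x < y"
  shows "x ^ 3 < y ^ 3"
proof -
  have "x \<noteq> 0 \<or> y \<noteq> 0" using assms by auto
  \<comment> \<open>This factor is \<open>x\<^sup>2 + x * y + y\<^sup>2\<close>, the quotient of
    \<open>y ^ 3 - x ^ 3\<close> by \<open>y - x\<close>, written as a sum of squares.\<close>
  then have "0 < (x + y / 2)\<^sup>2 + 3 / 4 * y\<^sup>2"
    by (cases "y = 0") (auto intro: add_nonneg_pos)
  then have "0 < (y - x) * ((x + y / 2)\<^sup>2 + 3 / 4 * y\<^sup>2)" using assms by simp
  also have "\<dots> = y ^ 3 - x ^ 3" by (simp add: power2_eq_square power3_eq_cube field_simps)
  finally show ?thesis by simp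
qed

lemma cube_less_iff: "x ^ 3 < y ^ 3 \<longleftrightarrow> x < (y :: 'a::linordered_field)"
  using cube_less by (metis linorder_neqE order_less_asym order_less_irrefl)

text \<open>No order isomorphism carries an interval without a maximum onto one with a maximum.
  Cubing has dense range but omits 2, so it can carry the first into the second and leave out just
  the maximum.\<close>

lemma cube_dense:
  fixes r s :: rat
  assumes "r < s"
  shows "\<exists>q. r < q ^ 3 \<and> q ^ 3 < s"
proof -
  have "root 3 (of_rat r) < root 3 (of_rat s)" using assms by (simp add: of_rat_less)
  then obtain q where q: "root 3 (of_rat r) < of_rat q" "of_rat q < root 3 (of_rat s)"
    using of_rat_dense by blast
  have "root 3 (of_rat r) ^ 3 < (of_rat q :: real) ^ 3" "(of_rat q :: real) ^ 3 < root 3 (of_rat s) ^ 3"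
    using q by (simp_all add: cube_less_iff)
  then have "(of_rat r :: real) < of_rat (q ^ 3)" "(of_rat (q ^ 3) :: real) < of_rat s"
    by (simp_all add: odd_real_root_pow of_rat_power)
  then show ?thesis by (auto simp: of_rat_less)
qed

lemma cube_neq_two: "(q :: rat) ^ 3 \<noteq> 2"
proof
  assume q: "q ^ 3 = 2"
  obtain a b where ab: "q = of_int a / of_int b" "b > 0" "coprime a b"
    using quotient_of_unique[of q] by (metis Fract_of_int_quotient fst_conv snd_conv)
  have "(of_int a :: rat) ^ 3 = 2 * of_int b ^ 3" using q ab by (simp add: power_divide field_simps)
  then have "(of_int (a ^ 3) :: rat) = of_int (2 * b ^ 3)" by simp
  then have eq: "a ^ 3 = 2 * b ^ 3" by (simp only: of_int_eq_iff)
  then have "even (a ^ 3)" by simp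
  then have "even a" by simp
  then obtain k where "a = 2 * k" by blast
  then have "b ^ 3 = 2 * (2 * k ^ 3)" using eq by (simp add: power_mult_distrib)
  then have "even (b ^ 3)" by simp
  then have "even b" by simp
  then show False using \<open>even a\<close> ab(3) by (meson coprime_common_divisor odd_one)
qed

section \<open>A labelled colouring for every set of marks\<close>

definition point_less :: "(int list \<times> nat) \<times> rat \<Rightarrow> (int list \<times> nat) \<times> rat \<Rightarrow> bool" where
  "point_less P Q \<longleftrightarrow> class_less (fst P) (fst Q) \<or> fst P = fst Q \<and> snd P < snd Q"

lemma dense_unbounded_points: "dense_unbounded (classes \<times> UNIV) point_less"
  unfolding dense_unbounded_def
proof (intro conjI ballI impI)
  have "([0], 0) \<in> classes" by (simp add: classes_def)
  then show "classes \<times> (UNIV :: rat set) \<noteq> {}" by blast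
  show "countable (classes \<times> (UNIV :: rat set))" by simp
  fix P Q :: "(int list \<times> nat) \<times> rat" assume PQ: "P \<in> classes \<times> UNIV" "Q \<in> classes \<times> UNIV"
  show "P = Q \<or> point_less P Q \<or> point_less Q P"
    using class_less_total[of "fst P" "fst Q"] by (auto simp: point_less_def prod_eq_iff)
  show "\<not> point_less P P" by (simp add: point_less_def)
  show "\<exists>Z\<in>classes \<times> UNIV. point_less P Z \<and> point_less Z Q" if PQ': "point_less P Q"
  proof (cases "fst P = fst Q")
    case True
    then have "snd P < snd Q" using PQ' by (auto simp: point_less_def)
    then obtain z where "snd P < z" "z < snd Q" using dense by blast
    then show ?thesis using True PQ by (intro bexI[of _ "(fst P, z)"]) (auto simp: point_less_def)
  next
    case False
    then have "class_less (fst P) (fst Q)" using PQ' by (auto simp: point_less_def)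
    then show ?thesis using PQ by (intro bexI[of _ "(fst P, snd P + 1)"]) (auto simp: point_less_def)
  qed
  show "\<exists>Q\<in>classes \<times> UNIV. point_less P Q"
    using PQ(1) by (intro bexI[of _ "(fst P, snd P + 1)"]) (auto simp: point_less_def)
  show "\<exists>Q\<in>classes \<times> UNIV. point_less Q P"
    using PQ(1) by (intro bexI[of _ "(fst P, snd P - 1)"]) (auto simp: point_less_def)
next
  fix P Q Z :: "(int list \<times> nat) \<times> rat"
  assume "point_less P Q" "point_less Q Z"
  then show "point_less P Z" by (auto simp: point_less_def intro: class_less_trans)
qed

lemma dense_unbounded_rat: "dense_unbounded (UNIV :: rat set) (<)"
  unfolding dense_unbounded_def using dense lt_ex gt_ex by auto

text \<open>One arrangement of the rationals is fixed for all sets of marks. The colour of a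
  rational then depends on the mark of a single node, which makes the colouring a Borel function of
  \<open>y\<close>.\<close>

definition point :: "rat \<Rightarrow> (int list \<times> nat) \<times> rat" where
  "point = (SOME f. bij_betw f UNIV (classes \<times> UNIV) \<and> (\<forall>p q. p < q \<longleftrightarrow> point_less (f p) (f q)))"

lemma point: "bij_betw point UNIV (classes \<times> UNIV)" "p < q \<longleftrightarrow> point_less (point p) (point q)"
proof -
  have "\<exists>f. bij_betw f UNIV (classes \<times> UNIV) \<and> (\<forall>p q :: rat. p < q \<longleftrightarrow> point_less (f p) (f q))"
    using Cantor_isomorphism[OF dense_unbounded_rat dense_unbounded_points] by simp
  from someI_ex[OF this] show "bij_betw point UNIV (classes \<times> UNIV)"
    "p < q \<longleftrightarrow> point_less (point p) (point q)"
    unfolding point_def[symmetric] by blast+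
qed

lemma point_range: "fst (point p) \<in> classes"
  using point(1) unfolding bij_betw_def by (metis mem_Times_iff rangeI)

lemma point_surj: "\<kappa> \<in> classes \<Longrightarrow> \<exists>p. point p = (\<kappa>, x)"
  using point(1) unfolding bij_betw_def by (metis SigmaI UNIV_I imageE)

text \<open>The classes \<open>(a, 0)\<close> and \<open>(a, 1)\<close> share the points over \<open>(a, 0)\<close>. They are separated by the
  cut at \<open>0\<close>, whose lower part has a maximum, if \<open>a\<close> is marked, and by the irrational cut at the
  cube root of \<open>2\<close> otherwise. The map \<open>x \<mapsto> x ^ 3 - 2\<close> turns the second cut into the first.\<close>

definition label :: "(int list \<Rightarrow> bool) \<Rightarrow> rat \<Rightarrow> int list \<times> nat" where
  "label m p = (case point p of (\<kappa>, x) \<Rightarrow>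
    if snd \<kappa> = 0 \<and> (if m (fst \<kappa>) then 0 < x else 2 < x ^ 3) then (fst \<kappa>, 1) else \<kappa>)"

definition colouring :: "(int list \<Rightarrow> bool) \<Rightarrow> rat \<Rightarrow> nat" where
  "colouring m p = snd (label m p) mod 2"

lemma label_point:
  "point p = ((a, j), x) \<Longrightarrow>
    label m p = (if j = 0 \<and> (if m a then 0 < x else 2 < x ^ 3) then (a, 1) else (a, j))"
  by (simp add: label_def)

lemma labelled_colouring: "labelled m (colouring m) (label m)"
  unfolding labelled_def
proof (intro conjI allI impI)
  show "range (label m) = classes"
  proof (intro equalityI subsetI)
    fix \<kappa> assume "\<kappa> \<in> range (label m)"
    then obtain p where p: "\<kappa> = label m p" by blast
    obtain a j x where pt: "point p = ((a, j), x)" by (metis prod.collapse)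
    then have "(a, j) \<in> classes" using point_range[of p] by simp
    then show "\<kappa> \<in> classes"
      unfolding p label_point[OF pt] using top_class_ge[of a] by (auto simp: classes_def)
  next
    fix \<kappa> assume \<kappa>: "\<kappa> \<in> classes"
    \<comment> \<open>\<open>-1\<close> lies below both cuts, so the label is the class
      itself.\<close>
    obtain p where "point p = ((fst \<kappa>, snd \<kappa>), -1)" using point_surj[OF \<kappa>, of "-1"] by auto
    then have "label m p = \<kappa>" by (simp add: label_def)
    then show "\<kappa> \<in> range (label m)" by blast
  qed
  show "label m p = label m q \<or> class_less (label m p) (label m q)" if pq: "p < q" for p q
  proof -
    obtain a j x where p: "point p = ((a, j), x)" by (metis prod.collapse)
    obtain b i y where q: "point q = ((b, i), y)" by (metis prod.collapse)
    consider "a < b" | "a = b" "j < i" | "a = b" "j = i" "x < y"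
      using pq[unfolded point(2)[of p q]] p q by (auto simp: point_less_def class_less_def)
    then show ?thesis
    proof cases
      case 3
      then have "x ^ 3 < y ^ 3" by (simp add: cube_less)
      then show ?thesis using 3 by (auto simp: label_point[OF p] label_point[OF q] class_less_def)
    qed (auto simp: label_point[OF p] label_point[OF q] class_less_def)
  qed
  show "colouring m p = snd (label m p) mod 2" for p by (simp add: colouring_def)
  show "\<exists>q<p. label m q = label m p" for p
  proof -
    obtain a j x where p: "point p = ((a, j), x)" by (metis prod.collapse)
    then have aj: "(a, j) \<in> classes" using point_range[of p] by simp
    have "\<exists>y<x. (if m a then 0 < y else 2 < y ^ 3) \<longleftrightarrow> (if m a then 0 < x else 2 < x ^ 3)"
    proof (cases "if m a then 0 < x else 2 < x ^ 3")
      case True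
      show ?thesis
      proof (cases "m a")
        case True
        then show ?thesis using \<open>if m a then 0 < x else 2 < x ^ 3\<close> by (intro exI[of _ "x / 2"]) auto
      next
        case False
        then have "2 < x ^ 3" using True by simp
        then obtain y where "2 < y ^ 3" "y ^ 3 < x ^ 3" using cube_dense by blast
        then show ?thesis using False \<open>2 < x ^ 3\<close> by (auto simp: cube_less_iff)
      qed
    next
      case False
      have "(x - 1) ^ 3 < x ^ 3" by (rule cube_less) simp
      then show ?thesis using False by (intro exI[of _ "x - 1"]) (auto split: if_splits)
    qed
    then obtain y where y: "y < x"
      "(if m a then 0 < y else 2 < y ^ 3) \<longleftrightarrow> (if m a then 0 < x else 2 < x ^ 3)" by blast
    obtain q where q: "point q = ((a, j), y)" using point_surj[OF aj] by blast
    have "q < p" unfolding point(2)[of q p] using y(1) by (simp add: p q point_less_def)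
    moreover have "label m q = label m p" unfolding label_point[OF p] label_point[OF q] using y(2) by auto
    ultimately show ?thesis by blast
  qed
  show "\<exists>q>p. label m q = label m p" if notmax: "\<not> (snd (label m p) = 0 \<and> m (fst (label m p)))" for p
  proof -
    obtain a j x where p: "point p = ((a, j), x)" by (metis prod.collapse)
    then have aj: "(a, j) \<in> classes" using point_range[of p] by simp
    have "\<exists>y>x. j = 0 \<longrightarrow> ((if m a then 0 < y else 2 < y ^ 3) \<longleftrightarrow> (if m a then 0 < x else 2 < x ^ 3))"
    proof (cases "j = 0 \<and> \<not> (if m a then 0 < x else 2 < x ^ 3)")
      case True
      then have "\<not> m a" using notmax by (auto simp: label_point[OF p])
      \<comment> \<open>No rational sits on the irrational cut, so there is room between
        \<open>x\<close> and the cut.\<close>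
      then have "x ^ 3 < 2" using True cube_neq_two[of x] by auto
      then obtain y where "x ^ 3 < y ^ 3" "y ^ 3 < 2" using cube_dense by blast
      then show ?thesis using \<open>\<not> m a\<close> \<open>x ^ 3 < 2\<close> by (auto simp: cube_less_iff)
    next
      case False
      have "x ^ 3 < (x + 1) ^ 3" by (rule cube_less) simp
      then show ?thesis using False by (intro exI[of _ "x + 1"]) (auto split: if_splits)
    qed
    then obtain y where y: "x < y"
      "j = 0 \<longrightarrow> ((if m a then 0 < y else 2 < y ^ 3) \<longleftrightarrow> (if m a then 0 < x else 2 < x ^ 3))"
      by (elim exE conjE) (rule that)
    obtain q where q: "point q = ((a, j), y)" using point_surj[OF aj] by blast
    have "p < q" unfolding point(2)[of p q] using y(1) by (simp add: p q point_less_def)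
    moreover have "label m q = label m p" unfolding label_point[OF p] label_point[OF q] using y(2) by auto
    ultimately show ?thesis by blast
  qed
  show "\<exists>p. label m p = (a, 0) \<and> (\<forall>q>p. label m q \<noteq> (a, 0))" if a: "a \<noteq> [] \<and> m a" for a
  proof -
    have "(a, 0) \<in> classes" using a by (simp add: classes_def)
    then obtain p where p: "point p = ((a, 0), 0)" using point_surj by blast
    have "label m q \<noteq> (a, 0)" if "p < q" for q
    proof -
      obtain b i y where q: "point q = ((b, i), y)" by (metis prod.collapse)
      then show ?thesis
        using that[unfolded point(2)[of p q]] p a by (auto simp: label_point[OF q] point_less_def class_less_def)
    qed
    moreover have "label m p = (a, 0)" using a by (simp add: label_point[OF p])
    ultimately show ?thesis by blast
  qed
qed

section \<open>Embeddings from translations\<close>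

primrec shift :: "(nat \<Rightarrow> int) \<Rightarrow> int list \<Rightarrow> int list" where
  "shift t [] = []"
| "shift t (x # xs) = (x + 3 * t 0) # shift (\<lambda>i. t (Suc i)) xs"

lemma length_shift [simp]: "length (shift t a) = length a"
  by (induction a arbitrary: t) auto

lemma shift_eq_Nil [simp]: "shift t a = [] \<longleftrightarrow> a = []"
  by (cases a) auto

lemma nth_shift: "i < length a \<Longrightarrow> shift t a ! i = a ! i + 3 * t i"
  by (induction a arbitrary: t i) (auto simp: nth_Cons split: nat.splits)

lemma last_shift: "a \<noteq> [] \<Longrightarrow> last (shift t a) = last a + 3 * t (length a - 1)"
  by (simp add: last_conv_nth nth_shift)

lemma shift_less: "shift t a < shift t b \<longleftrightarrow> a < b"
proof (induction a arbitrary: t b)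
  case Nil
  then show ?case by (cases b) auto
next
  case (Cons x xs)
  then show ?case by (cases b) auto
qed

lemma shift_inverse: "shift t (shift (\<lambda>i. - t i) a) = a"
  by (induction a arbitrary: t) auto

text \<open>Adding multiples of 3 keeps the last residue, which together with the length determines
  the size of a block.\<close>

lemma shift_classes: "(shift t a, j) \<in> classes \<longleftrightarrow> (a, j) \<in> classes"
  by (cases "a = []") (auto simp: classes_def top_class_def last_shift)

text \<open>The nodes are shifted and each fibre is mapped identically, except over
  \<open>(a, 0)\<close> when a mark is created: there \<open>x ^ 3 - 2\<close> carries the cut at
  the cube root of 2 to the cut at 0.\<close>

lemma colouring_embedding:
  assumes mm': "\<And>a. a \<noteq> [] \<Longrightarrow> m a \<Longrightarrow> m' (shift t a)"
  shows "\<exists>g. dense_order_preserving g \<and> (\<forall>q. colouring m q = colouring m' (g q))"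
proof -
  define e where "e = (\<lambda>(\<kappa> :: int list \<times> nat) x. if snd \<kappa> = 0 \<and> \<not> m (fst \<kappa>) \<and> m' (shift t (fst \<kappa>)) then x ^ 3 - 2 else x :: rat)"
  have e_mono: "e \<kappa> x < e \<kappa> y" if "x < y" for \<kappa> x y
    using that by (simp add: e_def cube_less)
  have e_dense: "\<exists>y. u < e \<kappa> y \<and> e \<kappa> y < v" if uv: "u < v" for \<kappa> u v
  proof -
    obtain y where "u + 2 < y ^ 3" "y ^ 3 < v + 2" using cube_dense[of "u + 2" "v + 2"] uv by auto
    then have "u < y ^ 3 - 2" "y ^ 3 - 2 < v" by auto
    then have "\<exists>y. u < y ^ 3 - 2 \<and> y ^ 3 - 2 < v" by blast
    moreover have "(\<forall>y. e \<kappa> y = y ^ 3 - 2) \<or> (\<forall>y. e \<kappa> y = y)" by (auto simp: e_def)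
    ultimately show ?thesis using dense[OF uv] by auto
  qed
  have "\<exists>q. point q = ((shift t (fst (fst (point p))), snd (fst (point p))), e (fst (point p)) (snd (point p)))" for p
  proof (rule point_surj)
    show "(shift t (fst (fst (point p))), snd (fst (point p))) \<in> classes"
      using point_range[of p] by (simp add: shift_classes)
  qed
  then obtain g where g: "\<And>p. point (g p) =
      ((shift t (fst (fst (point p))), snd (fst (point p))), e (fst (point p)) (snd (point p)))"
    using choice[of "\<lambda>p q. point q =
      ((shift t (fst (fst (point p))), snd (fst (point p))), e (fst (point p)) (snd (point p)))"]
    by blast
  have "g p < g q" if "p < q" for p q
    using that unfolding point(2)[of p q] point(2)[of "g p" "g q"] g by (auto simp: point_less_def class_less_def shift_less e_mono)
  then have "strict_mono g" by (simp add: strict_mono_def)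
  moreover have "\<exists>q. r0 < g q \<and> g q < r1" if r: "r0 < r1" for r0 r1
  proof -
    obtain b j x where r0: "point r0 = ((b, j), x)" by (metis prod.collapse)
    obtain b' j' x' where r1: "point r1 = ((b', j'), x')" by (metis prod.collapse)
    define a where "a = shift (\<lambda>i. - t i) b"
    have a: "shift t a = b" by (simp add: a_def shift_inverse)
    have "(b, j) \<in> classes" using point_range[of r0] r0 by simp
    then have "(a, j) \<in> classes" using a shift_classes by metis
    \<comment> \<open>It is enough to land above \<open>r0\<close> in its own fibre. The bound
      \<open>v\<close> matters when \<open>r1\<close> lies in that fibre too; otherwise every point
      of the fibre is below \<open>r1\<close>.\<close>
    define v where "v = (if (b, j) = (b', j') then x' else x + 1)"
    have "x < v" using r[unfolded point(2)[of r0 r1]] r0 r1 by (auto simp: v_def point_less_def class_less_def)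
    then obtain y where y: "x < e (a, j) y" "e (a, j) y < v" using e_dense by blast
    obtain q where q: "point q = ((a, j), y)" using point_surj[OF \<open>(a, j) \<in> classes\<close>] by blast
    have gq: "point (g q) = ((b, j), e (a, j) y)" unfolding g q using a by simp
    have "r0 < g q" unfolding point(2)[of r0 "g q"] using y(1) by (simp add: gq r0 point_less_def)
    moreover have "g q < r1"
      unfolding point(2)[of "g q" r1] using y(2) r[unfolded point(2)[of r0 r1]]
      by (auto simp: gq r0 r1 point_less_def v_def split: if_splits)
    ultimately show ?thesis by blast
  qed
  ultimately have "dense_order_preserving g" unfolding dense_order_preserving_def by blast
  moreover have "colouring m q = colouring m' (g q)" for q
  proof -
    obtain a j x where q: "point q = ((a, j), x)" by (metis prod.collapse)
    then have "(a, j) \<in> classes" using point_range[of q] by simp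
    then have "a \<noteq> []" by (simp add: classes_def)
    have gq: "point (g q) = ((shift t a, j), e (a, j) x)" unfolding g q by simp
    show ?thesis
      unfolding colouring_def label_point[OF q] label_point[OF gq]
      using mm'[OF \<open>a \<noteq> []\<close>] by (auto simp: e_def)
  qed
  ultimately show ?thesis by blast
qed

section \<open>Marks\<close>

text \<open>The address \<open>a\<close> encodes \<open>(u, s)\<close> by \<open>a\<^sub>i = 3 s\<^sub>i + u\<^sub>i\<close>. The value at the empty list is never
  used.\<close>

definition mark ::
    "(((nat \<Rightarrow> nat) \<times> (nat \<Rightarrow> nat)) \<times> (nat \<Rightarrow> nat)) set \<Rightarrow> (nat \<Rightarrow> nat) \<Rightarrow> int list \<Rightarrow> bool" where
  "mark F y a \<longleftrightarrow> (if last a mod 3 = 2 then 0 \<le> last a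
    else (\<forall>x\<in>set a. 0 \<le> x \<and> x mod 3 \<noteq> 2) \<and>
      chain F (length a) (\<lambda>i. nat (a ! i mod 3)) y (\<lambda>i. nat (a ! i div 3)))"

lemma mark_origin: "last a mod 3 = 2 \<Longrightarrow> mark F y a \<longleftrightarrow> 0 \<le> last a"
  by (simp add: mark_def)

text \<open>Only the first \<open>length a\<close> entries of \<open>y\<close> enter a chain, so
  each chain condition is open.\<close>

lemma mark_measurable: "Measurable.pred borel (\<lambda>y. mark F y a)"
proof -
  have "open {y. chain F n u y s}" for n u s
  proof (subst open_subopen, intro ballI)
    fix y assume y: "y \<in> {y. chain F n u y s}"
    have "{v. agree n y v} = (\<Inter>i\<in>{..<n}. (\<lambda>v. v i) -` {y i})" by (auto simp: agree_def)
    moreover have "open (\<Inter>i\<in>{..<n}. (\<lambda>v :: nat \<Rightarrow> nat. v i) -` {y i})"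
      by (intro open_INT ballI open_vimage open_discrete continuous_coordinate) auto
    moreover have "{v. agree n y v} \<subseteq> {y. chain F n u y s}"
      using y by (auto intro: chain_cong simp: agree_def)
    ultimately show "\<exists>T. open T \<and> y \<in> T \<and> T \<subseteq> {y. chain F n u y s}"
      by (intro exI[of _ "{v. agree n y v}"]) (auto simp: agree_def)
  qed
  then have "Measurable.pred borel (\<lambda>y. chain F n u y s)" for n u s by (simp add: pred_def)
  then show ?thesis unfolding mark_def by measurable
qed

text \<open>The pair with witness \<open>t\<close> is one more link at the end of the chain from
  \<open>u\<close> to \<open>y\<close>, and the factor 3 in \<open>shift\<close> adds
  \<open>t\<close> to the quotients. Markers stay marked because their last entry does not
  decrease.\<close>

lemma mark_shift:
  assumes F: "((y, y'), t) \<in> F" and m: "mark F y a" and a: "a \<noteq> []"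
  shows "mark F y' (shift (\<lambda>i. int (t i)) a)"
proof -
  let ?b = "shift (\<lambda>i. int (t i)) a"
  have last: "last ?b mod 3 = last a mod 3" "last ?b \<ge> last a" using last_shift[OF a] by simp_all
  show ?thesis
  proof (cases "last a mod 3 = 2")
    case True
    then show ?thesis using m last by (simp add: mark_def)
  next
    case False
    then have pos: "\<And>i. i < length a \<Longrightarrow> 0 \<le> a ! i \<and> a ! i mod 3 \<noteq> 2"
      and ch: "chain F (length a) (\<lambda>i. nat (a ! i mod 3)) y (\<lambda>i. nat (a ! i div 3))"
      using m by (auto simp: mark_def)
    have "chain F (length a) y y' t"
    proof (rule chain_step[OF F])
      show "chain F (length a) y' y' (\<lambda>_. 0)" by (rule chain_refl) (simp add: agree_def)
    qed (auto simp: agree_def)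
    from chain_trans[OF ch this]
    have "chain F (length a) (\<lambda>i. nat (?b ! i mod 3)) y' (\<lambda>i. nat (?b ! i div 3))"
    proof (rule chain_cong)
      fix i assume "i < length a"
      then have "?b ! i div 3 = a ! i div 3 + int (t i)" "0 \<le> a ! i div 3" using pos by (auto simp: nth_shift pos_imp_zdiv_nonneg_iff)
      then show "nat (a ! i div 3) + t i \<le> nat (?b ! i div 3)" by simp
    qed (auto simp: agree_def nth_shift)
    moreover have "\<forall>x\<in>set ?b. 0 \<le> x \<and> x mod 3 \<noteq> 2"
      using pos by (auto simp: in_set_conv_nth nth_shift)
    ultimately show ?thesis using last False by (simp add: mark_def)
  qed
qed

text \<open>A chain without links costs nothing, so quotients 0 suffice. This is the marked branch
  whose image is studied in \<open>embedding_imp_chain\<close>.\<close>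

lemma mark_path:
  assumes "\<And>i. y i \<le> 1" "n > 0"
  shows "mark F y (map (\<lambda>i. int (y i)) [0..<n])"
proof -
  have y: "int (y i) mod 3 = int (y i)" "int (y i) div 3 = 0" for i using assms(1)[of i] by auto
  have "last (map (\<lambda>i. int (y i)) [0..<n]) = int (y (n - 1))" using assms(2) by (simp add: last_map)
  moreover have "int (y i) \<noteq> 2" for i using assms(1)[of i] by linarith
  moreover have "chain F n (\<lambda>i. nat (map (\<lambda>i. int (y i)) [0..<n] ! i mod 3)) y s" for s
    by (rule chain_refl) (simp add: agree_def y)
  ultimately show ?thesis by (auto simp: mark_def y)
qed

lemma mark_path_converse:
  assumes a: "mark F y' a" "length a = n" "n > 0" and res: "\<And>i. i < n \<Longrightarrow> a ! i mod 3 = int (y i)"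
    and y: "\<And>i. y i \<le> 1"
  shows "chain F n y y' (\<lambda>i. nat (a ! i div 3))"
proof -
  have "a \<noteq> []" using a by auto
  then have "last a mod 3 \<noteq> 2" using res[of "n - 1"] y[of "n - 1"] a by (simp add: last_conv_nth)
  then have "chain F n (\<lambda>i. nat (a ! i mod 3)) y' (\<lambda>i. nat (a ! i div 3))"
    using a by (simp add: mark_def)
  then show ?thesis by (rule chain_cong) (auto simp: agree_def res)
qed

text \<open>The branch of \<open>y\<close> has quotients 0. If it is marked for \<open>y'\<close>
  too, the chains behind these marks have no links, and they only say that prefixes of
  \<open>y\<close> and \<open>y'\<close> agree.\<close>

lemma mark_inj:
  assumes eq: "\<And>a. a \<noteq> [] \<Longrightarrow> mark F y a \<longleftrightarrow> mark F y' a" and y: "\<And>i. y i \<le> 1"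
    and one: "\<And>p t. (p, t) \<in> F \<Longrightarrow> t 0 = 1"
  shows "y = y'"
proof
  fix i
  define a where "a = map (\<lambda>j. int (y j)) [0..<Suc i]"
  have y3: "int (y j) mod 3 = int (y j)" "int (y j) div 3 = 0" for j using y[of j] by auto
  have "mark F y' a" using mark_path[of y "Suc i" F] y eq[of a] by (simp add: a_def)
  then have "chain F (Suc i) y y' (\<lambda>j. nat (a ! j div 3))"
    by (rule mark_path_converse) (use y in \<open>auto simp: a_def y3 simp del: upt_Suc\<close>)
  then have "agree (Suc i) y y'"
    by (rule chain_zero) (use one y3 in \<open>auto simp: a_def simp del: upt_Suc\<close>)
  then show "y i = y' i" by (simp add: agree_def)
qed

text \<open>Parents go to parents, so the prefixes of the branch \<open>y\<close> are mapped to the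
  prefixes of one sequence \<open>k\<close>. Its residues spell \<open>y\<close>, and its quotients
  form one witness that serves all levels.\<close>

lemma embedding_imp_chain:
  assumes emb: "labelled_embedding (mark F y) c \<alpha> (mark F y') c' \<alpha>' g" and y: "\<And>i. y i \<le> 1"
  shows "\<exists>s. \<forall>n. chain F n y y' s"
proof -
  interpret labelled_embedding "mark F y" c \<alpha> "mark F y'" c' \<alpha>' g by (rule emb)
  define path where "path = (\<lambda>n. map (\<lambda>i. int (y i)) [0..<n])"
  define k where "k = (\<lambda>i. last (block_map (path (Suc i))))"
  have path_Suc: "path (Suc n) = path n @ [int (y n)]" for n by (simp add: path_def)
  have path_ne: "path (Suc n) \<noteq> []" for n by (simp add: path_def)
  have image: "block_map' (path n) = map k [0..<n]" for n
  proof (induction n)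
    case 0
    then show ?case by (simp add: path_def block_map'_def)
  next
    case (Suc n)
    obtain l where l: "block_map (path (Suc n)) = block_map' (path n) @ [l]"
      using block_map_child[of "path n" "int (y n)"] unfolding path_Suc by blast
    then have "l = k n" by (simp add: k_def)
    then show ?case using l Suc path_ne[of n] by (simp add: block_map'_def)
  qed
  have res: "k i mod 3 = int (y i)" for i
    using block_map_last[OF path_ne[of i]] y[of i] by (simp add: k_def path_Suc)
  have "chain F (Suc n) y y' (\<lambda>i. nat (k i div 3))" for n
  proof -
    have "mark F y (path (Suc n))" unfolding path_def by (rule mark_path[OF y]) simp
    then have "mark F y' (block_map (path (Suc n)))" by (rule block_map_mark[OF path_ne])
    then have mark: "mark F y' (map k [0..<Suc n])"
      using image[of "Suc n"] path_ne[of n] by (simp add: block_map'_def)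
    have "chain F (Suc n) y y' (\<lambda>i. nat (map k [0..<Suc n] ! i div 3))"
      by (rule mark_path_converse[OF mark _ _ _ y]) (auto simp: res simp del: upt_Suc)
    then show ?thesis by (rule chain_cong) (auto simp: agree_def simp del: upt_Suc)
  qed
  then have "chain F n y y' (\<lambda>i. nat (k i div 3))" for n using chain_mono[of F "Suc n"] by simp
  then show ?thesis by blast
qed

section \<open>Composition and transport\<close>

lemma dense_order_preserving_comp:
  assumes f: "dense_order_preserving f" and g: "dense_order_preserving g"
  shows "dense_order_preserving (\<lambda>x. g (f x))"
proof -
  have mono: "f x < f y \<longleftrightarrow> x < y" "g x < g y \<longleftrightarrow> x < y" for x y
    using f g by (auto simp: dense_order_preserving_def strict_mono_less)
  have "\<exists>q. r0 < g (f q) \<and> g (f q) < r1" if r: "g (f q0) < r0" "r0 < r1" "r1 < g (f q1)" for q0 q1 r0 r1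
  proof -
    \<comment> \<open>The midpoint gives two values \<open>g u < g v\<close> in the interval; then
      \<open>f\<close> has to take a value between \<open>u\<close> and \<open>v\<close>.\<close>
    obtain r where rr: "r0 < r" "r < r1" using dense[OF r(2)] by blast
    obtain u where u: "r0 < g u" "g u < r"
      using g r(1) rr order_less_trans[OF rr(2) r(3)] unfolding dense_order_preserving_def by metis
    obtain v where v: "r < g v" "g v < r1"
      using g r(3) rr order_less_trans[OF r(1) rr(1)] unfolding dense_order_preserving_def by metis
    have "f q0 < u" "u < v" "v < f q1"
      using r u v by (meson mono(2) order_less_trans)+
    then obtain q where "u < f q" "f q < v" using f unfolding dense_order_preserving_def by metis
    then show ?thesis using u v by (meson mono(2) order_less_trans)
  qed
  then show ?thesis unfolding dense_order_preserving_def strict_mono_def using mono by blast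
qed

lemma dense_order_preserving_iso:
  assumes "bij h" "strict_mono h"
  shows "dense_order_preserving h"
  unfolding dense_order_preserving_def using assms
  by (metis UNIV_I bij_betw_imp_surj_on dense imageE)

text \<open>Labels travel along automorphisms; this makes the set \<open>B\<close> of the main
  argument invariant.\<close>

lemma labelled_transport:
  assumes lab: "labelled m c \<alpha>" and h: "bij h" "strict_mono h" "\<And>q. c q = c' (h q)"
  shows "labelled m c' (\<lambda>p. \<alpha> (inv h p))"
proof -
  have inv: "inv h (h p) = p" "h (inv h p) = p" for p using h(1) by (auto simp: bij_is_inj bij_is_surj surj_f_inv_f)
  have mono: "inv h p < inv h q \<longleftrightarrow> p < q" for p q using h(2) inv by (metis strict_mono_less)
  show ?thesis
    unfolding labelled_def
  proof (intro conjI allI impI)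
    show "range (\<lambda>p. \<alpha> (inv h p)) = classes"
      using labelled_range[OF lab] labelled_surj[OF lab] inv(1) by (auto simp: image_iff) metis
    show "\<alpha> (inv h p) = \<alpha> (inv h q) \<or> class_less (\<alpha> (inv h p)) (\<alpha> (inv h q))" if "p < q" for p q
      using labelled_mono[OF lab] that mono by blast
    show "c' p = snd (\<alpha> (inv h p)) mod 2" for p
      using labelled_colour[OF lab, of "inv h p"] h(3)[of "inv h p"] inv by simp
    show "\<exists>q<p. \<alpha> (inv h q) = \<alpha> (inv h p)" for p
      using labelled_no_min[OF lab, of "inv h p"] mono inv by metis
    show "\<exists>q>p. \<alpha> (inv h q) = \<alpha> (inv h p)"
      if "\<not> (snd (\<alpha> (inv h p)) = 0 \<and> m (fst (\<alpha> (inv h p))))" for p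
      using labelled_no_max[OF lab that] mono inv by metis
    show "\<exists>p. \<alpha> (inv h p) = (a, 0) \<and> (\<forall>q>p. \<alpha> (inv h q) \<noteq> (a, 0))" if "a \<noteq> [] \<and> m a" for a
    proof -
      obtain p where "\<alpha> p = (a, 0)" "\<And>q. p < q \<Longrightarrow> \<alpha> q \<noteq> (a, 0)"
        using labelled_max[OF lab] \<open>a \<noteq> [] \<and> m a\<close> by blast
      then show ?thesis using mono inv by (intro exI[of _ "h p"]) (metis inv(1))
    qed
  qed
qed

section \<open>Colourings of the rationals\<close>

lemma space_rat_colourings: "space (rat_colourings C) = UNIV \<rightarrow> C"
  by (simp add: rat_colourings_def space_PiM PiE_UNIV_domain)

lemma rat_colourings_coordinate: "(\<lambda>c. c q) \<in> rat_colourings C \<rightarrow>\<^sub>M count_space UNIV"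
proof -
  have "(\<lambda>c. c q) \<in> rat_colourings C \<rightarrow>\<^sub>M count_space C"
    unfolding rat_colourings_def by (rule measurable_component_singleton) simp
  moreover have "(\<lambda>x. x) \<in> count_space C \<rightarrow>\<^sub>M count_space UNIV" by simp
  ultimately show ?thesis by (rule measurable_compose)
qed

lemma measurable_rat_colourings:
  fixes C :: "'c::countable set"
  assumes f: "\<And>x. x \<in> space M \<Longrightarrow> f x \<in> UNIV \<rightarrow> C"
    and "\<And>q. (\<lambda>x. f x q) \<in> M \<rightarrow>\<^sub>M count_space UNIV"
  shows "f \<in> M \<rightarrow>\<^sub>M rat_colourings C"
  unfolding rat_colourings_def
proof (rule measurable_PiM_single')
  show "(\<lambda>x. f x q) \<in> M \<rightarrow>\<^sub>M count_space C" for q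
  proof (rule measurableI)
    fix A assume "A \<in> sets (count_space C)"
    have "(\<lambda>x. f x q) -` A \<inter> space M \<in> sets M" by (rule measurable_sets[OF assms(2)]) simp
    then show "(\<lambda>x. f x q) -` A \<inter> space M \<in> sets M" .
  qed (use f in auto)
  show "f \<in> space M \<rightarrow> (\<Pi>\<^sub>E q\<in>UNIV. space (count_space C))" using f by (auto simp: PiE_UNIV_domain)
qed

text \<open>A closed subspace of a countable product of discrete spaces is Polish. Its Borel sets
  are those of the product sigma-algebra because the identity is measurable in both
  directions.\<close>

lemma standard_Borel_rat_colourings: "standard_Borel (rat_colourings (C :: nat set))"
proof -
  define S where "S = (UNIV :: rat set) \<rightarrow> C"
  define T where "T = subtopology (euclidean :: (rat \<Rightarrow> nat) topology) S"
  have "closed S"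
  proof -
    have "S = (\<Inter>q. (\<lambda>c. c q) -` C)" by (auto simp: S_def)
    moreover have "closed (\<Inter>q. (\<lambda>c :: rat \<Rightarrow> nat. c q) -` C)"
      by (intro closed_INT ballI closed_vimage continuous_on_product_then_coordinatewise[OF continuous_on_id])
        (simp add: closed_def open_discrete)
    ultimately show ?thesis by simp
  qed
  have "completely_metrizable_space (euclidean :: nat topology)"
    by (metis completely_metrizable_space_discrete_topology discrete_topology_unique
        open_discrete open_openin topspace_euclidean UNIV_I)
  then have "completely_metrizable_space (euclidean :: (rat \<Rightarrow> nat) topology)"
    unfolding euclidean_product_topology[symmetric] completely_metrizable_space_product_topology by simp
  then have "completely_metrizable_space T"
    unfolding T_def by (rule completely_metrizable_space_closedin) (simp add: \<open>closed S\<close>)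
  moreover have "separable_space T"
  proof -
    obtain B :: "(rat \<Rightarrow> nat) set set" where B: "countable B" "topological_basis B"
      using ex_countable_basis by blast
    have "second_countable (euclidean :: (rat \<Rightarrow> nat) topology)"
      unfolding second_countable_def
    proof (intro exI[of _ B] conjI ballI allI impI)
      show "openin euclidean V" if "V \<in> B" for V using topological_basis_open[OF B(2) that] by simp
      fix U and x :: "rat \<Rightarrow> nat" assume "openin euclidean U \<and> x \<in> U"
      then show "\<exists>V\<in>B. x \<in> V \<and> V \<subseteq> U" using topological_basisE[OF B(2)] by (metis open_openin)
    qed (rule B(1))
    then show ?thesis
      unfolding T_def by (intro second_countable_imp_separable_space second_countable_subtopology)
  qed
  moreover have "sets (rat_colourings C) = sigma_sets (space (rat_colourings C)) {U. openin T U}"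
  proof -
    have "id \<in> restrict_space borel S \<rightarrow>\<^sub>M rat_colourings C"
    proof (rule measurable_rat_colourings)
      have "(\<lambda>c :: rat \<Rightarrow> nat. c q) \<in> borel \<rightarrow>\<^sub>M borel" for q
        by (intro borel_measurable_continuous_onI continuous_on_product_then_coordinatewise[OF continuous_on_id])
      then have "(\<lambda>c :: rat \<Rightarrow> nat. c q) \<in> borel \<rightarrow>\<^sub>M count_space UNIV" for q
        by (simp add: measurable_cong_sets[OF refl sets_borel_eq_count_space])
      then show "(\<lambda>c. id c q) \<in> restrict_space borel S \<rightarrow>\<^sub>M count_space UNIV" for q
        by (simp add: measurable_restrict_space1)
    qed (simp add: S_def space_restrict_space)
    moreover have "id \<in> rat_colourings C \<rightarrow>\<^sub>M restrict_space borel S"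
    proof (rule measurable_restrict_space2)
      show "id \<in> rat_colourings C \<rightarrow>\<^sub>M borel"
        using rat_colourings_coordinate
        by (intro measurable_fun_borel) (simp add: measurable_cong_sets[OF refl sets_borel_eq_count_space])
    qed (simp add: S_def space_rat_colourings)
    moreover have sp: "space (restrict_space borel S) = S" "space (rat_colourings C) = S"
      by (simp_all add: space_restrict_space S_def space_rat_colourings)
    moreover have "sets N \<subseteq> sets M" if "id \<in> M \<rightarrow>\<^sub>M N" "space M = space N" for M N :: "(rat \<Rightarrow> nat) measure"
    proof
      fix A assume A: "A \<in> sets N"
      then have "id -` A \<inter> space M = A" using sets.sets_into_space[OF A] that(2) by auto
      then show "A \<in> sets M" using measurable_sets[OF that(1) A] by simp
    qed
    ultimately have "sets (rat_colourings C) = sets (restrict_space borel S)" by (metis subset_antisym)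
    also have "\<dots> = (\<inter>) S ` sigma_sets UNIV {U. open U}" by (simp add: sets_restrict_space sets_borel)
    also have "\<dots> = sigma_sets S ((\<inter>) S ` {U. open U})"
      using \<open>closed S\<close> by (intro sigma_sets_Int) (auto simp: sets_borel[symmetric])
    also have "(\<inter>) S ` {U. open U} = {U. openin T U}"
      by (auto simp: T_def openin_subtopology)
    finally show ?thesis using sp by simp
  qed
  moreover have "topspace T = space (rat_colourings C)" by (simp add: T_def S_def space_rat_colourings)
  ultimately show ?thesis unfolding standard_Borel_def Polish_space_def by blast
qed

text \<open>Through \<open>to_nat\<close> and \<open>from_nat\<close> every sequence decodes to a
  map of the rationals and every map has a code, so the quantifier over \<open>g\<close> becomes a
  projection along the Baire space.\<close>

lemma analytic_colour_relation:
  fixes C :: "nat set"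
  assumes \<Phi>m: "Measurable.pred borel (\<lambda>x :: nat \<Rightarrow> nat. \<Phi> (\<lambda>q. from_nat (x (to_nat q)) :: rat))"
  shows "analytic_in (rat_colourings C \<Otimes>\<^sub>M rat_colourings C)
    {(c, c'). c \<in> UNIV \<rightarrow> C \<and> c' \<in> UNIV \<rightarrow> C \<and> (\<exists>g. \<Phi> g \<and> (\<forall>q. (c q, c' (g q)) \<in> R))}"
proof -
  let ?X = "rat_colourings C"
  let ?M = "(?X \<Otimes>\<^sub>M ?X) \<Otimes>\<^sub>M (borel :: (nat \<Rightarrow> nat) measure)"
  define gf where "gf = (\<lambda>x :: nat \<Rightarrow> nat. \<lambda>q :: rat. from_nat (x (to_nat q)) :: rat)"
  define W where "W = {w \<in> space ?M. \<Phi> (gf (snd w)) \<and> (\<forall>q. (fst (fst w) q, snd (fst w) (gf (snd w) q)) \<in> R)}"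
  have 1: "(\<lambda>w. fst (fst w) q) \<in> ?M \<rightarrow>\<^sub>M count_space UNIV" for q
    by (rule measurable_compose[OF _ rat_colourings_coordinate]) measurable
  have 2: "(\<lambda>w. snd (fst w) q) \<in> ?M \<rightarrow>\<^sub>M count_space UNIV" for q
    by (rule measurable_compose[OF _ rat_colourings_coordinate]) measurable
  have 3: "(\<lambda>w. gf (snd w) q) \<in> ?M \<rightarrow>\<^sub>M count_space UNIV" for q
  proof -
    have "(\<lambda>w. snd w (to_nat q)) \<in> ?M \<rightarrow>\<^sub>M count_space UNIV"
      by (rule measurable_compose[OF measurable_snd measurable_coordinate])
    then show ?thesis unfolding gf_def by (rule measurable_compose) simp
  qed
  \<comment> \<open>The argument of the second colouring depends on \<open>w\<close> but takes only
    countably many values.\<close>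
  have 4: "(\<lambda>w. snd (fst w) (gf (snd w) q)) \<in> ?M \<rightarrow>\<^sub>M count_space UNIV" for q
    by (rule measurable_compose_countable[OF 2 3])
  have "Measurable.pred ?M (\<lambda>w. (i, snd (fst w) (gf (snd w) q)) \<in> R)" for i q
    by (rule measurable_compose[OF 4]) simp
  then have [measurable]: "Measurable.pred ?M (\<lambda>w. (fst (fst w) q, snd (fst w) (gf (snd w) q)) \<in> R)" for q
    by (rule measurable_compose_countable[OF _ 1])
  have [measurable]: "Measurable.pred ?M (\<lambda>w. \<Phi> (gf (snd w)))"
    unfolding gf_def by (rule measurable_compose[OF measurable_snd \<Phi>m])
  have "W \<in> sets ?M" unfolding W_def by measurable
  moreover have "{(c, c'). c \<in> UNIV \<rightarrow> C \<and> c' \<in> UNIV \<rightarrow> C \<and> (\<exists>g. \<Phi> g \<and> (\<forall>q. (c q, c' (g q)) \<in> R))} = fst ` W"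
  proof (intro equalityI subsetI)
    fix p assume "p \<in> {(c, c'). c \<in> UNIV \<rightarrow> C \<and> c' \<in> UNIV \<rightarrow> C \<and> (\<exists>g. \<Phi> g \<and> (\<forall>q. (c q, c' (g q)) \<in> R))}"
    then obtain c c' g where p: "p = (c, c')" "c \<in> UNIV \<rightarrow> C" "c' \<in> UNIV \<rightarrow> C" "\<Phi> g"
      "\<forall>q. (c q, c' (g q)) \<in> R" by blast
    have "gf (\<lambda>n. to_nat (g (from_nat n))) = g" by (simp add: gf_def)
    then have "((c, c'), \<lambda>n. to_nat (g (from_nat n))) \<in> W"
      using p by (simp add: W_def space_pair_measure space_rat_colourings)
    then show "p \<in> fst ` W" using p(1) by force
  next
    fix p assume "p \<in> fst ` W"
    then show "p \<in> {(c, c'). c \<in> UNIV \<rightarrow> C \<and> c' \<in> UNIV \<rightarrow> C \<and> (\<exists>g. \<Phi> g \<and> (\<forall>q. (c q, c' (g q)) \<in> R))}"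
      by (auto simp: W_def space_pair_measure space_rat_colourings)
  qed
  ultimately show ?thesis unfolding analytic_in_def by blast
qed

lemma coded_map_measurable:
  fixes P :: "rat \<Rightarrow> rat \<Rightarrow> bool"
  shows "Measurable.pred borel (\<lambda>x :: nat \<Rightarrow> nat. P (from_nat (x m)) (from_nat (x n)))"
proof -
  have "Measurable.pred borel (\<lambda>x :: nat \<Rightarrow> nat. P (from_nat i) (from_nat (x n)))" for i
    by (rule measurable_compose[OF measurable_coordinate]) simp
  then show ?thesis by (rule measurable_compose_countable[OF _ measurable_coordinate])
qed

lemma dense_order_preserving_measurable:
  "Measurable.pred borel (\<lambda>x :: nat \<Rightarrow> nat. dense_order_preserving (\<lambda>q. from_nat (x (to_nat q))))"
proof -
  have [measurable]: "Measurable.pred borel (\<lambda>x :: nat \<Rightarrow> nat. from_nat (x m) < (from_nat (x n) :: rat))"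
    for m n by (rule coded_map_measurable)
  have [measurable]: "Measurable.pred borel (\<lambda>x :: nat \<Rightarrow> nat. from_nat (x n) < r)"
    "Measurable.pred borel (\<lambda>x :: nat \<Rightarrow> nat. r < from_nat (x n))" for r :: rat and n
    by (rule measurable_compose[OF measurable_coordinate], simp)+
  show ?thesis unfolding dense_order_preserving_def strict_mono_def by measurable
qed

lemma order_automorphism_measurable:
  "Measurable.pred borel (\<lambda>x :: nat \<Rightarrow> nat. bij (\<lambda>q :: rat. from_nat (x (to_nat q)) :: rat) \<and>
    strict_mono (\<lambda>q :: rat. from_nat (x (to_nat q)) :: rat))"
proof -
  \<comment> \<open>Strict monotonicity gives injectivity, and what remains quantifies over
    rationals only.\<close>
  have eq: "bij h \<and> strict_mono h \<longleftrightarrow> (\<forall>r. \<exists>q. h q = r) \<and> strict_mono h" for h :: "rat \<Rightarrow> rat"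
    unfolding bij_def surj_def using strict_mono_imp_inj_on by metis
  have [measurable]: "Measurable.pred borel (\<lambda>x :: nat \<Rightarrow> nat. from_nat (x m) < (from_nat (x n) :: rat))"
    for m n by (rule coded_map_measurable)
  have [measurable]: "Measurable.pred borel (\<lambda>x :: nat \<Rightarrow> nat. from_nat (x n) = r)" for r :: rat and n
    by (rule measurable_compose[OF measurable_coordinate]) simp
  show ?thesis unfolding eq unfolding strict_mono_def by measurable
qed

lemma dop_le_analytic_quasi_order:
  fixes C :: "nat set"
  assumes R: "preorder_on C R"
  shows "analytic_quasi_order (rat_colourings C) (dop_le C R)"
proof -
  have "refl_on C R" "trans R" using R by (auto simp: preorder_on_def)
  have "dense_order_preserving (\<lambda>q. q)"
    unfolding dense_order_preserving_def strict_mono_def using dense by blast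
  then have "refl_on (UNIV \<rightarrow> C) (dop_le C R)"
    using \<open>refl_on C R\<close> unfolding refl_on_def dop_le_def by (auto intro!: exI[of _ "\<lambda>q. q"])
  moreover have "trans (dop_le C R)"
  proof (rule transI)
    fix c c' c'' assume "(c, c') \<in> dop_le C R" "(c', c'') \<in> dop_le C R"
    then obtain g g' where g: "dense_order_preserving g" "\<And>q. (c q, c' (g q)) \<in> R"
      "dense_order_preserving g'" "\<And>q. (c' q, c'' (g' q)) \<in> R" and "c \<in> UNIV \<rightarrow> C" "c'' \<in> UNIV \<rightarrow> C"
      unfolding dop_le_def by blast
    moreover have "(c q, c'' (g' (g q))) \<in> R" for q using transD[OF \<open>trans R\<close> g(2)] g(4) by blast
    ultimately show "(c, c'') \<in> dop_le C R"
      using dense_order_preserving_comp[OF g(1,3)] unfolding dop_le_def by blast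
  qed
  moreover have "dop_le C R \<subseteq> (UNIV \<rightarrow> C) \<times> (UNIV \<rightarrow> C)" by (auto simp: dop_le_def)
  moreover have "analytic_in (rat_colourings C \<Otimes>\<^sub>M rat_colourings C) (dop_le C R)"
    unfolding dop_le_def by (rule analytic_colour_relation) (rule dense_order_preserving_measurable)
  ultimately show ?thesis by (simp add: analytic_quasi_order_def preorder_on_def space_rat_colourings)
qed

lemma dop_iso_sym: "(c, c') \<in> dop_iso C \<Longrightarrow> (c', c) \<in> dop_iso C"
proof -
  assume "(c, c') \<in> dop_iso C"
  then obtain h where h: "bij h" "strict_mono h" "\<And>q. c q = c' (h q)" "c \<in> UNIV \<rightarrow> C" "c' \<in> UNIV \<rightarrow> C"
    unfolding dop_iso_def by blast
  have inv: "h (inv h q) = q" for q using h(1) by (simp add: bij_is_surj surj_f_inv_f)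
  have "strict_mono (inv h)" unfolding strict_mono_def using h(2) inv by (metis strict_mono_less)
  moreover have "c' q = c (inv h q)" for q using h(3) inv by metis
  ultimately show "(c', c) \<in> dop_iso C" unfolding dop_iso_def using h bij_imp_bij_inv by blast
qed

lemma dop_iso_analytic_equivalence:
  fixes C :: "nat set"
  shows "analytic_equivalence (rat_colourings C) (dop_iso C)"
proof -
  have "refl_on (UNIV \<rightarrow> C) (dop_iso C)"
    unfolding refl_on_def dop_iso_def by (auto intro!: exI[of _ "\<lambda>q. q"] simp: strict_mono_def bij_def)
  moreover have "sym (dop_iso C)" using dop_iso_sym by (rule symI)
  moreover have "trans (dop_iso C)"
  proof (rule transI)
    fix c c' c'' assume "(c, c') \<in> dop_iso C" "(c', c'') \<in> dop_iso C"
    then obtain g h where g: "bij g" "strict_mono g" "\<And>q. c q = c' (g q)"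
      "bij h" "strict_mono h" "\<And>q. c' q = c'' (h q)" and "c \<in> UNIV \<rightarrow> C" "c'' \<in> UNIV \<rightarrow> C"
      unfolding dop_iso_def by blast
    moreover have "bij (h \<circ> g)" "strict_mono (h \<circ> g)"
      using g by (auto intro: bij_comp simp: strict_mono_def)
    moreover have "c q = c'' ((h \<circ> g) q)" for q using g by simp
    ultimately show "(c, c'') \<in> dop_iso C" unfolding dop_iso_def by blast
  qed
  moreover have "dop_iso C \<subseteq> (UNIV \<rightarrow> C) \<times> (UNIV \<rightarrow> C)" by (auto simp: dop_iso_def)
  moreover have "analytic_in (rat_colourings C \<Otimes>\<^sub>M rat_colourings C) (dop_iso C)"
  proof -
    have "dop_iso C = {(c, c'). c \<in> UNIV \<rightarrow> C \<and> c' \<in> UNIV \<rightarrow> C \<and>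
        (\<exists>g. (bij g \<and> strict_mono g) \<and> (\<forall>q. (c q, c' (g q)) \<in> Id))}"
      by (simp add: dop_iso_def conj_assoc)
    then show ?thesis
      using analytic_colour_relation[OF order_automorphism_measurable, of C Id] by simp
  qed
  ultimately show ?thesis by (simp add: analytic_equivalence_def equiv_def space_rat_colourings)
qed

lemma dop_iso_subset_dop_le:
  assumes "refl_on C R"
  shows "dop_iso C \<subseteq> dop_le C R"
proof
  fix p assume "p \<in> dop_iso C"
  then obtain c c' h where p: "p = (c, c')" "c \<in> UNIV \<rightarrow> C" "c' \<in> UNIV \<rightarrow> C"
    and h: "bij h" "strict_mono h" "\<And>q. c q = c' (h q)" unfolding dop_iso_def by blast
  have "(c q, c' (h q)) \<in> R" for q
  proof -
    have "c q \<in> C" using p(2) by auto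
    then show ?thesis using assms h(3)[of q] by (simp add: refl_on_def)
  qed
  then show "p \<in> dop_le C R"
    unfolding dop_le_def using p dense_order_preserving_iso[OF h(1,2)] by blast
qed

section \<open>Invariant universality\<close>

text \<open>All quantifiers in \<open>labelled\<close> range over countable types. A mark at the
  variable node \<open>fst (af x p)\<close> is handled by running through the countably many values
  of \<open>af x p\<close>.\<close>

lemma labelled_measurable:
  assumes y: "yf \<in> M \<rightarrow>\<^sub>M borel" and c: "\<And>p. (\<lambda>x. cf x p) \<in> M \<rightarrow>\<^sub>M count_space UNIV"
    and a: "\<And>p. (\<lambda>x. af x p) \<in> M \<rightarrow>\<^sub>M count_space UNIV"
  shows "Measurable.pred M (\<lambda>x. labelled (mark F (yf x)) (cf x) (af x))"
proof -
  have one: "Measurable.pred M (\<lambda>x. Q (af x p))" for Q p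
    by (rule measurable_compose[OF a]) simp
  have two: "Measurable.pred M (\<lambda>x. Q (af x p) (af x q))" for Q p q
    by (rule measurable_compose_countable[OF one a])
  have marked: "Measurable.pred M (\<lambda>x. mark F (yf x) b)" for b
    by (rule measurable_compose[OF y mark_measurable])
  have [measurable]: "Measurable.pred M (\<lambda>x. mark F (yf x) b)" for b by (rule marked)
  have [measurable]: "Measurable.pred M (\<lambda>x. mark F (yf x) (fst (af x p)))" for p
    by (rule measurable_compose_countable[where f = "\<lambda>\<kappa> x. mark F (yf x) (fst \<kappa>)", OF marked a])
  have [measurable]: "Measurable.pred M (\<lambda>x. cf x p = snd (af x p) mod 2)" for p
  proof (rule measurable_compose_countable[where f = "\<lambda>\<kappa> x. cf x p = snd \<kappa> mod 2", OF _ a])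
    show "Measurable.pred M (\<lambda>x. cf x p = snd \<kappa> mod 2)" for \<kappa>
      by (rule measurable_compose[OF c]) simp
  qed
  have [measurable]: "Measurable.pred M (\<lambda>x. af x p \<in> classes)" "Measurable.pred M (\<lambda>x. af x p = \<kappa>)"
    "Measurable.pred M (\<lambda>x. snd (af x p) = 0)" for p \<kappa>
    by (rule one)+
  have [measurable]: "Measurable.pred M (\<lambda>x. af x p = af x q)"
    "Measurable.pred M (\<lambda>x. class_less (af x p) (af x q))" for p q
    by (rule two)+
  have eq: "range \<alpha> = classes \<longleftrightarrow> (\<forall>p. \<alpha> p \<in> classes) \<and> (\<forall>\<kappa>. \<kappa> \<in> classes \<longrightarrow> (\<exists>p. \<alpha> p = \<kappa>))"
    for \<alpha> :: "rat \<Rightarrow> int list \<times> nat"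
  proof -
    have "range \<alpha> = classes \<longleftrightarrow> (\<forall>p. \<alpha> p \<in> classes) \<and> (\<forall>\<kappa>. \<kappa> \<in> classes \<longrightarrow> \<kappa> \<in> range \<alpha>)" by blast
    moreover have "\<kappa> \<in> range \<alpha> \<longleftrightarrow> (\<exists>p. \<alpha> p = \<kappa>)" for \<kappa> by auto
    ultimately show ?thesis by simp
  qed
  show ?thesis unfolding labelled_def eq by measurable
qed

text \<open>The form in which coding delivers an arbitrary analytic quasi-order. For
  \<open>chain_limit\<close>, \<open>bit\<close> supplies the compactness and \<open>one\<close> the
  price of a link.\<close>

locale coded_quasi_order =
  fixes D :: "(nat \<Rightarrow> nat) set" and F :: "(((nat \<Rightarrow> nat) \<times> (nat \<Rightarrow> nat)) \<times> (nat \<Rightarrow> nat)) set"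
  assumes D: "D \<in> sets borel" and bit: "\<And>y i. y \<in> D \<Longrightarrow> y i \<le> 1"
    and closed: "closed F" and sub: "fst ` F \<subseteq> D \<times> D" and transitive: "trans (fst ` F)"
    and reflexive: "\<And>y. y \<in> D \<Longrightarrow> (y, y) \<in> fst ` F"
    and one: "\<And>p t. (p, t) \<in> F \<Longrightarrow> t 0 = 1"
begin

text \<open>An embedding yields chains of all levels with one witness, and their limit is equality
  or a pair of the relation. Conversely a witness shifts the canonical colouring of \<open>y\<close>
  into that of \<open>y'\<close>, and the given colourings are isomorphic to the canonical
  ones.\<close>

lemma embeds_iff:
  assumes lab: "labelled (mark F y) c \<alpha>" "labelled (mark F y') c' \<alpha>'" and y: "y \<in> D" "y' \<in> D"
  shows "(\<exists>g. dense_order_preserving g \<and> (\<forall>q. c q = c' (g q))) \<longleftrightarrow> (y, y') \<in> fst ` F"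
proof
  assume "\<exists>g. dense_order_preserving g \<and> (\<forall>q. c q = c' (g q))"
  then obtain g where "labelled_embedding (mark F y) c \<alpha> (mark F y') c' \<alpha>' g"
    using lab by (auto intro: labelled_embedding.intro)
  then obtain s where "\<And>n. chain F n y y' s" using embedding_imp_chain bit[OF y(1)] by blast
  then have "y = y' \<or> (y, y') \<in> fst ` F"
  proof (rule chain_limit[OF closed transitive, rotated 2])
    fix p r t assume F: "((p, r), t) \<in> F"
    then show "t 0 = 1" by (rule one)
    have "(p, r) \<in> D \<times> D" using F sub by force
    then show "r i \<le> 1" for i using bit by auto
  qed
  then show "(y, y') \<in> fst ` F" using reflexive y by auto
next
  assume "(y, y') \<in> fst ` F"
  then obtain t where "((y, y'), t) \<in> F" by force
  then obtain g where g: "dense_order_preserving g"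
    "\<And>q. colouring (mark F y) q = colouring (mark F y') (g q)"
    using colouring_embedding[of "mark F y" "mark F y'" "\<lambda>i. int (t i)"] mark_shift by blast
  obtain h where h: "bij h" "strict_mono h" "\<And>q. c q = colouring (mark F y) (h q)"
    using labelled_isomorphic[OF lab(1) labelled_colouring] by blast
  obtain k where k: "bij k" "strict_mono k" "\<And>q. colouring (mark F y') q = c' (k q)"
    using labelled_isomorphic[OF labelled_colouring lab(2)] by blast
  have "dense_order_preserving (\<lambda>q. k (g (h q)))"
    using dense_order_preserving_comp[OF dense_order_preserving_comp[OF
        dense_order_preserving_iso[OF h(1,2)] g(1)] dense_order_preserving_iso[OF k(1,2)]] .
  moreover have "c q = c' (k (g (h q)))" for q using g(2) h(3) k(3) by simp
  ultimately show "\<exists>g. dense_order_preserving g \<and> (\<forall>q. c q = c' (g q))" by blast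
qed

lemma label_unique:
  assumes "labelled (mark F y) c \<alpha>" "labelled (mark F y') c \<alpha>'" "y \<in> D"
  shows "\<alpha> = \<alpha>'" "y = y'"
proof -
  note u = labelled_unique[OF assms(1,2) mark_origin mark_origin]
  show "\<alpha> = \<alpha>'" by (rule u(1))
  show "y = y'" by (rule mark_inj[of F]) (use u(2) bit[OF assms(3)] one in auto)
qed

lemma decoding:
  obtains B \<delta> and \<rho> :: "nat \<Rightarrow> rat" where "B \<in> sets borel" "\<delta> \<in> borel \<rightarrow>\<^sub>M borel"
    "\<And>c. c \<circ> \<rho> \<in> B \<longleftrightarrow> (\<exists>y\<in>D. \<exists>\<alpha>. labelled (mark F y) c \<alpha>)"
    "\<And>c y \<alpha>. y \<in> D \<Longrightarrow> labelled (mark F y) c \<alpha> \<Longrightarrow> \<delta> (c \<circ> \<rho>) = y"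
proof -
  \<comment> \<open>Bijective enumerations make the decoding of colourings and labels injective, as
    the uniqueness of \<open>z\<close> demands.\<close>
  define \<rho> :: "nat \<Rightarrow> rat" where "\<rho> = from_nat_into UNIV"
  define \<kappa> :: "nat \<Rightarrow> int list \<times> nat" where "\<kappa> = from_nat_into UNIV"
  have "bij \<rho>" unfolding \<rho>_def by (rule bij_betw_from_nat_into) (auto simp: infinite_UNIV_char_0)
  then have \<rho>: "inv \<rho> (\<rho> n) = n" "\<rho> (inv \<rho> q) = q" for n q
    by (auto simp: bij_is_inj bij_is_surj surj_f_inv_f)
  have "infinite (UNIV :: (int list \<times> nat) set)" by (simp add: finite_prod)
  then have "bij \<kappa>" unfolding \<kappa>_def by (intro bij_betw_from_nat_into) auto
  then have \<kappa>: "inv \<kappa> (\<kappa> n) = n" "\<kappa> (inv \<kappa> q) = q" for n q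
    by (auto simp: bij_is_inj bij_is_surj surj_f_inv_f)
  \<comment> \<open>The even entries of the second sequence hold \<open>y\<close>, the odd ones the
    labels.\<close>
  define yf :: "(nat \<Rightarrow> nat) \<times> (nat \<Rightarrow> nat) \<Rightarrow> nat \<Rightarrow> nat" where "yf = (\<lambda>x i. snd x (2 * i))"
  define cf :: "(nat \<Rightarrow> nat) \<times> (nat \<Rightarrow> nat) \<Rightarrow> rat \<Rightarrow> nat" where "cf = (\<lambda>x q. fst x (inv \<rho> q))"
  define af where "af = (\<lambda>(x :: (nat \<Rightarrow> nat) \<times> (nat \<Rightarrow> nat)) q. \<kappa> (snd x (Suc (2 * inv \<rho> q))))"
  define P where "P = {x. yf x \<in> D \<and> labelled (mark F (yf x)) (cf x) (af x)}"
  let ?M = "(borel :: (nat \<Rightarrow> nat) measure) \<Otimes>\<^sub>M (borel :: (nat \<Rightarrow> nat) measure)"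
  have coord: "(\<lambda>x. snd x n) \<in> ?M \<rightarrow>\<^sub>M count_space UNIV" "(\<lambda>x. fst x n) \<in> ?M \<rightarrow>\<^sub>M count_space UNIV" for n
    by (rule measurable_compose[OF measurable_snd measurable_coordinate]
        measurable_compose[OF measurable_fst measurable_coordinate])+
  have yf: "yf \<in> ?M \<rightarrow>\<^sub>M borel"
    using coord(1) unfolding yf_def
    by (intro measurable_fun_borel) (simp add: measurable_cong_sets[OF refl sets_borel_eq_count_space])
  have "(\<lambda>x. cf x q) \<in> ?M \<rightarrow>\<^sub>M count_space UNIV" for q unfolding cf_def by (rule coord)
  moreover have "(\<lambda>x. af x q) \<in> ?M \<rightarrow>\<^sub>M count_space UNIV" for q
    unfolding af_def by (rule measurable_compose[OF coord(1)]) simp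
  ultimately have [measurable]: "Measurable.pred ?M (\<lambda>x. labelled (mark F (yf x)) (cf x) (af x))"
    by (rule labelled_measurable[OF yf])
  have [measurable]: "Measurable.pred ?M (\<lambda>x. yf x \<in> D)" by (rule pred_sets2[OF D yf])
  have "{x \<in> space ?M. yf x \<in> D \<and> labelled (mark F (yf x)) (cf x) (af x)} \<in> sets ?M" by measurable
  then have "P \<in> sets ?M" by (simp add: P_def space_pair_measure)
  then have P: "P \<in> sets borel" by (simp only: borel_prod)
  have P_I: "(c \<circ> \<rho>, \<lambda>n. if even n then y (n div 2) else inv \<kappa> (\<alpha> (\<rho> (n div 2)))) \<in> P"
    if "y \<in> D" "labelled (mark F y) c \<alpha>" for y c \<alpha>
    using that by (simp add: P_def yf_def cf_def af_def \<rho> \<kappa>)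
  have uniq: "z = z'" if z: "(v, z) \<in> P" "(v, z') \<in> P" for v z z'
  proof -
    have cf: "cf (v, z) = cf (v, z')" by (simp add: cf_def)
    have "labelled (mark F (yf (v, z))) (cf (v, z)) (af (v, z))"
      "labelled (mark F (yf (v, z'))) (cf (v, z)) (af (v, z'))" "yf (v, z) \<in> D"
      using z cf by (auto simp: P_def)
    note eq = label_unique[OF this]
    show "z = z'"
    proof
      fix n
      show "z n = z' n"
      proof (cases "even n")
        case True
        then show ?thesis using fun_cong[OF eq(2), of "n div 2"] by (simp add: yf_def)
      next
        case False
        then have "Suc (2 * (n div 2)) = n" by presburger
        then have "\<kappa> (z n) = \<kappa> (z' n)"
          using fun_cong[OF eq(1), of "\<rho> (n div 2)"] by (simp add: af_def \<rho>)
        then show ?thesis using \<kappa>(1) by metis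
      qed
    qed
  qed
  obtain \<psi> where \<psi>: "\<psi> \<in> borel \<rightarrow>\<^sub>M borel" "\<And>v z. (v, z) \<in> P \<Longrightarrow> \<psi> v = z" "fst ` P \<in> sets borel"
    by (rule Borel_unique_uniformization[OF P]) (erule (1) uniq, rule that)
  define \<delta> where "\<delta> = (\<lambda>v i. \<psi> v (2 * i))"
  have "(\<lambda>v. \<psi> v n) \<in> borel \<rightarrow>\<^sub>M count_space UNIV" for n
    by (rule measurable_compose[OF \<psi>(1) measurable_coordinate])
  then have "\<delta> \<in> borel \<rightarrow>\<^sub>M borel"
    unfolding \<delta>_def
    by (intro measurable_fun_borel) (simp add: measurable_cong_sets[OF refl sets_borel_eq_count_space])
  moreover have "c \<circ> \<rho> \<in> fst ` P \<longleftrightarrow> (\<exists>y\<in>D. \<exists>\<alpha>. labelled (mark F y) c \<alpha>)" for c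
  proof
    assume "c \<circ> \<rho> \<in> fst ` P"
    then obtain z where z: "(c \<circ> \<rho>, z) \<in> P" by force
    have "cf (c \<circ> \<rho>, z) = c" by (simp add: cf_def \<rho>)
    then show "\<exists>y\<in>D. \<exists>\<alpha>. labelled (mark F y) c \<alpha>" using z by (auto simp: P_def)
  next
    assume "\<exists>y\<in>D. \<exists>\<alpha>. labelled (mark F y) c \<alpha>"
    then show "c \<circ> \<rho> \<in> fst ` P" using P_I by force
  qed
  moreover have "\<delta> (c \<circ> \<rho>) = y" if "y \<in> D" "labelled (mark F y) c \<alpha>" for c y \<alpha>
    using \<psi>(2)[OF P_I[OF that]] by (simp add: \<delta>_def)
  ultimately show ?thesis using that[OF \<psi>(3)] by blast
qed

end

text \<open>On two incomparable colours a reflexive relation is equality. So this one statement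
  covers both claims, with the colours \<open>k0\<close> and \<open>k1\<close> in the roles of 0 and
  1.\<close>

theorem invariantly_universal_two_colours:
  fixes C :: "nat set"
  assumes R: "preorder_on C R" and k: "k0 \<in> C" "k1 \<in> C" "(k0, k1) \<notin> R" "(k1, k0) \<notin> R"
  shows "invariantly_universal TYPE('b) (rat_colourings C) (dop_le C R) (dop_iso C)"
proof -
  let ?X = "rat_colourings C"
  have reflR: "refl_on C R" using R by (simp add: preorder_on_def)
  have kk: "(k0, k0) \<in> R" "(k1, k1) \<in> R" "k0 \<noteq> k1" using reflR k by (auto simp: refl_on_def)
  have "\<exists>B\<in>sets ?X. dop_iso C `` B \<subseteq> B \<and> Borel_bireducible Y Q (restrict_space ?X B) (dop_le C R \<inter> B \<times> B)"
    if Y: "standard_Borel Y" and Q: "analytic_quasi_order Y Q" for Y :: "'b measure" and Q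
  proof -
    have Q': "Q \<subseteq> space Y \<times> space Y" "refl_on (space Y) Q" "trans Q" "analytic_in (Y \<Otimes>\<^sub>M Y) Q"
      using Q by (auto simp: analytic_quasi_order_def preorder_on_def)
    obtain e :: "'b \<Rightarrow> nat \<Rightarrow> nat" and D d where e: "e \<in> Y \<rightarrow>\<^sub>M borel" "D \<in> sets borel"
      "d \<in> restrict_space borel D \<rightarrow>\<^sub>M Y" "e ` space Y = D" "\<And>y. y \<in> space Y \<Longrightarrow> d (e y) = y"
      "\<And>y i. e y i \<le> 1"
      by (rule standard_Borel_code[OF Y]) (rule that)
    have "\<exists>F :: (((nat \<Rightarrow> nat) \<times> (nat \<Rightarrow> nat)) \<times> (nat \<Rightarrow> nat)) set.
        closed F \<and> fst ` F = map_prod e e ` Q \<and> (\<forall>p t. (p, t) \<in> F \<longrightarrow> t 0 = 1)"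
      by (rule analytic_imp_closed_code[OF Q'(4,1) e(2-5)])
    then obtain F :: "(((nat \<Rightarrow> nat) \<times> (nat \<Rightarrow> nat)) \<times> (nat \<Rightarrow> nat)) set"
      where F: "closed F" "fst ` F = map_prod e e ` Q" "\<forall>p t. (p, t) \<in> F \<longrightarrow> t 0 = 1"
      by (elim exE conjE)
    have e_inj: "x = y" if "x \<in> space Y" "y \<in> space Y" "e x = e y" for x y using e(5) that by metis
    have F_iff: "(e x, e y) \<in> fst ` F \<longleftrightarrow> (x, y) \<in> Q" if "x \<in> space Y" "y \<in> space Y" for x y
    proof
      assume "(e x, e y) \<in> fst ` F"
      then obtain x' y' where xy': "(x', y') \<in> Q" "e x = e x'" "e y = e y'" unfolding F(2) by auto
      then have "x' \<in> space Y" "y' \<in> space Y" using Q'(1) by auto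
      then have "x = x'" "y = y'" using xy' e_inj that by auto
      then show "(x, y) \<in> Q" using xy' by simp
    qed (force simp: F(2))
    interpret coded_quasi_order D F
    proof
      show "y i \<le> 1" if "y \<in> D" for y i using that e(4,6) by blast
      show "fst ` F \<subseteq> D \<times> D" unfolding F(2) using Q'(1) e(4) by auto
      show "trans (fst ` F)"
      proof (rule transI)
        fix u v w assume uv: "(u, v) \<in> fst ` F" "(v, w) \<in> fst ` F"
        then obtain x y y' z where xy: "(x, y) \<in> Q" "(y', z) \<in> Q" "u = e x" "v = e y" "v = e y'" "w = e z"
          unfolding F(2) by auto
        then have "y = y'" using Q'(1) e_inj by (metis SigmaD1 SigmaD2 subsetD)
        then have "(x, z) \<in> Q" using xy Q'(3) by (auto dest: transD)
        then show "(u, w) \<in> fst ` F" unfolding F(2) using xy by force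
      qed
      show "(y, y) \<in> fst ` F" if "y \<in> D" for y
      proof -
        obtain x where "x \<in> space Y" "y = e x" using \<open>y \<in> D\<close> e(4) by blast
        then show ?thesis using F_iff Q'(2) by (simp add: refl_on_def)
      qed
    qed (use e F in auto)
    obtain B0 \<delta> and \<rho> :: "nat \<Rightarrow> rat" where B0: "B0 \<in> sets borel" "\<delta> \<in> borel \<rightarrow>\<^sub>M borel"
      "\<And>c. c \<circ> \<rho> \<in> B0 \<longleftrightarrow> (\<exists>y\<in>D. \<exists>\<alpha>. labelled (mark F y) c \<alpha>)"
      "\<And>c y \<alpha>. y \<in> D \<Longrightarrow> labelled (mark F y) c \<alpha> \<Longrightarrow> \<delta> (c \<circ> \<rho>) = y"
      by (rule decoding) (rule that)
    \<comment> \<open>Colours other than \<open>k1\<close> decode to 0; \<open>B\<close> admits only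
      \<open>k0\<close> and \<open>k1\<close>, which \<open>dec\<close> distinguishes.\<close>
    define dec where "dec = (\<lambda>(c :: rat \<Rightarrow> nat) q. if c q = k1 then 1 else 0 :: nat)"
    define enc where "enc = (\<lambda>(b :: rat \<Rightarrow> nat) q. if b q = 0 then k0 else k1)"
    define B where "B = {c \<in> space ?X. (\<forall>q. c q = k0 \<or> c q = k1) \<and> dec c \<circ> \<rho> \<in> B0}"
    have [measurable]: "Measurable.pred ?X (\<lambda>c. c q = r)" for q r
      by (rule measurable_compose[OF rat_colourings_coordinate]) simp
    have dec_m: "(\<lambda>c. dec c \<circ> \<rho>) \<in> ?X \<rightarrow>\<^sub>M borel"
    proof (rule measurable_fun_borel)
      show "(\<lambda>c. (dec c \<circ> \<rho>) n) \<in> borel_measurable ?X" for n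
        unfolding dec_def o_def by measurable
    qed
    have [measurable]: "Measurable.pred ?X (\<lambda>c. dec c \<circ> \<rho> \<in> B0)" by (rule pred_sets2[OF B0(1) dec_m])
    have B: "B \<in> sets ?X" unfolding B_def by measurable
    have le_iff: "(c, c') \<in> dop_le C R \<longleftrightarrow> (\<exists>g. dense_order_preserving g \<and> (\<forall>q. dec c q = dec c' (g q)))"
      if c: "c \<in> space ?X" "c' \<in> space ?X" "\<And>q. c q = k0 \<or> c q = k1" "\<And>q. c' q = k0 \<or> c' q = k1" for c c'
    proof -
      have "(c q, c' r) \<in> R \<longleftrightarrow> dec c q = dec c' r" for q r
        using c(3)[of q] c(4)[of r] k(3,4) kk by (auto simp: dec_def)
      then show ?thesis using c(1,2) by (simp add: dop_le_def space_rat_colourings)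
    qed
    have B_D: "\<exists>y\<in>space Y. \<exists>\<alpha>. labelled (mark F (e y)) (dec c) \<alpha> \<and> \<delta> (dec c \<circ> \<rho>) = e y" if "c \<in> B" for c
      using that B0(3,4) e(4) by (fastforce simp: B_def)
    have inv: "dop_iso C `` B \<subseteq> B"
    proof
      fix c' assume "c' \<in> dop_iso C `` B"
      then obtain c h where c: "c \<in> B" and h: "bij h" "strict_mono h" "\<And>q. c q = c' (h q)" "c' \<in> UNIV \<rightarrow> C"
        unfolding dop_iso_def by blast
      obtain y \<alpha> where "y \<in> space Y" "labelled (mark F (e y)) (dec c) \<alpha>" using B_D[OF c] by blast
      moreover have "dec c q = dec c' (h q)" for q by (simp add: dec_def h(3))
      ultimately have "\<exists>\<alpha>. labelled (mark F (e y)) (dec c') \<alpha>" using labelled_transport h(1,2) by blast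
      then have "dec c' \<circ> \<rho> \<in> B0" using B0(3) e(4) \<open>y \<in> space Y\<close> by blast
      moreover have "c' q = k0 \<or> c' q = k1" for q
      proof -
        obtain p where "q = h p" using h(1) by (metis bij_pointE)
        moreover have "c p = k0 \<or> c p = k1" using c by (simp add: B_def)
        ultimately show ?thesis using h(3)[of p] by simp
      qed
      ultimately show "c' \<in> B" using h(4) by (simp add: B_def space_rat_colourings)
    qed
    define \<phi> where "\<phi> = (\<lambda>y. enc (colouring (mark F (e y))))"
    have dec_\<phi>: "dec (\<phi> y) = colouring (mark F (e y))" for y
      using kk(3) by (auto simp: dec_def \<phi>_def enc_def colouring_def fun_eq_iff)
    have lab_\<phi>: "labelled (mark F (e y)) (dec (\<phi> y)) (label (mark F (e y)))" for y
      unfolding dec_\<phi> by (rule labelled_colouring)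
    have \<phi>_space: "\<phi> y \<in> space ?X" for y using k by (simp add: \<phi>_def enc_def space_rat_colourings)
    have \<phi>_k: "\<phi> y q = k0 \<or> \<phi> y q = k1" for y q by (simp add: \<phi>_def enc_def)
    have \<phi>_B: "\<phi> y \<in> B" if "y \<in> space Y" for y
    proof -
      have "dec (\<phi> y) \<circ> \<rho> \<in> B0" using B0(3) lab_\<phi> e(4) that by blast
      then show ?thesis using \<phi>_space \<phi>_k by (simp add: B_def)
    qed
    have "Borel_reducible Y Q (restrict_space ?X B) (dop_le C R \<inter> B \<times> B)"
      unfolding Borel_reducible_def
    proof (intro bexI[of _ \<phi>] ballI)
      fix x y assume xy: "x \<in> space Y" "y \<in> space Y"
      have "(\<phi> x, \<phi> y) \<in> dop_le C R \<longleftrightarrow> (e x, e y) \<in> fst ` F"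
        using le_iff[OF \<phi>_space \<phi>_space \<phi>_k \<phi>_k] embeds_iff[OF lab_\<phi> lab_\<phi>] xy e(4) by blast
      then show "(x, y) \<in> Q \<longleftrightarrow> (\<phi> x, \<phi> y) \<in> dop_le C R \<inter> B \<times> B" using F_iff[OF xy] \<phi>_B xy by simp
    next
      show "\<phi> \<in> Y \<rightarrow>\<^sub>M restrict_space ?X B"
      proof (rule measurable_restrict_space2)
        show "\<phi> \<in> Y \<rightarrow>\<^sub>M ?X"
        proof (rule measurable_rat_colourings)
          fix q
          have [measurable]: "Measurable.pred Y (\<lambda>y. mark F (e y) a)" for a
            by (rule measurable_compose[OF e(1) mark_measurable])
          show "(\<lambda>y. \<phi> y q) \<in> Y \<rightarrow>\<^sub>M count_space UNIV"
            unfolding \<phi>_def enc_def colouring_def label_def case_prod_beta by measurable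
        qed (use \<phi>_space in \<open>simp add: space_rat_colourings\<close>)
      qed (use \<phi>_B in auto)
    qed
    moreover have "Borel_reducible (restrict_space ?X B) (dop_le C R \<inter> B \<times> B) Y Q"
      unfolding Borel_reducible_def
    proof (intro bexI[of _ "\<lambda>c. d (\<delta> (dec c \<circ> \<rho>))"] ballI)
      fix c c' assume "c \<in> space (restrict_space ?X B)" "c' \<in> space (restrict_space ?X B)"
      then have c: "c \<in> B" "c' \<in> B" by (auto simp: space_restrict_space)
      obtain y \<alpha> where y: "y \<in> space Y" "labelled (mark F (e y)) (dec c) \<alpha>" "\<delta> (dec c \<circ> \<rho>) = e y"
        using B_D[OF c(1)] by blast
      obtain y' \<alpha>' where y': "y' \<in> space Y" "labelled (mark F (e y')) (dec c') \<alpha>'" "\<delta> (dec c' \<circ> \<rho>) = e y'"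
        using B_D[OF c(2)] by blast
      have "(c, c') \<in> dop_le C R \<longleftrightarrow> (e y, e y') \<in> fst ` F"
        using le_iff[of c c'] embeds_iff[OF y(2) y'(2)] c y(1) y'(1) e(4) by (auto simp: B_def)
      then show "(c, c') \<in> dop_le C R \<inter> B \<times> B \<longleftrightarrow> (d (\<delta> (dec c \<circ> \<rho>)), d (\<delta> (dec c' \<circ> \<rho>))) \<in> Q"
        using c y(1,3) y'(1,3) F_iff[OF y(1) y'(1)] e(5) by simp
    next
      have "(\<lambda>c. \<delta> (dec c \<circ> \<rho>)) \<in> restrict_space ?X B \<rightarrow>\<^sub>M restrict_space borel D"
      proof (rule measurable_restrict_space2)
        show "(\<lambda>c. \<delta> (dec c \<circ> \<rho>)) \<in> restrict_space ?X B \<rightarrow>\<^sub>M borel"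
          by (rule measurable_restrict_space1[OF measurable_compose[OF dec_m B0(2)]])
        show "(\<lambda>c. \<delta> (dec c \<circ> \<rho>)) \<in> space (restrict_space ?X B) \<rightarrow> D"
          using B_D e(4) by (fastforce simp: space_restrict_space)
      qed
      then show "(\<lambda>c. d (\<delta> (dec c \<circ> \<rho>))) \<in> restrict_space ?X B \<rightarrow>\<^sub>M Y"
        by (rule measurable_compose[OF _ e(3)])
    qed
    ultimately show ?thesis using B inv by (auto simp: Borel_bireducible_def)
  qed
  moreover have "dop_iso C \<subseteq> dop_le C R \<inter> (dop_le C R)\<inverse>"
    using dop_iso_subset_dop_le[OF reflR] dop_iso_sym[of _ _ C] by auto
  ultimately show ?thesis
    unfolding invariantly_universal_def
    using standard_Borel_rat_colourings dop_le_analytic_quasi_order[OF R] dop_iso_analytic_equivalence by blast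
qed

theorem theorem5p14:
  shows "invariantly_universal TYPE('b) (rat_colourings {0, 1 :: nat})
           (dop_le {0, 1} (Id_on {0, 1})) (dop_iso {0, 1})
       \<and> (\<forall>R :: nat rel. preorder_on UNIV R \<and> (\<exists>m n. (m, n) \<notin> R \<and> (n, m) \<notin> R) \<longrightarrow>
            invariantly_universal TYPE('b) (rat_colourings UNIV) (dop_le UNIV R) (dop_iso UNIV))"
proof (intro conjI allI impI)
  have "preorder_on {0, 1 :: nat} (Id_on {0, 1})"
    by (auto simp: preorder_on_def refl_on_def trans_def)
  then show "invariantly_universal TYPE('b) (rat_colourings {0, 1 :: nat})
      (dop_le {0, 1} (Id_on {0, 1})) (dop_iso {0, 1})"
    by (rule invariantly_universal_two_colours[of _ _ 0 1]) auto
next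
  fix R :: "nat rel"
  assume "preorder_on UNIV R \<and> (\<exists>m n. (m, n) \<notin> R \<and> (n, m) \<notin> R)"
  then obtain m n where "preorder_on UNIV R" "(m, n) \<notin> R" "(n, m) \<notin> R" by blast
  then show "invariantly_universal TYPE('b) (rat_colourings UNIV) (dop_le UNIV R) (dop_iso UNIV)"
    by (intro invariantly_universal_two_colours[of _ _ m n]) auto
qed

end
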